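(* Let $\lambda>1$ be dyadic and $d\in\{1,2\}$. Then, for all $t\ne0$ and $f\in L^1(\mathbb{R}^d)$, we have the estimate $$\|S_{m_d}(\pm t)f_\lambda\|_{L^\infty_x(\mathbb{R}^d)}\lesssim\lambda^{3d/4}|t|^{-d/2}\|f\|_{L^1_x(\mathbb{R}^d)}.$$
   Context: $S_{m_d}(\pm t)=e^{\mp itm_d(D)}$ is the Fourier multiplier operator with symbol $e^{\mp itm_d(\xi)}$, where $D=-i\nabla$ and $m_1(\xi)=\xi\sqrt{\tanh\xi/\xi}$ for $\xi\in\mathbb{R}$, $m_2(\xi)=|\xi|\sqrt{\tanh|\xi|/|\xi|}$ for $\xi\in\mathbb{R}^2$. A dyadic number is one of the form $2^k$, $k\in\mathbb{Z}$. Fix an even function $\chi\in C_0^\infty((-2,2))$ with $\chi(s)=1$ for $|s|\le1$; let $\beta(s)=\chi(s)-\chi(2s)$ and $\beta_\lambda(s)=\beta(s/\lambda)$. For dyadic $\lambda>1$, $f_\lambda=P_\lambda f$ is defined by $\widehat{P_\lambda f}(\xi)=\beta_\lambda(|\xi|)\widehat f(\xi)$. The notation $A\lesssim B$ means $A\le CB$ with a constant $C>0$ independent of $\lambda$, $t$ and $f$. *)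

theory Defs
  imports "HOL-Analysis.Analysis" "HOL-Probability.Essential_Supremum"
begin

text \<open>Fourier transform with the unnormalised convention, so that the multiplier with
  symbol \<open>p\<close> is \<open>p(D)\<close> for \<open>D = -i\<nabla>\<close>; the inverse transform carries the factor
  \<open>(2\<pi>)\<close> to the power minus the dimension.\<close>

definition fourier :: "('a::euclidean_space \<Rightarrow> complex) \<Rightarrow> 'a \<Rightarrow> complex" where
  "fourier f \<xi> = (LINT x|lborel. cis (- (x \<bullet> \<xi>)) * f x)"

definition inv_fourier :: "('a::euclidean_space \<Rightarrow> complex) \<Rightarrow> 'a \<Rightarrow> complex" where
  "inv_fourier g x =
     (1 / (2 * pi) ^ DIM('a)) *\<^sub>R (LINT \<xi>|lborel. cis (x \<bullet> \<xi>) * g \<xi>)"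

text \<open>Both transforms are Lebesgue integrals, so the operator below has its intended meaning
  when \<open>f\<close> and \<open>\<lambda>\<xi>. p \<xi> * fourier f \<xi>\<close> are integrable. This covers all uses made of it:
  frequency localisation of an integrable function, and a unimodular symbol applied to a
  frequency-localised integrable function.\<close>

definition fourier_multiplier ::
    "('a::euclidean_space \<Rightarrow> complex) \<Rightarrow> ('a \<Rightarrow> complex) \<Rightarrow> 'a \<Rightarrow> complex" where
  "fourier_multiplier p f = inv_fourier (\<lambda>\<xi>. p \<xi> * fourier f \<xi>)"

definition propagator ::
    "('a::euclidean_space \<Rightarrow> real) \<Rightarrow> real \<Rightarrow> ('a \<Rightarrow> complex) \<Rightarrow> 'a \<Rightarrow> complex" where
  "propagator m t = fourier_multiplier (\<lambda>\<xi>. exp (- \<i> * of_real (t * m \<xi>)))"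

text \<open>Since \<open>0 / 0 = 0\<close>, both symbols vanish at the origin, which is their continuous value.\<close>

definition m1 :: "real \<Rightarrow> real" where
  "m1 \<xi> = \<xi> * sqrt (tanh \<xi> / \<xi>)"

definition m2 :: "real ^ 2 \<Rightarrow> real" where
  "m2 \<xi> = norm \<xi> * sqrt (tanh (norm \<xi>) / norm \<xi>)"

definition cutoff :: "(real \<Rightarrow> real) \<Rightarrow> bool" where
  "cutoff chi \<longleftrightarrow>
     (\<forall>n. ((deriv ^^ n) chi) differentiable_on UNIV) \<and>
     closure {s. chi s \<noteq> 0} \<subseteq> {-2<..<2} \<and>
     (\<forall>s. chi (- s) = chi s) \<and>
     (\<forall>s. \<bar>s\<bar> \<le> 1 \<longrightarrow> chi s = 1)"

definition dyadic :: "real \<Rightarrow> bool" where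
  "dyadic L \<longleftrightarrow> (\<exists>k::int. L = 2 powi k)"

definition bump :: "(real \<Rightarrow> real) \<Rightarrow> real \<Rightarrow> real" where
  "bump chi s = chi s - chi (2 * s)"

definition freq_proj ::
    "(real \<Rightarrow> real) \<Rightarrow> real \<Rightarrow> ('a::euclidean_space \<Rightarrow> complex) \<Rightarrow> 'a \<Rightarrow> complex" where
  "freq_proj chi L = fourier_multiplier (\<lambda>\<xi>. of_real (bump chi (norm \<xi> / L)))"

definition L1_norm :: "('a::euclidean_space \<Rightarrow> complex) \<Rightarrow> real" where
  "L1_norm f = (LINT x|lborel. norm (f x))"

text \<open>\<open>esssup\<close> is \<open>\<infinity>\<close> on non-measurable functions, so a finite bound on the norm below
  includes measurability.\<close>

definition Linf_norm :: "('a::euclidean_space \<Rightarrow> complex) \<Rightarrow> ereal" where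
  "Linf_norm g = esssup lborel (\<lambda>x. ereal (norm (g x)))"

end

theory Submission
  imports Defs "HOL-Probability.Probability"
begin

text \<open>Write \<open>b\<close> for the annular cutoff \<open>bump chi (norm \<xi> / L)\<close> and \<open>\<mu>\<close> for the symbol. The
function \<open>freq_proj chi L f\<close> is the convolution of \<open>f\<close> with the inverse transform of \<open>b\<close>. That kernel
is integrable because \<open>b\<close> is smooth, so Fourier inversion shows that the Fourier transform of
\<open>freq_proj chi L f\<close> is \<open>b\<close> times that of \<open>f\<close>. The propagated function is then the convolution
of \<open>f\<close> with the inverse transform \<open>I\<close> of \<open>exp (- i s \<mu>) b\<close>, and the estimate follows from
\<open>sup \<bar>I\<bar> \<lesssim> L powr (3 d / 4) * \<bar>s\<bar> powr (- d / 2)\<close>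
(\<open>Linf_norm_propagator_freq_proj_le\<close>).

On the support of \<open>b\<close> one has \<open>\<bar>\<xi>\<bar> \<ge> 1\<close>, because a dyadic number above 1 is at least 2. There both
symbols are, up to sign, the function \<open>disp r = sqrt (r * tanh r)\<close> of \<open>r = \<bar>\<xi>\<bar>\<close>, whose first
derivative is at least a multiple of \<open>r powr (- 1 / 2)\<close> and whose second derivative is at most a
negative multiple of \<open>r powr (- 3 / 2)\<close> (\<open>disp'_ge\<close>, \<open>disp''_le\<close>). In one dimension van der
Corput's second derivative test, with lower bound \<open>\<bar>s\<bar> L powr (- 3 / 2)\<close> for the second derivative
of the phase, gives the bound \<open>L powr (3 / 4) * \<bar>s\<bar> powr (- 1 / 2)\<close>.

In two dimensions, rotate \<open>x\<close> to the first axis and use polar coordinates: \<open>I x\<close> becomes an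
integral over the angle \<open>\<theta>\<close> of the radial oscillatory integrals \<open>R (X * cos \<theta>)\<close>, where
\<open>X = norm x\<close> and \<open>R y\<close> has the phase \<open>y * r - s * disp r\<close> and an amplitude of size \<open>L\<close>. The second
derivative of this phase in \<open>r\<close> does not depend on \<open>y\<close>, so the second derivative test applies
uniformly in \<open>\<theta>\<close>.

\<^item> If \<open>X\<close> is small compared with \<open>\<bar>s\<bar> / sqrt L\<close>, the first derivative of the phase never vanishes, and
  the first derivative test gives \<open>L powr (3 / 2) / \<bar>s\<bar>\<close> for each angle.
\<^item> Otherwise the second derivative test alone loses a factor of at most order \<open>sqrt (L * X)\<close>. If \<open>L * X < 1\<close>,
  then \<open>\<bar>s\<bar>\<close> is at most of order \<open>L powr (- 1 / 2)\<close> and nothing is lost. For \<open>L * X \<ge> 1\<close> the factor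
  is recovered from the angle. Put \<open>\<delta> = 1 / sqrt (L * X)\<close>. The angles within \<open>\<delta>\<close> of the axis contribute at most \<open>\<delta>\<close> times
  the radial bound. At the other angles, integrate by parts in \<open>\<theta>\<close> for fixed \<open>r\<close>, and only
  afterwards apply the second derivative test in \<open>r\<close>; the resulting weight
  \<open>cos \<theta> / (sin \<theta>)\<^sup>2\<close> has integral of order \<open>1 / \<delta>\<close> (\<open>angular_integral_bound\<close>).\<close>

section \<open>Convolution and the Fourier transform\<close>

lemma borel_measurable_cis [measurable]: "cis \<in> borel_measurable borel"
  by (intro borel_measurable_continuous_onI continuous_intros)

lemma integrable_cis_mult:
  assumes "integrable M g" "\<phi> \<in> borel_measurable M"
  shows "integrable M (\<lambda>x. cis (\<phi> x) * g x)"
proof (rule Bochner_Integration.integrable_bound[OF assms(1)])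
  show "(\<lambda>x. cis (\<phi> x) * g x) \<in> borel_measurable M"
    using assms by (measurable)
qed (simp add: norm_mult)

lemma integrable_pair_product:
  fixes f :: "'a::euclidean_space \<Rightarrow> complex" and g :: "'b::euclidean_space \<Rightarrow> complex"
  assumes f: "integrable lborel f" and g: "integrable lborel g"
  shows "integrable (lborel \<Otimes>\<^sub>M lborel) (\<lambda>(x, y). f x * g y)"
proof (rule lborel_pair.Fubini_integrable)
  have [measurable]: "f \<in> borel_measurable borel" "g \<in> borel_measurable borel"
    using f g by auto
  show "(\<lambda>(x, y). f x * g y) \<in> borel_measurable (lborel \<Otimes>\<^sub>M lborel)" by measurable
qed (use f g in \<open>auto simp: norm_mult\<close>)

lemma integrable_lborel_translate:
  fixes g :: "'a::euclidean_space \<Rightarrow> complex"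
  assumes "integrable lborel g"
  shows "integrable lborel (\<lambda>x. g (c + x))" "(LINT x|lborel. g (c + x)) = (LINT x|lborel. g x)"
proof -
  have "integrable (distr lborel borel ((+) c)) g"
    using assms by (simp add: lborel_distr_plus)
  then show "integrable lborel (\<lambda>x. g (c + x))"
    by (subst (asm) integrable_distr_eq) (use assms in auto)
  have "(LINT x|lborel. g x) = (LINT x|distr lborel borel ((+) c). g x)"
    by (simp add: lborel_distr_plus)
  also have "\<dots> = (LINT x|lborel. g (c + x))"
    by (subst integral_distr) (use assms in auto)
  finally show "(LINT x|lborel. g (c + x)) = (LINT x|lborel. g x)" ..
qed

lemma cis_inner_diff: "cis ((x - y) \<bullet> \<xi>) = cis (x \<bullet> \<xi>) * cis (- (y \<bullet> \<xi>))"
  by (simp add: cis_mult inner_diff_left)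

definition convol :: "('a::euclidean_space \<Rightarrow> complex) \<Rightarrow> ('a \<Rightarrow> complex) \<Rightarrow> 'a \<Rightarrow> complex" where
  "convol K f x = (LINT y|lborel. f y * K (x - y))"

text \<open>By Fubini's theorem, the integral defining the transform of \<open>f\<close> may be taken outside the frequency
integral, since \<open>h\<close> and \<open>f\<close> are both integrable.\<close>

lemma fourier_multiplier_eq_convol:
  fixes f h :: "'a::euclidean_space \<Rightarrow> complex"
  assumes h: "integrable lborel h" and f: "integrable lborel f"
  shows "fourier_multiplier h f = convol (inv_fourier h) f"
proof
  fix x :: 'a
  have [measurable]: "f \<in> borel_measurable borel" "h \<in> borel_measurable borel"
    using f h by auto
  have int: "integrable (lborel \<Otimes>\<^sub>M lborel) (\<lambda>(\<xi>, y). cis ((x - y) \<bullet> \<xi>) * (h \<xi> * f y))"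
    using integrable_cis_mult[OF integrable_pair_product[OF h f], of "\<lambda>(\<xi>, y). (x - y) \<bullet> \<xi>"]
    by (simp add: case_prod_unfold)
  have "(LINT \<xi>|lborel. cis (x \<bullet> \<xi>) * (h \<xi> * fourier f \<xi>)) =
        (LINT \<xi>|lborel. LINT y|lborel. cis ((x - y) \<bullet> \<xi>) * (h \<xi> * f y))"
    unfolding fourier_def
    by (simp flip: integral_mult_right_zero add: cis_inner_diff mult_ac)
  also have "\<dots> = (LINT y|lborel. LINT \<xi>|lborel. cis ((x - y) \<bullet> \<xi>) * (h \<xi> * f y))"
    using lborel_pair.Fubini_integral[OF int] by simp
  also have "\<dots> = (LINT y|lborel. f y * (LINT \<xi>|lborel. cis ((x - y) \<bullet> \<xi>) * h \<xi>))"
    by (simp flip: integral_mult_right_zero add: mult_ac)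
  finally show "fourier_multiplier h f x = convol (inv_fourier h) f x"
    unfolding fourier_multiplier_def convol_def inv_fourier_def
    by (simp add: mult_ac)
qed

text \<open>Exchange the integrals and shift the inner variable by \<open>y\<close>; the shift produces the phase that turns the
outer integral into the transform of \<open>f\<close>.\<close>

lemma fourier_convol:
  fixes K f :: "'a::euclidean_space \<Rightarrow> complex"
  assumes K: "integrable lborel K" and f: "integrable lborel f"
  shows "fourier (convol K f) \<xi> = fourier K \<xi> * fourier f \<xi>"
proof -
  have [measurable]: "f \<in> borel_measurable borel" "K \<in> borel_measurable borel"
    using f K by auto
  have K': "integrable lborel (\<lambda>x. K (x - y))" for y
    using integrable_lborel_translate(1)[OF K, of "-y"] by simp
  have nK: "(LINT x|lborel. norm (K (x - y))) = (LINT x|lborel. norm (K x))" for y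
    using integrable_lborel_translate(2)[of "\<lambda>x. complex_of_real (norm (K x))" "-y"] K by simp
  have int: "integrable (lborel \<Otimes>\<^sub>M lborel) (\<lambda>(y, x). f y * K (x - y))"
    by (rule lborel_pair.Fubini_integrable) (use f K' in \<open>auto simp: norm_mult nK\<close>)
  have int': "integrable (lborel \<Otimes>\<^sub>M lborel) (\<lambda>(y, x). cis (- (x \<bullet> \<xi>)) * (f y * K (x - y)))"
    using integrable_cis_mult[OF int, of "\<lambda>(y, x). - (x \<bullet> \<xi>)"]
    by (simp add: case_prod_unfold)
  have cK: "integrable lborel (\<lambda>x. cis (- (x \<bullet> \<xi>)) * K x)"
    by (rule integrable_cis_mult[OF K]) simp
  have "fourier (convol K f) \<xi> =
      (LINT x|lborel. LINT y|lborel. cis (- (x \<bullet> \<xi>)) * (f y * K (x - y)))"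
    unfolding fourier_def convol_def by (simp flip: integral_mult_right_zero)
  also have "\<dots> = (LINT y|lborel. LINT x|lborel. cis (- (x \<bullet> \<xi>)) * (f y * K (x - y)))"
    using lborel_pair.Fubini_integral[OF int'] by simp
  also have "\<dots> = (LINT y|lborel. cis (- (y \<bullet> \<xi>)) * f y * fourier K \<xi>)"
  proof (rule Bochner_Integration.integral_cong[OF refl])
    fix y :: 'a
    have "(LINT x|lborel. cis (- (x \<bullet> \<xi>)) * (f y * K (x - y))) =
          (LINT x|lborel. (cis (- (y \<bullet> \<xi>)) * f y) * (cis (- ((x - y) \<bullet> \<xi>)) * K (x - y)))"
    proof (rule Bochner_Integration.integral_cong[OF refl])
      fix x
      have "cis (- (x \<bullet> \<xi>)) = cis (- (y \<bullet> \<xi>)) * cis (- ((x - y) \<bullet> \<xi>))"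
        by (simp add: cis_mult inner_diff_left)
      then show "cis (- (x \<bullet> \<xi>)) * (f y * K (x - y)) =
          (cis (- (y \<bullet> \<xi>)) * f y) * (cis (- ((x - y) \<bullet> \<xi>)) * K (x - y))"
        by simp
    qed
    also have "\<dots> = (cis (- (y \<bullet> \<xi>)) * f y) * (LINT x|lborel. cis (- ((x - y) \<bullet> \<xi>)) * K (x - y))"
      by simp
    also have "(LINT x|lborel. cis (- ((x - y) \<bullet> \<xi>)) * K (x - y)) = fourier K \<xi>"
      using integrable_lborel_translate(2)[OF cK, of "-y"] by (simp add: fourier_def)
    finally show "(LINT x|lborel. cis (- (x \<bullet> \<xi>)) * (f y * K (x - y))) =
        cis (- (y \<bullet> \<xi>)) * f y * fourier K \<xi>" .
  qed
  also have "\<dots> = fourier K \<xi> * fourier f \<xi>"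
    by (simp add: fourier_def[of f] mult.commute[of "fourier K \<xi>"])
  finally show "fourier (convol K f) \<xi> = fourier K \<xi> * fourier f \<xi>" .
qed

section \<open>Gaussian regularisation and Fourier inversion\<close>

text \<open>By the characteristic function of the standard normal distribution.\<close>

lemma gaussian_fourier_real:
  fixes z :: real
  shows "integrable lborel (\<lambda>x. cis (x * z) * of_real (exp (- x\<^sup>2 / 2)))"
    and "(LINT x|lborel. cis (x * z) * of_real (exp (- x\<^sup>2 / 2))) = of_real (sqrt (2 * pi) * exp (- z\<^sup>2 / 2))"
proof -
  have e: "complex_of_real (exp (- x\<^sup>2 / 2)) = of_real (sqrt (2 * pi)) * of_real (std_normal_density x)" for x
    by (simp add: std_normal_density_def)
  have i: "integrable lborel (\<lambda>x. complex_of_real (std_normal_density x))"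
    using integrable_std_normal_moment[of 0] by simp
  have i2: "integrable lborel (\<lambda>x. cis (x * z) * complex_of_real (std_normal_density x))"
    by (rule integrable_cis_mult[OF i]) simp
  show "integrable lborel (\<lambda>x. cis (x * z) * of_real (exp (- x\<^sup>2 / 2)))"
    unfolding e using integrable_mult_right[OF i2, of "of_real (sqrt (2 * pi))"]
    by (simp add: mult_ac)
  have "(LINT x|lborel. cis (x * z) * complex_of_real (std_normal_density x)) = char std_normal_distribution z"
    unfolding char_def
    by (subst integral_density)
      (auto simp: normal_density_nonneg cis_conv_exp scaleR_conv_of_real mult_ac intro!: Bochner_Integration.integral_cong)
  then show "(LINT x|lborel. cis (x * z) * of_real (exp (- x\<^sup>2 / 2))) = of_real (sqrt (2 * pi) * exp (- z\<^sup>2 / 2))"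
    unfolding e by (simp add: char_std_normal_distribution mult.left_commute[of "cis _" "of_real (sqrt (2 * pi))"])
qed

text \<open>The Lebesgue measure on a Euclidean space is the image of a product measure, so integrals of
tensor products factor. This reduces the transform of a Gaussian to one dimension and gives
integrable majorants for kernels.\<close>

lemma lborel_prod_Basis:
  fixes f :: "'a::euclidean_space \<Rightarrow> real \<Rightarrow> complex"
  assumes "\<And>b. b \<in> Basis \<Longrightarrow> integrable lborel (f b)"
  shows "integrable lborel (\<lambda>x::'a. \<Prod>b\<in>Basis. f b (x \<bullet> b))"
    and "(LINT x|lborel. (\<Prod>b\<in>Basis. f b (x \<bullet> b))) = (\<Prod>b\<in>Basis. LINT x|lborel. f b x)"
proof -
  interpret product_sigma_finite "\<lambda>_::'a. lborel :: real measure" ..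
  have [measurable]: "\<And>b. b \<in> Basis \<Longrightarrow> f b \<in> borel_measurable borel" using assms by auto
  have m: "(\<lambda>x::'a. \<Prod>b\<in>Basis. f b (x \<bullet> b)) \<in> borel_measurable borel" by measurable
  have m2: "(\<lambda>g. \<Sum>b\<in>Basis. g b *\<^sub>R b) \<in> (\<Pi>\<^sub>M b\<in>(Basis::'a set). (lborel::real measure)) \<rightarrow>\<^sub>M borel"
    by measurable
  have s: "(\<Sum>b\<in>Basis. g b *\<^sub>R b) \<bullet> c = g c" if "c \<in> Basis" for g and c :: 'a
    using that by simp
  show "integrable lborel (\<lambda>x::'a. \<Prod>b\<in>Basis. f b (x \<bullet> b))"
    unfolding lborel_eq[where 'a='a]
    by (subst integrable_distr_eq[OF m2 m])
       (use product_integrable_prod[of Basis f] assms in \<open>simp cong: prod.cong\<close>)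
  show "(LINT x|lborel. (\<Prod>b\<in>Basis. f b (x \<bullet> b))) = (\<Prod>b\<in>Basis. LINT x|lborel. f b x)"
    unfolding lborel_eq[where 'a='a]
    by (subst integral_distr[OF m2 m])
       (use product_integral_prod[of Basis f] assms in \<open>simp cong: prod.cong\<close>)
qed

definition gaussian :: "'a::euclidean_space \<Rightarrow> complex" where
  "gaussian x = of_real (exp (- (norm x)\<^sup>2 / 2))"

lemma gaussian_fourier:
  fixes z :: "'a::euclidean_space"
  shows "integrable lborel (\<lambda>x. cis (x \<bullet> z) * gaussian x)"
    and "(LINT x|lborel. cis (x \<bullet> z) * gaussian x) = of_real (sqrt (2 * pi) ^ DIM('a)) * gaussian z"
proof -
  have n: "(norm x)\<^sup>2 = (\<Sum>b\<in>Basis. (x \<bullet> b)\<^sup>2)" for x :: 'a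
    unfolding power2_norm_eq_inner by (subst euclidean_inner) (simp add: power2_eq_square)
  have g: "gaussian x = (\<Prod>b\<in>Basis. of_real (exp (- (x \<bullet> b)\<^sup>2 / 2)))" for x :: 'a
  proof -
    have "- (norm x)\<^sup>2 / 2 = (\<Sum>b\<in>Basis. - (x \<bullet> b)\<^sup>2 / 2)"
      unfolding n by (simp add: sum_negf sum_divide_distrib)
    then show ?thesis by (simp only: gaussian_def exp_sum[OF finite_Basis] of_real_prod)
  qed
  have c: "cis (x \<bullet> z) = (\<Prod>b\<in>Basis. cis ((x \<bullet> b) * (z \<bullet> b)))" for x :: 'a
    by (subst euclidean_inner) (simp add: cis_conv_exp exp_sum sum_distrib_left)
  have eq: "cis (x \<bullet> z) * gaussian x = (\<Prod>b\<in>Basis. cis ((x \<bullet> b) * (z \<bullet> b)) * of_real (exp (- (x \<bullet> b)\<^sup>2 / 2)))" for x :: 'a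
    unfolding g c by (simp add: prod.distrib)
  show "integrable lborel (\<lambda>x. cis (x \<bullet> z) * gaussian x)"
    unfolding eq by (rule lborel_prod_Basis) (rule gaussian_fourier_real)
  show "(LINT x|lborel. cis (x \<bullet> z) * gaussian x) = of_real (sqrt (2 * pi) ^ DIM('a)) * gaussian z"
    unfolding eq g[of z] lborel_prod_Basis(2)[OF gaussian_fourier_real(1)] gaussian_fourier_real(2)
    by (simp add: prod.distrib)
qed

lemma lborel_integral_affine:
  fixes F :: "'a::euclidean_space \<Rightarrow> complex"
  assumes [measurable]: "F \<in> borel_measurable borel" and c: "c > 0"
  shows "(LINT x|lborel. F x) = of_real (c ^ DIM('a)) * (LINT x|lborel. F (t + c *\<^sub>R x))"
proof -
  have "(LINT x|lborel. F x) = (LINT x|density (distr lborel borel (\<lambda>x. t + c *\<^sub>R x)) (\<lambda>_. \<bar>c\<bar>^DIM('a)). F x)"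
    using lborel_affine[of c t] c by simp
  also have "\<dots> = of_real (c ^ DIM('a)) * (LINT x|lborel. F (t + c *\<^sub>R x))"
    using c by (subst integral_density) (auto simp: integral_distr scaleR_conv_of_real)
  finally show ?thesis .
qed

lemma integrable_lborel_affine:
  fixes F :: "'a::euclidean_space \<Rightarrow> complex"
  assumes F: "integrable lborel F" and c: "c > 0"
  shows "integrable lborel (\<lambda>x. F (t + c *\<^sub>R x))"
proof -
  have [measurable]: "F \<in> borel_measurable borel" using F by auto
  have "integrable (density (distr lborel borel (\<lambda>x. t + c *\<^sub>R x)) (\<lambda>_. ennreal (\<bar>c\<bar>^DIM('a)))) F"
    using F lborel_affine[of c t] c by simp
  then have "integrable (distr lborel borel (\<lambda>x. t + c *\<^sub>R x)) (\<lambda>x. \<bar>c\<bar>^DIM('a) *\<^sub>R F x)"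
    by (subst (asm) integrable_density) auto
  then have "integrable (distr lborel borel (\<lambda>x. t + c *\<^sub>R x)) (\<lambda>x. (1 / c^DIM('a)) *\<^sub>R (\<bar>c\<bar>^DIM('a) *\<^sub>R F x))"
    by (rule integrable_scaleR_right)
  then have "integrable (distr lborel borel (\<lambda>x. t + c *\<^sub>R x)) F"
    using c by simp
  then show ?thesis by (subst (asm) integrable_distr_eq) auto
qed

lemma gaussian_continuous: "continuous_on UNIV (gaussian :: 'a::euclidean_space \<Rightarrow> complex)"
  unfolding gaussian_def by (intro continuous_intros) auto

lemma norm_gaussian_le: "norm (gaussian x) \<le> 1"
  by (simp add: gaussian_def)

text \<open>Insert the convergence factor \<open>gaussian (\<epsilon> n *\<^sub>R x)\<close> into the integral defining the left-hand
side. By integrability of \<open>inv_fourier h\<close> the regularised integrals \<open>A n\<close> tend to the left-hand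
side. By Fubini's theorem and the transform of the Gaussian, \<open>A n\<close> is also an average of \<open>h\<close> over
translates \<open>\<xi> + \<epsilon> n *\<^sub>R z\<close> with a Gaussian weight of total mass one, and these averages tend to \<open>h \<xi>\<close>.\<close>

theorem fourier_inv_fourier:
  fixes h :: "'a::euclidean_space \<Rightarrow> complex"
  assumes h: "integrable lborel h" "continuous_on UNIV h" "\<And>\<eta>. norm (h \<eta>) \<le> B"
    and K: "integrable lborel (inv_fourier h)"
  shows "fourier (inv_fourier h) \<xi> = h \<xi>"
proof -
  let ?d = "DIM('a)"
  define \<epsilon> where "\<epsilon> n = 1 / real (Suc n)" for n
  have \<epsilon>0: "\<epsilon> n > 0" for n by (simp add: \<epsilon>_def)
  have \<epsilon>lim: "\<epsilon> \<longlonglongrightarrow> 0" unfolding \<epsilon>_def using LIMSEQ_inverse_real_of_nat by (simp add: inverse_eq_divide)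
  have [measurable]: "h \<in> borel_measurable borel" "inv_fourier h \<in> borel_measurable borel"
    "gaussian \<in> borel_measurable (borel :: 'a measure)"
    using h(1) K gaussian_continuous borel_measurable_continuous_onI by auto
  have gint: "integrable lborel (gaussian :: 'a \<Rightarrow> complex)"
    using gaussian_fourier(1)[of "0::'a"] by simp
  have gi: "(LINT x|lborel. gaussian (x::'a)) = of_real (sqrt (2 * pi) ^ ?d)"
    using gaussian_fourier(2)[of "0::'a"] by (simp add: gaussian_def)
  define A where "A n = (LINT x|lborel. cis (- (x \<bullet> \<xi>)) * inv_fourier h x * gaussian (\<epsilon> n *\<^sub>R x))" for n
  have lim1: "A \<longlonglongrightarrow> fourier (inv_fourier h) \<xi>"
    unfolding A_def fourier_def
  proof (rule integral_dominated_convergence[where w = "\<lambda>x. norm (inv_fourier h x)"])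
    show "AE x in lborel. (\<lambda>n. cis (- (x \<bullet> \<xi>)) * inv_fourier h x * gaussian (\<epsilon> n *\<^sub>R x))
        \<longlonglongrightarrow> cis (- (x \<bullet> \<xi>)) * inv_fourier h x"
    proof (rule AE_I2)
      fix x :: 'a
      have "(\<lambda>n. gaussian (\<epsilon> n *\<^sub>R x)) \<longlonglongrightarrow> gaussian (0 *\<^sub>R x)"
        using gaussian_continuous[where 'a='a] \<epsilon>lim
        by (intro continuous_on_tendsto_compose[where f=gaussian and s=UNIV] tendsto_intros) auto
      then have "(\<lambda>n. gaussian (\<epsilon> n *\<^sub>R x)) \<longlonglongrightarrow> 1" by (simp add: gaussian_def)
      from tendsto_mult[OF tendsto_const this]
      show "(\<lambda>n. cis (- (x \<bullet> \<xi>)) * inv_fourier h x * gaussian (\<epsilon> n *\<^sub>R x))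
        \<longlonglongrightarrow> cis (- (x \<bullet> \<xi>)) * inv_fourier h x" by (metis mult.right_neutral)
    qed
  qed (use K norm_gaussian_le in \<open>auto simp: norm_mult intro!: AE_I2 mult_left_le\<close>)
  define c where "c = complex_of_real (1 / (2 * pi) ^ ?d)"
  have A_eq: "A n = c * of_real (sqrt (2 * pi) ^ ?d) * (LINT z|lborel. h (\<xi> + \<epsilon> n *\<^sub>R z) * gaussian z)" for n
  proof -
    have inner: "(LINT x|lborel. cis (x \<bullet> (\<eta> - \<xi>)) * gaussian (\<epsilon> n *\<^sub>R x)) =
        of_real ((1 / \<epsilon> n) ^ ?d) * (of_real (sqrt (2 * pi) ^ ?d) * gaussian ((1 / \<epsilon> n) *\<^sub>R (\<eta> - \<xi>)))" for \<eta>
      using \<epsilon>0[of n] gaussian_fourier(2)[of "(1 / \<epsilon> n) *\<^sub>R (\<eta> - \<xi>)"]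
      by (subst lborel_integral_affine[where c = "1 / \<epsilon> n" and t = 0]) simp_all
    have g: "integrable lborel (\<lambda>x::'a. gaussian (\<epsilon> n *\<^sub>R x))"
      using integrable_lborel_affine[OF gint \<epsilon>0[of n], of 0] by simp

    have int: "integrable (lborel \<Otimes>\<^sub>M lborel) (\<lambda>(x, \<eta>). cis (x \<bullet> (\<eta> - \<xi>)) * (gaussian (\<epsilon> n *\<^sub>R x) * h \<eta>))"
      using integrable_cis_mult[OF integrable_pair_product[OF g h(1)], of "\<lambda>(x, \<eta>). x \<bullet> (\<eta> - \<xi>)"]
      by (simp add: case_prod_unfold)
    have cc: "cis (x \<bullet> (\<eta> - \<xi>)) = cis (- (x \<bullet> \<xi>)) * cis (x \<bullet> \<eta>)" for x \<eta>
      by (simp add: cis_mult inner_diff_right)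
    have "A n = c * (LINT x|lborel. LINT \<eta>|lborel. cis (x \<bullet> (\<eta> - \<xi>)) * (gaussian (\<epsilon> n *\<^sub>R x) * h \<eta>))"
      unfolding A_def inv_fourier_def cc c_def
      by (simp flip: integral_mult_right_zero add: scaleR_conv_of_real mult_ac)
    also have "(LINT x|lborel. LINT \<eta>|lborel. cis (x \<bullet> (\<eta> - \<xi>)) * (gaussian (\<epsilon> n *\<^sub>R x) * h \<eta>)) =
       (LINT \<eta>|lborel. LINT x|lborel. cis (x \<bullet> (\<eta> - \<xi>)) * (gaussian (\<epsilon> n *\<^sub>R x) * h \<eta>))"
      using lborel_pair.Fubini_integral[OF int] by simp
    also have "\<dots> = (LINT \<eta>|lborel. h \<eta> * (LINT x|lborel. cis (x \<bullet> (\<eta> - \<xi>)) * gaussian (\<epsilon> n *\<^sub>R x)))"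
      by (simp flip: integral_mult_right_zero add: mult_ac)
    also have "\<dots> = (LINT \<eta>|lborel. h \<eta> * (of_real ((1 / \<epsilon> n) ^ ?d) * (of_real (sqrt (2 * pi) ^ ?d) * gaussian ((1 / \<epsilon> n) *\<^sub>R (\<eta> - \<xi>)))))"
      unfolding inner ..
    also have "\<dots> = of_real ((1 / \<epsilon> n) ^ ?d) * (of_real (sqrt (2 * pi) ^ ?d) *
        (LINT \<eta>|lborel. h \<eta> * gaussian ((1 / \<epsilon> n) *\<^sub>R (\<eta> - \<xi>))))"
      by (simp only: integral_mult_right_zero[symmetric] mult.left_commute mult.assoc)
    also have "(LINT \<eta>|lborel. h \<eta> * gaussian ((1 / \<epsilon> n) *\<^sub>R (\<eta> - \<xi>))) =
        of_real (\<epsilon> n ^ ?d) * (LINT z|lborel. h (\<xi> + \<epsilon> n *\<^sub>R z) * gaussian z)"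
      using \<epsilon>0[of n] by (subst lborel_integral_affine[where c = "\<epsilon> n" and t = \<xi>]) simp_all
    also have "complex_of_real ((1 / \<epsilon> n) ^ ?d) * (of_real (sqrt (2 * pi) ^ ?d) *
        (of_real (\<epsilon> n ^ ?d) * (LINT z|lborel. h (\<xi> + \<epsilon> n *\<^sub>R z) * gaussian z))) =
        of_real (sqrt (2 * pi) ^ ?d) * (LINT z|lborel. h (\<xi> + \<epsilon> n *\<^sub>R z) * gaussian z)"
      using \<epsilon>0[of n] by (simp add: power_divide)
    finally show ?thesis by simp
  qed
  have "(\<lambda>n. LINT z|lborel. h (\<xi> + \<epsilon> n *\<^sub>R z) * gaussian z) \<longlonglongrightarrow> (LINT z::'a|lborel. h \<xi> * gaussian z)"
  proof (rule integral_dominated_convergence[where w = "\<lambda>x::'a. B * norm (gaussian x)"])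
    show "AE z::'a in lborel. (\<lambda>n. h (\<xi> + \<epsilon> n *\<^sub>R z) * gaussian z) \<longlonglongrightarrow> h \<xi> * gaussian z"
    proof (intro AE_I2 tendsto_intros)
      fix z :: 'a
      have "(\<lambda>n. h (\<xi> + \<epsilon> n *\<^sub>R z)) \<longlonglongrightarrow> h (\<xi> + 0 *\<^sub>R z)"
        using h(2) \<epsilon>lim
        by (intro continuous_on_tendsto_compose[where f=h and s=UNIV] tendsto_intros) auto
      then show "(\<lambda>n. h (\<xi> + \<epsilon> n *\<^sub>R z)) \<longlonglongrightarrow> h \<xi>" by simp
    qed
  qed (use gint h(3) in \<open>auto simp: norm_mult intro!: mult_right_mono\<close>)
  then have "A \<longlonglongrightarrow> c * of_real (sqrt (2 * pi) ^ ?d) * (h \<xi> * of_real (sqrt (2 * pi) ^ ?d))"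
    unfolding A_eq by (intro tendsto_intros) (simp add: gi)
  moreover have "c * of_real (sqrt (2 * pi) ^ ?d) * (h \<xi> * of_real (sqrt (2 * pi) ^ ?d)) = h \<xi>"
  proof -
    have "sqrt (2 * pi) * sqrt (2 * pi) = 2 * pi" by simp
    then have "sqrt (2 * pi) ^ ?d * sqrt (2 * pi) ^ ?d = (2 * pi) ^ ?d"
      by (simp only: power_mult_distrib[symmetric])
    then have "complex_of_real (sqrt (2 * pi) ^ ?d) * of_real (sqrt (2 * pi) ^ ?d) = of_real ((2 * pi) ^ ?d)"
      by (metis of_real_mult)
    then have "c * (complex_of_real (sqrt (2 * pi) ^ ?d) * of_real (sqrt (2 * pi) ^ ?d)) = 1"
      by (simp add: c_def)
    then show ?thesis by (simp add: mult_ac)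
  qed
  ultimately show ?thesis using LIMSEQ_unique[OF lim1] by simp
qed

section \<open>Radial functions supported in an annulus\<close>

text \<open>Radial functions are differentiated below by iterating the map \<open>u \<mapsto> u' / r\<close>. For \<open>a > 0\<close> it preserves
functions of this kind at the cost of one derivative, hence the recursion in \<open>k\<close>. The absolute
value admits even functions such as the rescaled \<open>bump chi\<close>.\<close>

fun annular :: "real \<Rightarrow> real \<Rightarrow> nat \<Rightarrow> (real \<Rightarrow> real) \<Rightarrow> bool" where
  "annular a b 0 u \<longleftrightarrow> continuous_on UNIV u \<and> (\<forall>r. \<bar>r\<bar> \<notin> {a..b} \<longrightarrow> u r = 0)"
| "annular a b (Suc k) u \<longleftrightarrow> (\<exists>u'. (\<forall>r. (u has_real_derivative u' r) (at r)) \<and> annular a b k u')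
      \<and> (\<forall>r. \<bar>r\<bar> \<notin> {a..b} \<longrightarrow> u r = 0)"

lemma annular_support: "annular a b k u \<Longrightarrow> \<bar>r\<bar> \<notin> {a..b} \<Longrightarrow> u r = 0"
  by (cases k) auto

lemma annular_Suc_D: "annular a b (Suc k) u \<Longrightarrow> annular a b k u"
proof (induction k arbitrary: u)
  case 0
  then show ?case by (auto intro: DERIV_continuous_on)
next
  case (Suc k)
  then show ?case by (metis annular.simps(2))
qed

lemma annular_continuous: "annular a b k u \<Longrightarrow> continuous_on UNIV u"
  by (induction k) (use annular_Suc_D in auto)

lemma annular_diff: "annular a b k u \<Longrightarrow> annular a b k v \<Longrightarrow> annular a b k (\<lambda>r. u r - v r)"
proof (induction k arbitrary: u v)
  case 0
  then show ?case by (auto intro!: continuous_intros)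
next
  case (Suc k)
  from Suc.prems obtain u' v' where *: "\<And>r. (u has_real_derivative u' r) (at r)" "annular a b k u'"
     "\<And>r. (v has_real_derivative v' r) (at r)" "annular a b k v'" by auto
  have "\<exists>w. (\<forall>r. ((\<lambda>r. u r - v r) has_real_derivative w r) (at r)) \<and> annular a b k w"
    using *(1,3) Suc.IH[OF *(2,4)] by (intro exI[of _ "\<lambda>r. u' r - v' r"]) (auto intro: DERIV_diff)
  then show ?case using annular_support[OF Suc.prems(1)] annular_support[OF Suc.prems(2)] by simp
qed

lemma eventually_annular_0:
  assumes "annular a b k u" "\<bar>r\<bar> \<notin> {a..b}"
  shows "eventually (\<lambda>s. u s = 0) (nhds r)"
proof -
  have "open (abs -` (- {a..b}) :: real set)"
    by (intro open_vimage open_Compl continuous_intros)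
  then have "eventually (\<lambda>s. s \<in> abs -` (- {a..b})) (nhds r)" using assms(2) by (intro eventually_nhds_in_open) auto
  then show ?thesis by eventually_elim (use annular_support[OF assms(1)] in auto)
qed

text \<open>Near the origin both \<open>u\<close> and the quotient vanish identically, so the singularity of the division
is invisible.\<close>

lemma annular_divide:
  assumes "0 < a"
  shows "annular a b k u \<Longrightarrow> annular a b k (\<lambda>r. u r / r)"
proof (induction k arbitrary: u)
  case 0
  have "isCont (\<lambda>r. u r / r) r" for r
  proof (cases "r = 0")
    case True
    then have "eventually (\<lambda>s. u s / s = 0) (nhds r)"
      using eventually_annular_0[OF 0, of r] assms by (auto elim: eventually_mono)
    then have "isCont (\<lambda>r. u r / r) r = isCont (\<lambda>_. 0::real) r" by (rule isCont_cong)
    then show ?thesis by simp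
  next
    case False
    moreover have "isCont u r" using 0 by (simp add: continuous_on_eq_continuous_at)
    ultimately show ?thesis by (intro isCont_divide continuous_ident) auto
  qed
  then show ?case using 0 by (auto simp: continuous_on_eq_continuous_at)
next
  case (Suc k)
  then obtain u' where u': "\<And>r. (u has_real_derivative u' r) (at r)" "annular a b k u'" by auto
  have k: "annular a b k u" using Suc.prems by (rule annular_Suc_D)
  have "((\<lambda>r. u r / r) has_real_derivative (u' r / r - u r / r / r)) (at r)" for r
  proof (cases "r = 0")
    case True
    then have "eventually (\<lambda>s. u s / s = 0) (nhds r)"
      using eventually_annular_0[OF k, of r] assms by (auto elim: eventually_mono)
    moreover have "u' r = 0" "u r = 0" using annular_support[OF u'(2)] annular_support[OF k] True assms by auto
    ultimately show ?thesis by (subst DERIV_cong_ev[OF refl _ refl, of _ "\<lambda>_. 0"]) auto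
  next
    case False
    then show ?thesis using DERIV_divide[OF u'(1)[of r] DERIV_ident] by (simp add: divide_simps)
  qed
  moreover have "annular a b k (\<lambda>r. u' r / r - u r / r / r)"
    by (intro annular_diff Suc.IH u'(2) k)
  ultimately have "\<exists>w. (\<forall>r. ((\<lambda>r. u r / r) has_real_derivative w r) (at r)) \<and> annular a b k w"
    by (intro exI[of _ "\<lambda>r. u' r / r - u r / r / r"]) simp
  then show ?case using annular_support[OF k] by simp
qed

text \<open>Outside the annulus the first function vanishes near every point, so its derivatives vanish
there too.\<close>

lemma annular_if_all_derivs:
  assumes D: "\<And>n r. (D n has_real_derivative D (Suc n) r) (at r)" and "\<And>r. \<bar>r\<bar> \<notin> {a..b} \<Longrightarrow> D 0 r = 0"
  shows "annular a b k (D 0)"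
  using assms
proof (induction k arbitrary: D)
  case 0
  then show ?case by (auto intro: DERIV_continuous_on)
next
  case (Suc k)
  have "D (Suc 0) r = 0" if r: "\<bar>r\<bar> \<notin> {a..b}" for r
  proof -
    have "open (abs -` (- {a..b}) :: real set)"
    by (intro open_vimage open_Compl continuous_intros)
    then have "eventually (\<lambda>s. s \<in> abs -` (- {a..b})) (nhds r)" using r by (intro eventually_nhds_in_open) auto
    then have "eventually (\<lambda>s. D 0 s = 0) (nhds r)" by eventually_elim (use Suc.prems(2) in auto)
    then have "(D 0 has_real_derivative 0) (at r)" by (subst DERIV_cong_ev[OF refl _ refl, of _ "\<lambda>_. 0"]) auto
    then show ?thesis using Suc.prems(1) DERIV_unique by blast
  qed
  then have "annular a b k (D (Suc 0))" using Suc.IH[of "\<lambda>n. D (Suc n)"] Suc.prems by auto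
  then show ?case using Suc.prems by auto
qed

lemma annular_derivative:
  assumes "0 < a" "annular a b (Suc k) u"
  obtains v where "annular a b k v" "\<And>r. (u has_real_derivative r * v r) (at r)"
proof -
  obtain u' where u': "\<And>r. (u has_real_derivative u' r) (at r)" "annular a b k u'"
    using assms by auto
  have eq: "r * (u' r / r) = u' r" for r
    using annular_support[OF u'(2), of 0] assms(1) by (cases "r = 0") auto
  show ?thesis
    by (rule that[OF annular_divide[OF assms(1) u'(2)]]) (simp only: eq u'(1))
qed

definition radial :: "(real \<Rightarrow> real) \<Rightarrow> 'a::euclidean_space \<Rightarrow> complex" where
  "radial u \<xi> = of_real (u (norm \<xi>))"

lemma continuous_on_radial: "annular a b k u \<Longrightarrow> continuous_on UNIV (radial u)"
  unfolding radial_def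
  by (intro continuous_on_of_real continuous_on_compose2[OF annular_continuous continuous_on_norm_id]) auto

lemma radial_support: "annular a b k u \<Longrightarrow> \<xi> \<notin> cball 0 b \<Longrightarrow> radial u \<xi> = 0"
  using annular_support[of a b k u "norm \<xi>"] by (auto simp: radial_def)

text \<open>The derivative of \<open>u (norm \<xi>)\<close> along \<open>e\<close> is \<open>u' (norm \<xi>) * (\<xi> \<bullet> e) / norm \<xi>\<close>. Writing
\<open>u' = r * v\<close> keeps it a product of the linear function \<open>\<xi> \<bullet> e\<close> with a radial function, without
any quotient.\<close>

lemma radial_directional_derivative:
  fixes \<xi> e :: "'a::euclidean_space"
  assumes "0 < a" "annular a b k u" "\<And>r. (u has_real_derivative r * v r) (at r)"
  shows "((\<lambda>\<tau>. radial u (\<xi> + \<tau> *\<^sub>R e)) has_vector_derivative of_real (\<xi> \<bullet> e) * radial v \<xi>) (at 0)"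
proof (cases "\<xi> = 0")
  case True
  have "open {\<tau>. norm (\<xi> + \<tau> *\<^sub>R e) < a}"
    by (intro open_Collect_less continuous_intros)
  then have "eventually (\<lambda>\<tau>. \<tau> \<in> {\<tau>. norm (\<xi> + \<tau> *\<^sub>R e) < a}) (nhds 0)"
    using True assms(1) by - (rule eventually_nhds_in_open, auto)
  then have "eventually (\<lambda>\<tau>. radial u (\<xi> + \<tau> *\<^sub>R e) = 0) (nhds 0)"
    by eventually_elim (use annular_support[OF assms(2)] in \<open>auto simp: radial_def\<close>)
  moreover have "((\<lambda>\<tau>. 0) has_vector_derivative (0::complex)) (at (0::real))" by simp
  ultimately have "((\<lambda>\<tau>. radial u (\<xi> + \<tau> *\<^sub>R e)) has_vector_derivative 0) (at 0)"
    using has_vector_derivative_cong_ev[where x = 0 and S = UNIV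
        and f = "\<lambda>\<tau>. radial u (\<xi> + \<tau> *\<^sub>R e)" and g = "\<lambda>_. 0"]
      True assms(1) annular_support[OF assms(2), of 0]
    by (simp add: radial_def)
  then show ?thesis using True by simp
next
  case False
  have "((\<lambda>\<tau>::real. \<xi> + \<tau> *\<^sub>R e) has_derivative (\<lambda>\<tau>. 0 + \<tau> *\<^sub>R e)) (at 0)"
    by (intro has_derivative_add has_derivative_const has_derivative_scaleR_left has_derivative_ident)
  moreover have "(norm has_derivative (\<lambda>y. y \<bullet> sgn \<xi>)) (at (\<xi> + 0 *\<^sub>R e))"
    using has_derivative_norm[OF False] by simp
  ultimately have "((\<lambda>\<tau>. norm (\<xi> + \<tau> *\<^sub>R e)) has_derivative (\<lambda>\<tau>. (0 + \<tau> *\<^sub>R e) \<bullet> sgn \<xi>)) (at 0)"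
    by (rule has_derivative_compose)
  moreover have "(\<lambda>\<tau>. (0 + \<tau> *\<^sub>R e) \<bullet> sgn \<xi>) = (*) (sgn \<xi> \<bullet> e)"
    by (simp add: fun_eq_iff inner_commute)
  ultimately have n: "((\<lambda>\<tau>. norm (\<xi> + \<tau> *\<^sub>R e)) has_real_derivative (sgn \<xi> \<bullet> e)) (at 0)"
    unfolding has_field_derivative_def by simp
  have "((\<lambda>\<tau>. u (norm (\<xi> + \<tau> *\<^sub>R e))) has_real_derivative (norm \<xi> * v (norm \<xi>)) * (sgn \<xi> \<bullet> e)) (at 0)"
    using DERIV_chain2[OF _ n, of u] assms(3) by simp
  moreover have "(norm \<xi> * v (norm \<xi>)) * (sgn \<xi> \<bullet> e) = (\<xi> \<bullet> e) * v (norm \<xi>)"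
    using False by (simp add: sgn_div_norm)
  ultimately have "((\<lambda>\<tau>. u (norm (\<xi> + \<tau> *\<^sub>R e))) has_real_derivative (\<xi> \<bullet> e) * v (norm \<xi>)) (at 0)"
    by simp
  from has_vector_derivative_of_real[OF this]
  show ?thesis by (simp add: radial_def)
qed

lemma integrable_continuous_compact_support:
  fixes G :: "'a::euclidean_space \<Rightarrow> complex"
  assumes "continuous_on UNIV G" "\<And>\<xi>. \<xi> \<notin> cball 0 R \<Longrightarrow> G \<xi> = 0"
  shows "integrable lborel G"
proof -
  have "integrable lborel (\<lambda>\<xi>. indicator (cball 0 R) \<xi> *\<^sub>R G \<xi>)"
    using assms(1) by (intro borel_integrable_compact) (auto intro: continuous_on_subset)
  moreover have "(\<lambda>\<xi>. indicator (cball 0 R) \<xi> *\<^sub>R G \<xi>) = G"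
    using assms(2) by (auto simp: indicator_def fun_eq_iff)
  ultimately show ?thesis by simp
qed

lemma bounded_continuous_compact_support:
  fixes G :: "'a::euclidean_space \<Rightarrow> complex"
  assumes "continuous_on UNIV G" "\<And>\<xi>. \<xi> \<notin> cball 0 R \<Longrightarrow> G \<xi> = 0"
  obtains B where "B > 0" "\<And>\<xi>. norm (G \<xi>) \<le> B"
proof -
  have "compact (G ` cball 0 R)"
    using assms(1) by (intro compact_continuous_image) (auto intro: continuous_on_subset)
  then obtain B where "B > 0" "\<forall>x\<in>G ` cball 0 R. norm x \<le> B"
    using compact_imp_bounded bounded_pos by blast
  then show ?thesis using assms(2) by (intro that[of B]) force+
qed

text \<open>By translation invariance, the difference quotients of \<open>H\<close> along \<open>e\<close> have integral zero. They are uniformly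
bounded with a common compact support, and they tend to \<open>H'\<close>. This argument replaces integration by parts in a
coordinate and works on every Euclidean space.\<close>

lemma integral_directional_derivative:
  fixes H H' :: "'a::euclidean_space \<Rightarrow> complex" and e :: 'a
  assumes H: "continuous_on UNIV H" "\<And>\<xi>. \<xi> \<notin> cball 0 R \<Longrightarrow> H \<xi> = 0"
    and H': "continuous_on UNIV H'" "\<And>\<xi>. \<xi> \<notin> cball 0 R \<Longrightarrow> H' \<xi> = 0"
    and e: "norm e = 1"
    and d: "\<And>\<xi>. ((\<lambda>\<tau>. H (\<xi> + \<tau> *\<^sub>R e)) has_vector_derivative H' \<xi>) (at 0)"
  shows "(LINT \<xi>|lborel. H' \<xi>) = 0"
proof -
  obtain B where B: "B > 0" "\<And>\<xi>. norm (H' \<xi>) \<le> B"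
    using bounded_continuous_compact_support[OF H'] by blast
  have iH: "integrable lborel H" using integrable_continuous_compact_support[OF H] .
  have [measurable]: "H \<in> borel_measurable borel" "H' \<in> borel_measurable borel"
    using H H' borel_measurable_continuous_onI by auto
  have d': "((\<lambda>\<tau>. H (\<xi> + \<tau> *\<^sub>R e)) has_vector_derivative H' (\<xi> + t *\<^sub>R e)) (at t)" for \<xi> t
  proof -
    have "((\<lambda>\<tau>. H (\<xi> + t *\<^sub>R e + \<tau> *\<^sub>R e)) has_vector_derivative H' (\<xi> + t *\<^sub>R e)) (at (t - t))"
      using d[of "\<xi> + t *\<^sub>R e"] by simp
    moreover have "((\<lambda>\<tau>. \<tau> - t) has_vector_derivative 1) (at t)"
      by (intro has_vector_derivative_eq_rhs[OF has_vector_derivative_diff[OF has_vector_derivative_id has_vector_derivative_const]]) simp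
    ultimately have "((\<lambda>\<tau>. H (\<xi> + t *\<^sub>R e + \<tau> *\<^sub>R e)) \<circ> (\<lambda>\<tau>. \<tau> - t) has_vector_derivative 1 *\<^sub>R H' (\<xi> + t *\<^sub>R e)) (at t)"
      by (intro vector_diff_chain_at)
    moreover have "(\<lambda>\<tau>. H (\<xi> + t *\<^sub>R e + \<tau> *\<^sub>R e)) \<circ> (\<lambda>\<tau>. \<tau> - t) = (\<lambda>\<tau>. H (\<xi> + \<tau> *\<^sub>R e))"
      by (simp add: fun_eq_iff algebra_simps)
    ultimately show ?thesis by simp
  qed
  define \<tau> where "\<tau> n = 1 / real (Suc n)" for n
  have \<tau>: "0 < \<tau> n" "\<tau> n \<le> 1" for n by (auto simp: \<tau>_def)
  have \<tau>lim: "\<tau> \<longlonglongrightarrow> 0" unfolding \<tau>_def using LIMSEQ_inverse_real_of_nat by (simp add: inverse_eq_divide)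
  define Q where "Q n \<xi> = (1 / \<tau> n) *\<^sub>R (H (\<xi> + \<tau> n *\<^sub>R e) - H \<xi>)" for n \<xi>
  have Q0: "(LINT \<xi>|lborel. Q n \<xi>) = 0" for n
  proof -
    have "(LINT \<xi>|lborel. Q n \<xi>) = (1 / \<tau> n) *\<^sub>R ((LINT \<xi>|lborel. H (\<tau> n *\<^sub>R e + \<xi>)) - (LINT \<xi>|lborel. H \<xi>))"
      unfolding Q_def using iH integrable_lborel_translate(1)[OF iH, of "\<tau> n *\<^sub>R e"]
      by (simp add: add.commute)
    then show ?thesis by (simp add: integrable_lborel_translate(2)[OF iH])
  qed
  have bound: "norm (Q n \<xi>) \<le> B * indicator (cball 0 (R + 1)) \<xi>" for n \<xi>
  proof (cases "\<xi> \<in> cball 0 (R + 1)")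
    case True
    have "((\<lambda>t. H' (\<xi> + t *\<^sub>R e)) has_integral H (\<xi> + \<tau> n *\<^sub>R e) - H (\<xi> + 0 *\<^sub>R e)) {0..\<tau> n}"
      using \<tau>(1)[of n] by (intro fundamental_theorem_of_calculus has_vector_derivative_at_within[OF d']) simp
    then have "H (\<xi> + \<tau> n *\<^sub>R e) - H \<xi> = integral {0..\<tau> n} (\<lambda>t. H' (\<xi> + t *\<^sub>R e))"
      by (simp add: integral_unique)
    also have "norm \<dots> \<le> B * (\<tau> n - 0)"
    proof (rule integral_bound)
      have "continuous_on {0..\<tau> n} (\<lambda>t. \<xi> + t *\<^sub>R e)" by (intro continuous_intros)
      then show "continuous_on {0..\<tau> n} (\<lambda>t. H' (\<xi> + t *\<^sub>R e))"
        by (rule continuous_on_compose2[OF H'(1)]) simp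
    qed (use \<tau>(1)[of n] B in auto)
    finally show ?thesis using True \<tau>[of n] by (simp add: Q_def divide_simps)
  next
    case False
    have "norm (\<xi> + \<tau> n *\<^sub>R e) \<ge> norm \<xi> - norm (\<tau> n *\<^sub>R e)"
      by (rule norm_diff_ineq)
    then have "norm (\<xi> + \<tau> n *\<^sub>R e) > R" "norm \<xi> > R" using \<tau>[of n] e False by auto
    then show ?thesis using False H(2) by (simp add: Q_def)
  qed
  have "(\<lambda>n. LINT \<xi>|lborel. Q n \<xi>) \<longlonglongrightarrow> (LINT \<xi>|lborel. H' \<xi>)"
  proof (rule integral_dominated_convergence[where w = "\<lambda>\<xi>::'a. B * indicator (cball 0 (R + 1)) \<xi>"])
    show "AE \<xi> in lborel. (\<lambda>n. Q n \<xi>) \<longlonglongrightarrow> H' \<xi>"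
    proof (rule AE_I2)
      fix \<xi>
      have "((\<lambda>t. norm (H (\<xi> + t *\<^sub>R e) - H (\<xi> + 0 *\<^sub>R e) - (t - 0) *\<^sub>R H' \<xi>) / norm (t - 0)) \<longlongrightarrow> 0) (at 0)"
        using d[of \<xi>] unfolding has_vector_derivative_def has_derivative_iff_norm by simp
      then have "(\<lambda>n. norm (H (\<xi> + \<tau> n *\<^sub>R e) - H (\<xi> + 0 *\<^sub>R e) - (\<tau> n - 0) *\<^sub>R H' \<xi>) / norm (\<tau> n - 0)) \<longlonglongrightarrow> 0"
        using \<tau>lim \<tau>(1) by (elim filterlim_compose) (auto simp: filterlim_at intro!: always_eventually less_imp_neq[THEN not_sym])
      moreover have "norm (H (\<xi> + \<tau> n *\<^sub>R e) - H (\<xi> + 0 *\<^sub>R e) - (\<tau> n - 0) *\<^sub>R H' \<xi>) / norm (\<tau> n - 0) = norm (Q n \<xi> - H' \<xi>)" for n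
      proof -
        have "H (\<xi> + \<tau> n *\<^sub>R e) - H \<xi> - \<tau> n *\<^sub>R H' \<xi> = \<tau> n *\<^sub>R (Q n \<xi> - H' \<xi>)"
          using \<tau>(1)[of n] by (simp add: Q_def scaleR_right_diff_distrib)
        then show ?thesis using \<tau>(1)[of n] by simp
      qed
      ultimately have "(\<lambda>n. norm (Q n \<xi> - H' \<xi>)) \<longlonglongrightarrow> 0" by simp
      then show "(\<lambda>n. Q n \<xi>) \<longlonglongrightarrow> H' \<xi>"
        by (simp add: LIM_zero_iff tendsto_norm_zero_iff)
    qed
    show "integrable lborel (\<lambda>\<xi>::'a. B * indicator (cball 0 (R + 1)) \<xi>)"
      using emeasure_bounded_finite[OF bounded_cball[of "0::'a" "R + 1"]]
      by (intro integrable_mult_right integrable_real_indicator) auto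
    show "Q n \<in> borel_measurable lborel" for n
    proof -
      have "continuous_on UNIV (\<lambda>\<xi>. H (\<xi> + \<tau> n *\<^sub>R e))"
        by (rule continuous_on_compose2[OF H(1)]) (auto intro: continuous_on_add continuous_on_id continuous_on_const)
      then have "continuous_on UNIV (Q n)" unfolding Q_def by (intro continuous_on_scaleR continuous_on_diff continuous_on_const H(1))
      then show ?thesis using borel_measurable_continuous_onI by simp
    qed
  qed (use bound in auto)
  then show ?thesis unfolding Q0 by (simp add: LIMSEQ_const_iff)
qed

text \<open>Apply the preceding fact to \<open>cis (x \<bullet> \<xi>) * G \<xi>\<close>: differentiating \<open>G\<close> along \<open>e\<close> multiplies its
inverse transform by \<open>- \<i> * (x \<bullet> e)\<close>.\<close>

lemma inv_fourier_directional_derivative: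
  fixes G G' :: "'a::euclidean_space \<Rightarrow> complex" and e :: 'a
  assumes G: "continuous_on UNIV G" "\<And>\<xi>. \<xi> \<notin> cball 0 R \<Longrightarrow> G \<xi> = 0"
    and G': "continuous_on UNIV G'" "\<And>\<xi>. \<xi> \<notin> cball 0 R \<Longrightarrow> G' \<xi> = 0"
    and e: "norm e = 1"
    and d: "\<And>\<xi>. ((\<lambda>\<tau>. G (\<xi> + \<tau> *\<^sub>R e)) has_vector_derivative G' \<xi>) (at 0)"
  shows "norm (inv_fourier G' x) = \<bar>x \<bullet> e\<bar> * norm (inv_fourier G x)"
proof -
  define H where "H \<xi> = cis (x \<bullet> \<xi>) * G \<xi>" for \<xi>
  define H' where "H' \<xi> = \<i> * of_real (x \<bullet> e) * (cis (x \<bullet> \<xi>) * G \<xi>) + cis (x \<bullet> \<xi>) * G' \<xi>" for \<xi>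
  have "(LINT \<xi>|lborel. H' \<xi>) = 0"
  proof (rule integral_directional_derivative[of H R, OF _ _ _ _ e])
    show "continuous_on UNIV H" "continuous_on UNIV H'" unfolding H_def H'_def
      by (intro continuous_intros G G')+
    fix \<xi>
    have "((\<lambda>\<tau>. x \<bullet> (\<xi> + \<tau> *\<^sub>R e)) has_real_derivative x \<bullet> e) (at 0)"
      unfolding inner_add_right inner_scaleR_right by (auto intro!: derivative_eq_intros)
    then have "((\<lambda>\<tau>. \<i> * complex_of_real (x \<bullet> (\<xi> + \<tau> *\<^sub>R e))) has_vector_derivative \<i> * of_real (x \<bullet> e)) (at 0)"
      by (intro has_vector_derivative_mult_right has_vector_derivative_of_real)
    from field_vector_diff_chain_at[OF this DERIV_exp]
    have "((\<lambda>\<tau>. cis (x \<bullet> (\<xi> + \<tau> *\<^sub>R e))) has_vector_derivative \<i> * of_real (x \<bullet> e) * cis (x \<bullet> \<xi>)) (at 0)"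
      by (simp add: o_def cis_conv_exp)
    from has_vector_derivative_mult[OF this d[of \<xi>]]
    show "((\<lambda>\<tau>. H (\<xi> + \<tau> *\<^sub>R e)) has_vector_derivative H' \<xi>) (at 0)"
      unfolding H_def H'_def by (simp add: mult_ac add.commute)
  qed (use G(2) G'(2) in \<open>auto simp: H_def H'_def\<close>)
  moreover have "integrable lborel (\<lambda>\<xi>. cis (x \<bullet> \<xi>) * G \<xi>)" "integrable lborel (\<lambda>\<xi>. cis (x \<bullet> \<xi>) * G' \<xi>)"
    by (intro integrable_cis_mult integrable_continuous_compact_support[OF G]
      integrable_continuous_compact_support[OF G']; simp)+
  ultimately have "\<i> * of_real (x \<bullet> e) * (LINT \<xi>|lborel. cis (x \<bullet> \<xi>) * G \<xi>) + (LINT \<xi>|lborel. cis (x \<bullet> \<xi>) * G' \<xi>) = 0"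
    unfolding H'_def by (subst (asm) Bochner_Integration.integral_add) auto
  then have "(LINT \<xi>|lborel. cis (x \<bullet> \<xi>) * G' \<xi>) = - (\<i> * of_real (x \<bullet> e) * (LINT \<xi>|lborel. cis (x \<bullet> \<xi>) * G \<xi>))"
    by (simp add: eq_neg_iff_add_eq_0 add.commute)
  then show ?thesis unfolding inv_fourier_def by (simp add: norm_mult)
qed

lemma inv_fourier_bound:
  assumes "integrable lborel G"
  shows "norm (inv_fourier G x) \<le> (1 / (2 * pi) ^ DIM('a)) * (LINT \<xi>|lborel. norm (G (\<xi>::'a::euclidean_space)))"
proof -
  have "norm (LINT \<xi>|lborel. cis (x \<bullet> \<xi>) * G \<xi>) \<le> (LINT \<xi>|lborel. norm (cis (x \<bullet> \<xi>) * G \<xi>))"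
    by (rule integral_norm_bound)
  then show ?thesis unfolding inv_fourier_def by (simp add: norm_mult divide_right_mono)
qed

text \<open>Four derivatives of \<open>radial u\<close> along a basis vector remain continuous with compact support, so
\<open>(x \<bullet> e) ^ 4\<close> times the inverse transform is bounded. With \<open>v1, ..., v4\<close> the iterates of
\<open>u \<mapsto> u' / r\<close> and \<open>p = \<xi> \<bullet> e\<close>, the functions \<open>h1, ..., h4\<close> are these derivatives.\<close>

lemma inv_fourier_radial_decay:
  fixes u :: "real \<Rightarrow> real"
  assumes a: "0 < a" and u: "annular a b 4 u"
  shows "\<exists>M. \<forall>(x::'a::euclidean_space). \<forall>e\<in>Basis. norm (inv_fourier (radial u) x) \<le> M \<and>
           (x \<bullet> e) ^ 4 * norm (inv_fourier (radial u) x) \<le> M"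
proof -
  have "annular a b (Suc (Suc (Suc (Suc 0)))) u" using u by (simp add: numeral_eq_Suc del: annular.simps)
  then obtain v1 where v1: "annular a b (Suc (Suc (Suc 0))) v1" "\<And>r. (u has_real_derivative r * v1 r) (at r)"
    using annular_derivative[OF a] by blast
  obtain v2 where v2: "annular a b (Suc (Suc 0)) v2" "\<And>r. (v1 has_real_derivative r * v2 r) (at r)"
    using annular_derivative[OF a v1(1)] by blast
  obtain v3 where v3: "annular a b (Suc 0) v3" "\<And>r. (v2 has_real_derivative r * v3 r) (at r)"
    using annular_derivative[OF a v2(1)] by blast
  obtain v4 where v4: "annular a b 0 v4" "\<And>r. (v3 has_real_derivative r * v4 r) (at r)"
    using annular_derivative[OF a v3(1)] by blast
  note cont = continuous_on_radial[OF u] continuous_on_radial[OF v1(1)] continuous_on_radial[OF v2(1)]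
    continuous_on_radial[OF v3(1)] continuous_on_radial[OF v4(1)]
  note supp = radial_support[OF u] radial_support[OF v1(1)] radial_support[OF v2(1)]
    radial_support[OF v3(1)] radial_support[OF v4(1)]
  note D0 = radial_directional_derivative[OF a u v1(2)]
  note D1 = radial_directional_derivative[OF a v1(1) v2(2)]
  note D2 = radial_directional_derivative[OF a v2(1) v3(2)]
  note D3 = radial_directional_derivative[OF a v3(1) v4(2)]
  define p where "p e \<xi> = complex_of_real (\<xi> \<bullet> e)" for e \<xi> :: 'a
  define h1 where "h1 e \<xi> = p e \<xi> * radial v1 \<xi>" for e \<xi> :: 'a
  define h2 where "h2 e \<xi> = radial v1 \<xi> + p e \<xi> ^ 2 * radial v2 \<xi>" for e \<xi> :: 'a
  define h3 where "h3 e \<xi> = 3 * p e \<xi> * radial v2 \<xi> + p e \<xi> ^ 3 * radial v3 \<xi>" for e \<xi> :: 'a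
  define h4 where "h4 e \<xi> = 3 * radial v2 \<xi> + 6 * p e \<xi> ^ 2 * radial v3 \<xi> + p e \<xi> ^ 4 * radial v4 \<xi>" for e \<xi> :: 'a
  have pc: "continuous_on UNIV (p e)" for e unfolding p_def by (intro continuous_intros)
  have hc: "continuous_on UNIV (h1 e)" "continuous_on UNIV (h2 e)" "continuous_on UNIV (h3 e)" "continuous_on UNIV (h4 e)" for e
    unfolding h1_def h2_def h3_def h4_def by (intro continuous_intros pc cont)+
  have hs: "h1 e \<xi> = 0" "h2 e \<xi> = 0" "h3 e \<xi> = 0" "h4 e \<xi> = 0" if "\<xi> \<notin> cball 0 b" for e \<xi>
    unfolding h1_def h2_def h3_def h4_def supp[OF that] by simp_all
  have decay: "(x \<bullet> e) ^ 4 * norm (inv_fourier (radial u) x) = norm (inv_fourier (h4 e) x)" if "e \<in> Basis" for x e :: 'a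
  proof -
    have e: "norm e = 1" "e \<bullet> e = 1" using that by auto
    have Dp: "((\<lambda>\<tau>. p e (\<xi> + \<tau> *\<^sub>R e)) has_vector_derivative 1) (at 0)" for \<xi>
    proof -
      have "((\<lambda>\<tau>. \<xi> \<bullet> e + \<tau> * (e \<bullet> e)) has_real_derivative 1) (at 0)"
        using e by (auto intro!: derivative_eq_intros)
      then have "((\<lambda>\<tau>. (\<xi> + \<tau> *\<^sub>R e) \<bullet> e) has_real_derivative 1) (at 0)"
        by (simp add: inner_add_left)
      from has_vector_derivative_of_real[OF this] show ?thesis by (simp add: p_def)
    qed
    have Dp2: "((\<lambda>\<tau>. p e (\<xi> + \<tau> *\<^sub>R e) ^ 2) has_vector_derivative 2 * p e \<xi>) (at 0)" for \<xi>
      using has_vector_derivative_mult[OF Dp Dp, of \<xi> \<xi>] by (simp add: power2_eq_square)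
    have Dp3: "((\<lambda>\<tau>. p e (\<xi> + \<tau> *\<^sub>R e) ^ 3) has_vector_derivative 3 * p e \<xi> ^ 2) (at 0)" for \<xi>
      using has_vector_derivative_mult[OF Dp2 Dp, of \<xi> \<xi>] by (simp add: power2_eq_square power3_eq_cube)
    have 1: "((\<lambda>\<tau>. radial u (\<xi> + \<tau> *\<^sub>R e)) has_vector_derivative h1 e \<xi>) (at 0)" for \<xi>
      using D0[of \<xi> e] by (simp add: h1_def p_def)
    have 2: "((\<lambda>\<tau>. h1 e (\<xi> + \<tau> *\<^sub>R e)) has_vector_derivative h2 e \<xi>) (at 0)" for \<xi>
      unfolding h1_def h2_def
      by (rule has_vector_derivative_eq_rhs[OF has_vector_derivative_mult[OF Dp[of \<xi>] D1[of \<xi> e]]])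
        (simp add: power2_eq_square p_def)
    have 3: "((\<lambda>\<tau>. h2 e (\<xi> + \<tau> *\<^sub>R e)) has_vector_derivative h3 e \<xi>) (at 0)" for \<xi>
      unfolding h2_def h3_def
      by (rule has_vector_derivative_eq_rhs[OF has_vector_derivative_add[OF D1[of \<xi> e]
          has_vector_derivative_mult[OF Dp2[of \<xi>] D2[of \<xi> e]]]])
        (simp add: power2_eq_square power3_eq_cube algebra_simps p_def)
    have 4: "((\<lambda>\<tau>. h3 e (\<xi> + \<tau> *\<^sub>R e)) has_vector_derivative h4 e \<xi>) (at 0)" for \<xi>
      unfolding h3_def h4_def
      by (rule has_vector_derivative_eq_rhs[OF has_vector_derivative_add[OF
          has_vector_derivative_mult[OF has_vector_derivative_mult_right[OF Dp[of \<xi>], of 3] D2[of \<xi> e]]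
          has_vector_derivative_mult[OF Dp3[of \<xi>] D3[of \<xi> e]]]])
        (simp add: power2_eq_square power3_eq_cube power4_eq_xxxx algebra_simps p_def)
    note IBP = inv_fourier_directional_derivative[OF _ _ _ _ e(1)]
    have "norm (inv_fourier (h4 e) x) = \<bar>x \<bullet> e\<bar> * (\<bar>x \<bullet> e\<bar> * (\<bar>x \<bullet> e\<bar> * (\<bar>x \<bullet> e\<bar> * norm (inv_fourier (radial u) x))))"
      using IBP[OF hc(3) hs(3) hc(4) hs(4) 4, where x = x] IBP[OF hc(2) hs(2) hc(3) hs(3) 3, where x = x]
        IBP[OF hc(1) hs(1) hc(2) hs(2) 2, where x = x] IBP[OF cont(1) supp(1) hc(1) hs(1) 1, where x = x]
      by simp
    also have "\<dots> = \<bar>x \<bullet> e\<bar> ^ 4 * norm (inv_fourier (radial u) x)" by (simp add: power4_eq_xxxx)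
    finally show ?thesis by simp
  qed
  define c where "c = 1 / (2 * pi) ^ DIM('a)"
  define M where "M = Max (insert (c * (LINT \<xi>|lborel. norm (radial u (\<xi>::'a)))) ((\<lambda>e. c * (LINT \<xi>|lborel. norm (h4 e \<xi>))) ` Basis))"
  have "norm (inv_fourier (radial u) x) \<le> M" for x :: 'a
    unfolding M_def using inv_fourier_bound[OF integrable_continuous_compact_support[OF cont(1) supp(1)], where x = x]
    by (subst Max_ge_iff) (auto simp: c_def)
  moreover have "(x \<bullet> e) ^ 4 * norm (inv_fourier (radial u) x) \<le> M" if "e \<in> Basis" for x e :: 'a
  proof -
    have "norm (inv_fourier (h4 e) x) \<le> c * (LINT \<xi>|lborel. norm (h4 e \<xi>))"
      unfolding c_def by (rule inv_fourier_bound[OF integrable_continuous_compact_support[OF hc(4) hs(4)]])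
    then show ?thesis unfolding decay[OF that] M_def using that by (subst Max_ge_iff) auto
  qed
  ultimately show ?thesis by blast
qed

lemma integrable_inverse_1_plus_square': "integrable lborel (\<lambda>x::real. complex_of_real (inverse (1 + x\<^sup>2)))"
proof -
  have "einterval (-\<infinity>) \<infinity> = UNIV" by (auto simp: einterval_def)
  then have "integrable lborel (\<lambda>x::real. inverse (1 + x\<^sup>2))"
    using integrable_inverse_1_plus_square by (simp add: set_integrable_def)
  then show ?thesis by (rule integrable_of_real)
qed

text \<open>In at most two dimensions the fourth powers of the single coordinates control the product
weight \<open>\<Prod>(1 + x\<^sub>e\<^sup>2)\<close>, whose reciprocal is integrable. This is why derivatives along a
single direction at a time suffice.\<close>

lemma prod_1_plus_square_le:
  fixes x :: "'a::euclidean_space"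
  assumes "DIM('a) \<le> 2"
  shows "(\<Prod>e\<in>Basis. 1 + (x \<bullet> e)\<^sup>2) \<le> 2 + (\<Sum>e\<in>Basis. (x \<bullet> e) ^ 4)"
proof -
  have q: "2 * s\<^sup>2 \<le> 1 + s ^ 4" for s :: real
    using zero_le_power2[of "s\<^sup>2 - 1"] by (simp add: power2_eq_square power4_eq_xxxx algebra_simps)
  have q2: "2 * (s\<^sup>2 * t\<^sup>2) \<le> s ^ 4 + t ^ 4" for s t :: real
    using zero_le_power2[of "s\<^sup>2 - t\<^sup>2"] by (simp add: power2_eq_square power4_eq_xxxx algebra_simps)
  have "DIM('a) = 1 \<or> DIM('a) = 2" using assms DIM_positive[where 'a='a] by linarith
  then show ?thesis
  proof
    assume "DIM('a) = 1"
    then obtain e :: 'a where B: "Basis = {e}" by (rule card_1_singletonE)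
    have "1 + (x \<bullet> e)\<^sup>2 \<le> 2 + (x \<bullet> e) ^ 4"
      using q[of "x \<bullet> e"] zero_le_power2[of "x \<bullet> e"] by linarith
    then show ?thesis unfolding B by simp
  next
    assume "DIM('a) = 2"
    then obtain e f :: 'a where B: "Basis = {e, f}" "e \<noteq> f" unfolding card_2_iff by blast
    have "(1 + (x \<bullet> e)\<^sup>2) * (1 + (x \<bullet> f)\<^sup>2) \<le> 2 + ((x \<bullet> e) ^ 4 + (x \<bullet> f) ^ 4)"
      using q[of "x \<bullet> e"] q[of "x \<bullet> f"] q2[of "x \<bullet> e" "x \<bullet> f"]
      by (simp add: distrib_left distrib_right)
    then show ?thesis unfolding B(1) using B(2) by simp
  qed
qed

text \<open>The decay along the basis vectors bounds the inverse transform by a multiple of the product of the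
functions \<open>1 / (1 + (x \<bullet> e)\<^sup>2)\<close>, which is integrable.\<close>

theorem integrable_inv_fourier_radial:
  fixes u :: "real \<Rightarrow> real"
  assumes dim: "DIM('a::euclidean_space) \<le> 2" and a: "0 < a" and u: "annular a b 4 u"
  shows "integrable lborel (inv_fourier (radial u) :: 'a \<Rightarrow> complex)"
proof -
  let ?K = "inv_fourier (radial u) :: 'a \<Rightarrow> complex"
  obtain M where M: "\<And>x e. e \<in> (Basis::'a set) \<Longrightarrow> norm (?K x) \<le> M" "\<And>x e. e \<in> Basis \<Longrightarrow> (x \<bullet> e) ^ 4 * norm (?K x) \<le> M"
    using inv_fourier_radial_decay[OF a u, where 'a='a] by blast
  have M0: "norm (?K x) \<le> M" for x using M(1)[OF SOME_Basis] .
  have "M \<ge> 0" using M0[of 0] norm_ge_zero order_trans by blast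
  define w where "w x = (\<Prod>e\<in>Basis. complex_of_real (inverse (1 + (x \<bullet> e)\<^sup>2)))" for x :: 'a
  have w: "integrable lborel w"
    unfolding w_def by (rule lborel_prod_Basis(1)) (rule integrable_inverse_1_plus_square')
  have [measurable]: "radial u \<in> borel_measurable (borel :: 'a measure)"
    using continuous_on_radial[OF u] by (rule borel_measurable_continuous_onI)
  have meas: "?K \<in> borel_measurable lborel"
    unfolding inv_fourier_def by measurable
  have bd: "norm (?K x) \<le> norm (of_real (4 * M) * w x)" for x
  proof -
    have pos: "(\<Prod>e\<in>Basis. 1 + (x \<bullet> e)\<^sup>2) > 0" by (intro prod_pos) (simp add: add_pos_nonneg)
    have "(\<Prod>e\<in>Basis. 1 + (x \<bullet> e)\<^sup>2) * norm (?K x) \<le> (2 + (\<Sum>e\<in>Basis. (x \<bullet> e) ^ 4)) * norm (?K x)"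
      by (intro mult_right_mono prod_1_plus_square_le dim) auto
    also have "\<dots> = 2 * norm (?K x) + (\<Sum>e\<in>Basis. (x \<bullet> e) ^ 4 * norm (?K x))"
      by (simp add: distrib_right sum_distrib_right)
    also have "\<dots> \<le> 2 * M + (\<Sum>e\<in>(Basis::'a set). M)"
      by (intro add_mono mult_left_mono sum_mono M M0) auto
    also have "\<dots> \<le> 4 * M" using dim \<open>M \<ge> 0\<close> by (simp add: mult_right_mono)
    finally have "norm (?K x) \<le> 4 * M / (\<Prod>e\<in>Basis. 1 + (x \<bullet> e)\<^sup>2)"
      using pos by (simp add: pos_le_divide_eq mult.commute)
    also have "\<dots> = norm (of_real (4 * M) * w x)"
    proof -
      have "w x = of_real (inverse (\<Prod>e\<in>Basis. 1 + (x \<bullet> e)\<^sup>2))"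
        by (simp only: w_def of_real_prod[symmetric] prod_inversef[symmetric] o_def)
      then have "norm (w x) = inverse (\<Prod>e\<in>Basis. 1 + (x \<bullet> e)\<^sup>2)"
        using pos by (simp only: norm_of_real) simp
      then show ?thesis using \<open>M \<ge> 0\<close> by (simp add: norm_mult divide_inverse)
    qed
    finally show ?thesis .
  qed
  show ?thesis
    by (rule Bochner_Integration.integrable_bound[OF integrable_mult_right[OF w, of "of_real (4 * M)"] meas])
      (use bd in simp)
qed

section \<open>Reduction to a pointwise kernel bound\<close>

lemma cutoffD:
  assumes "cutoff chi"
  shows "(deriv ^^ n) chi differentiable_on UNIV" "closure {s. chi s \<noteq> 0} \<subseteq> {-2<..<2}"
    "\<bar>s\<bar> \<le> 1 \<Longrightarrow> chi s = 1"
proof -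
  note c = assms[unfolded cutoff_def]
  show "(deriv ^^ n) chi differentiable_on UNIV" using conjunct1[OF c] by (rule spec)
  show "closure {s. chi s \<noteq> 0} \<subseteq> {-2<..<2}" using conjunct1[OF conjunct2[OF c]] .
  show "chi s = 1" if "\<bar>s\<bar> \<le> 1"
    using spec[OF conjunct2[OF conjunct2[OF conjunct2[OF c]]], of s] that by (rule mp)
qed

lemma cutoff_zero:
  assumes "cutoff chi" "\<bar>s\<bar> \<ge> 2" shows "chi s = 0"
proof (rule ccontr)
  assume "chi s \<noteq> 0"
  then have "s \<in> closure {s. chi s \<noteq> 0}" by (intro subsetD[OF closure_subset]) simp
  then have "s \<in> {-2<..<2}" by (rule subsetD[OF cutoffD(2)[OF assms(1)]])
  then show False using assms(2) by auto
qed

lemma bump_support: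
  assumes "cutoff chi" "\<bar>s\<bar> \<notin> {1/2..2}" shows "bump chi s = 0"
proof (cases "\<bar>s\<bar> < 1/2")
  case True
  then show ?thesis by (simp add: bump_def cutoffD(3)[OF assms(1)])
next
  case False
  then show ?thesis using assms cutoff_zero[OF assms(1), of s] cutoff_zero[OF assms(1), of "2 * s"]
    by (simp add: bump_def)
qed

lemma DERIV_cutoff:
  assumes "cutoff chi"
  shows "((deriv ^^ n) chi has_real_derivative (deriv ^^ Suc n) chi s) (at s)"
proof -
  have "(deriv ^^ n) chi differentiable_on UNIV" by (rule cutoffD(1)[OF assms])
  then have "(deriv ^^ n) chi differentiable (at s)" by (simp add: differentiable_on_def)
  then show ?thesis by (simp add: field_differentiable_derivI real_differentiable_def field_differentiable_def)
qed

text \<open>For \<open>\<bar>s\<bar> \<le> 1 / 2\<close> both terms of \<open>bump chi s\<close> equal 1, and for \<open>\<bar>s\<bar> \<ge> 2\<close> both vanish.\<close>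

lemma annular_bump:
  assumes "cutoff chi" "L > 0"
  shows "annular (L / 2) (2 * L) k (\<lambda>r. bump chi (r / L))"
proof -
  define D where "D n r = (1 / L) ^ n * (deriv ^^ n) chi ((1 / L) * r) - (2 / L) ^ n * (deriv ^^ n) chi ((2 / L) * r)" for n r
  have *: "((\<lambda>r. c ^ n * (deriv ^^ n) chi (c * r)) has_real_derivative c ^ Suc n * (deriv ^^ Suc n) chi (c * r)) (at r)" for c n r
  proof -
    have "((*) c has_real_derivative c) (at r)" by (auto intro!: derivative_eq_intros)
    from DERIV_cmult[OF DERIV_chain2[OF DERIV_cutoff[OF assms(1)] this], where c = "c ^ n"]
    show ?thesis by (simp add: mult_ac)
  qed
  have "(D n has_real_derivative D (Suc n) r) (at r)" for n r
    unfolding D_def by (intro DERIV_diff *)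
  moreover have D0: "D 0 r = bump chi (r / L)" for r by (simp add: D_def bump_def)
  moreover have "bump chi (r / L) = 0" if "\<bar>r\<bar> \<notin> {L/2..2 * L}" for r
    using that assms(2) by (intro bump_support[OF assms(1)]) (auto simp: field_simps)
  ultimately have "annular (L / 2) (2 * L) k (D 0)" by (intro annular_if_all_derivs) auto
  moreover have "D 0 = (\<lambda>r. bump chi (r / L))" using D0 by auto
  ultimately show ?thesis by simp
qed

lemma inv_fourier_measurable:
  fixes h :: "'a::euclidean_space \<Rightarrow> complex"
  assumes [measurable]: "h \<in> borel_measurable borel"
  shows "inv_fourier h \<in> borel_measurable borel"
  unfolding inv_fourier_def by measurable

text \<open>The propagator is defined through the transform of \<open>freq_proj chi L f\<close>; Fourier inversion for the
integrable kernel of the frequency projection turns it into a single Fourier multiplier acting on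
\<open>f\<close>, which is a convolution.\<close>

theorem Linf_norm_propagator_freq_proj_le:
  fixes f :: "'a::euclidean_space \<Rightarrow> complex" and mu :: "'a \<Rightarrow> real"
  assumes dim: "DIM('a) \<le> 2" and chi: "cutoff chi" and L: "L > 0"
    and mu [measurable]: "mu \<in> borel_measurable borel" and f: "integrable lborel f"
    and B: "\<And>x. norm (inv_fourier (\<lambda>\<xi>. cis (- (s * mu \<xi>)) * of_real (bump chi (norm \<xi> / L))) x) \<le> B"
  shows "Linf_norm (propagator mu s (freq_proj chi L f)) \<le> ereal (B * L1_norm f)"
proof -
  define h :: "'a \<Rightarrow> complex" where "h = radial (\<lambda>r. bump chi (r / L))"
  note ann = annular_bump[OF chi L]
  have L2: "0 < L / 2" using L by simp
  have hc: "continuous_on UNIV h" and hs: "\<And>\<xi>. \<xi> \<notin> cball 0 (2 * L) \<Longrightarrow> h \<xi> = 0"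
    unfolding h_def using continuous_on_radial[OF ann[of 0]] radial_support[OF ann[of 0]] by auto
  have hi: "integrable lborel h" using integrable_continuous_compact_support[OF hc hs] .
  obtain C where hb: "\<And>\<xi>. norm (h \<xi>) \<le> C" using bounded_continuous_compact_support[OF hc hs] by blast
  have K: "integrable lborel (inv_fourier h)"
    unfolding h_def by (rule integrable_inv_fourier_radial[OF dim L2 ann])
  have proj: "freq_proj chi L f = convol (inv_fourier h) f"
    unfolding freq_proj_def fourier_multiplier_eq_convol[OF hi f, symmetric] by (simp add: h_def radial_def[abs_def])
  have four: "fourier (freq_proj chi L f) \<xi> = h \<xi> * fourier f \<xi>" for \<xi>
    unfolding proj fourier_convol[OF K f] fourier_inv_fourier[OF hi hc hb K] ..
  define k where "k \<xi> = cis (- (s * mu \<xi>)) * h \<xi>" for \<xi>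
  have k: "integrable lborel k" unfolding k_def by (rule integrable_cis_mult[OF hi]) measurable
  have kB: "norm (inv_fourier k x) \<le> B" for x
    using B[of x] by (simp add: k_def[abs_def] h_def radial_def)
  have "propagator mu s (freq_proj chi L f) = fourier_multiplier k f"
    unfolding propagator_def fourier_multiplier_def four
    by (simp add: k_def cis_conv_exp mult.assoc)
  also have "\<dots> = convol (inv_fourier k) f" using fourier_multiplier_eq_convol[OF k f] .
  finally have eq: "propagator mu s (freq_proj chi L f) = convol (inv_fourier k) f" .
  have [measurable]: "f \<in> borel_measurable borel" "inv_fourier k \<in> borel_measurable borel"
    using f inv_fourier_measurable[of k] k by simp_all
  have "norm (convol (inv_fourier k) f x) \<le> B * L1_norm f" for x
  proof -
    have "norm (convol (inv_fourier k) f x) \<le> (LINT y|lborel. B * norm (f y))"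
      unfolding convol_def
    proof (rule order.trans[OF integral_norm_bound], rule integral_mono)
      show i: "integrable lborel (\<lambda>y. B * norm (f y))" using f by simp
      show b: "norm (f y * inv_fourier k (x - y)) \<le> B * norm (f y)" for y
        using kB[of "x - y"] by (simp add: norm_mult mult.commute[of B] mult_left_mono)
      show "integrable lborel (\<lambda>y. norm (f y * inv_fourier k (x - y)))"
        by (rule Bochner_Integration.integrable_bound[OF i]) (auto intro!: AE_I2 order.trans[OF b])
    qed
    then show ?thesis by (simp add: L1_norm_def)
  qed
  then show ?thesis unfolding Linf_norm_def eq
    by (intro esssup_I AE_I2) (auto simp: convol_def)
qed

section \<open>Van der Corput estimates\<close>

lemma cis_has_vector_derivative:
  assumes "(\<phi> has_real_derivative d) (at x within S)"
  shows "((\<lambda>x. cis (\<phi> x)) has_vector_derivative (\<i> * of_real d * cis (\<phi> x))) (at x within S)"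
proof -
  have 1: "((\<lambda>x. \<i> * complex_of_real (\<phi> x)) has_vector_derivative (\<i> * of_real d)) (at x within S)"
    using assms by (auto intro!: derivative_eq_intros simp: has_real_derivative_iff_has_vector_derivative)
  have 2: "(exp has_field_derivative exp (\<i> * complex_of_real (\<phi> x))) (at (\<i> * complex_of_real (\<phi> x)) within T)" for T
    by (auto intro!: derivative_eq_intros)
  from field_vector_diff_chain_within[OF 1 2] show ?thesis
    by (simp add: o_def cis_conv_exp)
qed

text \<open>Integrate by parts after writing \<open>cis \<circ> \<phi>\<close> as its own derivative divided by \<open>\<i> * \<phi>'\<close>. Because \<open>\<phi>'\<close>
is monotone, the derivative of \<open>1 / \<phi>'\<close> has constant sign, and the integral of its absolute value is a
difference of two boundary values.\<close>

lemma van_der_corput_first_incr: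
  fixes \<phi> \<phi>' \<phi>'' :: "real \<Rightarrow> real"
  assumes ab: "a \<le> b" and \<mu>: "\<mu> > 0"
    and d1: "\<And>x. x \<in> {a..b} \<Longrightarrow> (\<phi> has_real_derivative \<phi>' x) (at x within {a..b})"
    and d2: "\<And>x. x \<in> {a..b} \<Longrightarrow> (\<phi>' has_real_derivative \<phi>'' x) (at x within {a..b})"
    and c: "continuous_on {a..b} \<phi>''"
    and lower: "\<And>x. x \<in> {a..b} \<Longrightarrow> \<mu> \<le> \<bar>\<phi>' x\<bar>"
    and convex: "\<And>x. x \<in> {a..b} \<Longrightarrow> 0 \<le> \<phi>'' x"
  shows "norm (integral {a..b} (\<lambda>x. cis (\<phi> x))) \<le> 4 / \<mu>"
proof -
  have nz: "\<phi>' x \<noteq> 0" if "x \<in> {a..b}" for x using lower[OF that] \<mu> by auto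
  have cp: "continuous_on {a..b} \<phi>" and cp': "continuous_on {a..b} \<phi>'"
    by (rule DERIV_continuous_on[OF d1] DERIV_continuous_on[OF d2]; simp)+
  define G where "G x = cis (\<phi> x) * of_real (\<phi>'' x / (\<phi>' x)\<^sup>2) / \<i>" for x
  define F where "F x = cis (\<phi> x) * of_real (1 / \<phi>' x) / \<i>" for x
  have cG: "continuous_on {a..b} G" unfolding G_def
    using nz by (intro continuous_intros c cp cp') auto
  have cc: "continuous_on {a..b} (\<lambda>x. cis (\<phi> x))" by (intro continuous_intros cp)
  have inv: "((\<lambda>x. 1 / \<phi>' x) has_real_derivative - \<phi>'' x / (\<phi>' x)\<^sup>2) (at x within {a..b})"
    if "x \<in> {a..b}" for x
    using DERIV_divide[OF DERIV_const d2[OF that] nz[OF that], of 1]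
    by (simp add: power2_eq_square)
  have "((\<lambda>x. cis (\<phi> x) - G x) has_integral F b - F a) {a..b}"
  proof (rule fundamental_theorem_of_calculus[OF ab])
    fix x assume x: "x \<in> {a..b}"
    have "((\<lambda>x. complex_of_real (1 / \<phi>' x)) has_vector_derivative of_real (- \<phi>'' x / (\<phi>' x)\<^sup>2)) (at x within {a..b})"
      by (intro has_vector_derivative_of_real inv[OF x])
    from has_vector_derivative_mult[OF cis_has_vector_derivative[OF d1[OF x]] this]
    have "((\<lambda>x. cis (\<phi> x) * complex_of_real (1 / \<phi>' x)) has_vector_derivative
        (cis (\<phi> x) * of_real (- \<phi>'' x / (\<phi>' x)\<^sup>2) + (\<i> * of_real (\<phi>' x) * cis (\<phi> x)) * of_real (1 / \<phi>' x))) (at x within {a..b})"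
      by simp
    from has_vector_derivative_mult_left[OF this, of "1 / \<i>"]
    have "(F has_vector_derivative
        (cis (\<phi> x) * of_real (- \<phi>'' x / (\<phi>' x)\<^sup>2) + (\<i> * of_real (\<phi>' x) * cis (\<phi> x)) * of_real (1 / \<phi>' x)) * (1 / \<i>)) (at x within {a..b})"
      unfolding F_def by (simp add: field_simps)
    also have "(cis (\<phi> x) * of_real (- \<phi>'' x / (\<phi>' x)\<^sup>2) + (\<i> * of_real (\<phi>' x) * cis (\<phi> x)) * of_real (1 / \<phi>' x)) * (1 / \<i>) = cis (\<phi> x) - G x"
      using nz[OF x] by (simp add: G_def field_simps)
    finally show "(F has_vector_derivative cis (\<phi> x) - G x) (at x within {a..b})" .
  qed
  from integral_unique[OF this] have eq: "integral {a..b} (\<lambda>x. cis (\<phi> x)) = F b - F a + integral {a..b} G"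
    by (subst (asm) integral_diff) (auto intro!: integrable_continuous_interval cc cG simp: algebra_simps)
  have nF: "norm (F x) \<le> 1 / \<mu>" if "x \<in> {a..b}" for x
    using lower[OF that] \<mu> by (simp add: F_def norm_mult norm_divide frac_le)
  moreover have "norm (integral {a..b} G) \<le> 2 / \<mu>"
  proof -
    have I: "((\<lambda>x. - \<phi>'' x / (\<phi>' x)\<^sup>2) has_integral 1 / \<phi>' b - 1 / \<phi>' a) {a..b}"
      using inv by (intro fundamental_theorem_of_calculus[OF ab])
        (auto simp: has_real_derivative_iff_has_vector_derivative[symmetric])
    from has_integral_neg[OF this]
    have I: "((\<lambda>x. \<phi>'' x / (\<phi>' x)\<^sup>2) has_integral 1 / \<phi>' a - 1 / \<phi>' b) {a..b}" by simp
    have "norm (integral {a..b} G) \<le> integral {a..b} (\<lambda>x. \<phi>'' x / (\<phi>' x)\<^sup>2)"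
      using convex
      by (intro integral_norm_bound_integral integrable_continuous_interval[OF cG] has_integral_integrable[OF I])
        (auto simp: G_def norm_mult norm_divide norm_power)
    also have "\<dots> = 1 / \<phi>' a - 1 / \<phi>' b" using I by (rule integral_unique)
    also have "\<dots> \<le> \<bar>1 / \<phi>' a\<bar> + \<bar>1 / \<phi>' b\<bar>" by linarith
    also have "\<dots> \<le> 1 / \<mu> + 1 / \<mu>"
      using lower[of a] lower[of b] \<mu> ab by (intro add_mono) (auto simp: frac_le)
    finally show ?thesis by simp
  qed
  moreover have "norm (F b - F a + integral {a..b} G) \<le> norm (F b) + norm (F a) + norm (integral {a..b} G)"
    by (meson norm_triangle_ineq norm_triangle_ineq4 add_right_mono order_trans)
  moreover have "1 / \<mu> + 1 / \<mu> + 2 / \<mu> = 4 / \<mu>" by (simp add: field_simps)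
  moreover have "norm (F a) \<le> 1 / \<mu>" "norm (F b) \<le> 1 / \<mu>" using nF ab by auto
  ultimately show ?thesis unfolding eq by linarith
qed

text \<open>The derivative \<open>\<phi>'\<close> increases at rate at least \<open>\<mu>\<close>, so \<open>\<bar>\<phi>' x\<bar> \<ge> \<mu> * \<bar>x - c\<bar>\<close> for its zero \<open>c\<close>, or for
an endpoint if it has none. Estimate the part within \<open>\<delta>\<close> of \<open>c\<close> by its length and the two outer
parts by the first derivative test with lower bound \<open>\<mu> * \<delta>\<close>. The choice \<open>\<delta> = 1 / sqrt \<mu>\<close> balances the
two contributions.\<close>

lemma van_der_corput_second_incr:
  fixes \<phi> \<phi>' \<phi>'' :: "real \<Rightarrow> real"
  assumes ab: "a \<le> b" and \<mu>: "\<mu> > 0"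
    and d1: "\<And>x. x \<in> {a..b} \<Longrightarrow> (\<phi> has_real_derivative \<phi>' x) (at x within {a..b})"
    and d2: "\<And>x. x \<in> {a..b} \<Longrightarrow> (\<phi>' has_real_derivative \<phi>'' x) (at x within {a..b})"
    and c: "continuous_on {a..b} \<phi>''"
    and convex: "\<And>x. x \<in> {a..b} \<Longrightarrow> \<mu> \<le> \<phi>'' x"
  shows "norm (integral {a..b} (\<lambda>x. cis (\<phi> x))) \<le> 10 / sqrt \<mu>"
proof -
  have cp: "continuous_on {a..b} \<phi>" and cp': "continuous_on {a..b} \<phi>'"
    by (rule DERIV_continuous_on[OF d1] DERIV_continuous_on[OF d2]; simp)+
  have slope: "\<phi>' y - \<phi>' x \<ge> \<mu> * (y - x)" if "a \<le> x" "x \<le> y" "y \<le> b" for x y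
  proof -
    have "((\<lambda>t. \<phi>' t - \<mu> * t) has_real_derivative \<phi>'' t - \<mu>) (at t within {a..b})" if "t \<in> {a..b}" for t
      using d2[OF that] by (auto intro!: derivative_eq_intros)
    then have "((\<lambda>t. \<phi>' t - \<mu> * t) has_derivative (*) (\<phi>'' t - \<mu>)) (at t within {x..y})" if "t \<in> {x..y}" for t
      using that \<open>a \<le> x\<close> \<open>y \<le> b\<close>
      by - (rule has_derivative_subset[of _ _ _ "{a..b}"], auto simp: has_field_derivative_def)
    then have "\<exists>t\<in>{x..y}. (\<phi>' y - \<mu> * y) - (\<phi>' x - \<mu> * x) = (\<phi>'' t - \<mu>) * (y - x)"
      using mvt_very_simple[of x y "\<lambda>t. \<phi>' t - \<mu> * t" "\<lambda>t. (*) (\<phi>'' t - \<mu>)"] \<open>x \<le> y\<close> by auto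
    then obtain t where t: "t \<in> {x..y}" "(\<phi>' y - \<mu> * y) - (\<phi>' x - \<mu> * x) = (\<phi>'' t - \<mu>) * (y - x)" ..
    moreover have "(\<phi>'' t - \<mu>) * (y - x) \<ge> 0" using convex[of t] t(1) that by simp
    ultimately show ?thesis by (simp add: algebra_simps)
  qed
  \<comment> \<open>If \<open>\<phi>'\<close> has no zero, \<open>c\<close> is the endpoint at which \<open>\<bar>\<phi>'\<bar>\<close> is smallest.\<close>
  obtain c where c': "a \<le> c" "c \<le> b" "c < b \<Longrightarrow> \<phi>' c \<ge> 0" "a < c \<Longrightarrow> \<phi>' c \<le> 0"
  proof (cases "\<phi>' a \<ge> 0 \<or> \<phi>' b \<le> 0")
    case True then show ?thesis using that[of a] that[of b] ab by auto
  next
    case False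
    then obtain c where "a \<le> c" "c \<le> b" "\<phi>' c = 0"
      using IVT'[of \<phi>' a 0 b] ab cp' by auto
    then show ?thesis using that[of c] by simp
  qed
  define \<delta> where "\<delta> = 1 / sqrt \<mu>"
  have \<delta>: "\<delta> > 0" "\<mu> * \<delta> = sqrt \<mu>" using \<mu> by (auto simp: \<delta>_def real_div_sqrt)
  have away: "\<mu> * \<delta> \<le> \<bar>\<phi>' x\<bar>" if "x \<in> {a..b}" "\<delta> \<le> \<bar>x - c\<bar>" for x
  proof -
    have "\<mu> * \<delta> \<le> \<mu> * \<bar>x - c\<bar>" using \<mu> that by simp
    also have "\<dots> \<le> \<bar>\<phi>' x\<bar>"
    proof (cases "x \<ge> c")
      case True
      with slope[of c x] c' that \<delta> show ?thesis by (auto simp: abs_if)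
    next
      case False
      with slope[of x c] c' that \<delta> show ?thesis by (auto simp: abs_if algebra_simps)
    qed
    finally show ?thesis .
  qed
  have part: "norm (integral {p..q} (\<lambda>x. cis (\<phi> x))) \<le> 4 / sqrt \<mu>"
    if "a \<le> p" "p \<le> q" "q \<le> b" "\<And>x. x \<in> {p..q} \<Longrightarrow> \<delta> \<le> \<bar>x - c\<bar>" for p q
  proof -
    have sub: "{p..q} \<subseteq> {a..b}" using that by auto
    have "norm (integral {p..q} (\<lambda>x. cis (\<phi> x))) \<le> 4 / (\<mu> * \<delta>)"
    proof (rule van_der_corput_first_incr[where \<phi>' = \<phi>' and \<phi>'' = \<phi>''])
      show "(\<phi> has_real_derivative \<phi>' x) (at x within {p..q})"
           "(\<phi>' has_real_derivative \<phi>'' x) (at x within {p..q})" if "x \<in> {p..q}" for x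
        using d1 d2 sub that by (auto intro: DERIV_subset[of _ _ _ "{a..b}"])
      show "continuous_on {p..q} \<phi>''" using c sub by (rule continuous_on_subset)
      show "\<mu> * \<delta> \<le> \<bar>\<phi>' x\<bar>" if "x \<in> {p..q}" for x
        using away[of x] sub that \<open>\<And>x. x \<in> {p..q} \<Longrightarrow> \<delta> \<le> \<bar>x - c\<bar>\<close> by auto
      show "0 \<le> \<phi>'' x" if "x \<in> {p..q}" for x
        using convex[of x] \<mu> sub that by auto
    qed (use \<open>p \<le> q\<close> \<mu> \<delta> in auto)
    then show ?thesis using \<delta> by simp
  qed
  define l u where "l = max a (c - \<delta>)" and "u = min b (c + \<delta>)"
  have lu: "a \<le> l" "l \<le> c" "c \<le> u" "u \<le> b" using c' \<delta> by (auto simp: l_def u_def)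
  have int: "(\<lambda>x. cis (\<phi> x)) integrable_on {p..q}" if "a \<le> p" "q \<le> b" for p q
    using that by (intro integrable_continuous_interval continuous_intros continuous_on_subset[OF cp]) auto
  have "integral {a..b} (\<lambda>x. cis (\<phi> x)) = integral {a..l} (\<lambda>x. cis (\<phi> x)) +
      (integral {l..u} (\<lambda>x. cis (\<phi> x)) + integral {u..b} (\<lambda>x. cis (\<phi> x)))"
    using Henstock_Kurzweil_Integration.integral_combine[of a l b "\<lambda>x. cis (\<phi> x)"]
      Henstock_Kurzweil_Integration.integral_combine[of l u b "\<lambda>x. cis (\<phi> x)"] lu int by auto
  moreover have "norm (integral {a..l} (\<lambda>x. cis (\<phi> x))) \<le> 4 / sqrt \<mu>"
  proof (cases "l = a")
    case False
    then have "l = c - \<delta>" by (auto simp: l_def max_def split: if_splits)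
    then show ?thesis using lu by (intro part) auto
  qed (use \<mu> in simp)
  moreover have "norm (integral {u..b} (\<lambda>x. cis (\<phi> x))) \<le> 4 / sqrt \<mu>"
  proof (cases "u = b")
    case False
    then have "u = c + \<delta>" by (auto simp: u_def min_def split: if_splits)
    then show ?thesis using lu by (intro part) auto
  qed (use \<mu> in simp)
  moreover have "norm (integral {l..u} (\<lambda>x. cis (\<phi> x))) \<le> 2 / sqrt \<mu>"
  proof -
    have "norm (integral {l..u} (\<lambda>x. cis (\<phi> x))) \<le> 1 * (u - l)"
      using lu int by (intro integral_bound continuous_intros continuous_on_subset[OF cp]) auto
    also have "\<dots> \<le> 2 * \<delta>" by (auto simp: l_def u_def)
    finally show ?thesis by (simp add: \<delta>_def)
  qed
  moreover have "4 / sqrt \<mu> + (2 / sqrt \<mu> + 4 / sqrt \<mu>) = 10 / sqrt \<mu>" by (simp add: field_simps)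
  moreover have "norm (x + (y + z)) \<le> norm x + (norm y + norm z)" for x y z :: complex by norm
  ultimately show ?thesis
    by (smt (verit))
qed

lemma norm_integral_cis_minus:
  "norm (integral S (\<lambda>x. cis (- \<phi> x))) = norm (integral S (\<lambda>x. cis (\<phi> x)))"
  by (simp flip: cis_cnj integral_cnj)

lemma van_der_corput_first:
  fixes \<phi> \<phi>' \<phi>'' :: "real \<Rightarrow> real"
  assumes ab: "a \<le> b" and \<mu>: "\<mu> > 0"
    and d1: "\<And>x. x \<in> {a..b} \<Longrightarrow> (\<phi> has_real_derivative \<phi>' x) (at x within {a..b})"
    and d2: "\<And>x. x \<in> {a..b} \<Longrightarrow> (\<phi>' has_real_derivative \<phi>'' x) (at x within {a..b})"
    and c: "continuous_on {a..b} \<phi>''"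
    and lower: "\<And>x. x \<in> {a..b} \<Longrightarrow> \<mu> \<le> \<bar>\<phi>' x\<bar>"
    and convex: "(\<forall>x\<in>{a..b}. 0 \<le> \<phi>'' x) \<or> (\<forall>x\<in>{a..b}. \<phi>'' x \<le> 0)"
  shows "norm (integral {a..b} (\<lambda>x. cis (\<phi> x))) \<le> 4 / \<mu>"
  using convex
proof
  assume "\<forall>x\<in>{a..b}. 0 \<le> \<phi>'' x"
  with assms show ?thesis by (intro van_der_corput_first_incr[where \<phi>' = \<phi>' and \<phi>'' = \<phi>'']) auto
next
  assume "\<forall>x\<in>{a..b}. \<phi>'' x \<le> 0"
  with assms have "norm (integral {a..b} (\<lambda>x. cis (- \<phi> x))) \<le> 4 / \<mu>"
    by (intro van_der_corput_first_incr[where \<phi>' = "\<lambda>x. - \<phi>' x" and \<phi>'' = "\<lambda>x. - \<phi>'' x"])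
      (auto intro!: DERIV_minus continuous_intros)
  then show ?thesis by (simp only: norm_integral_cis_minus)
qed

lemma van_der_corput_second:
  fixes \<phi> \<phi>' \<phi>'' :: "real \<Rightarrow> real"
  assumes ab: "a \<le> b" and \<mu>: "\<mu> > 0"
    and d1: "\<And>x. x \<in> {a..b} \<Longrightarrow> (\<phi> has_real_derivative \<phi>' x) (at x within {a..b})"
    and d2: "\<And>x. x \<in> {a..b} \<Longrightarrow> (\<phi>' has_real_derivative \<phi>'' x) (at x within {a..b})"
    and c: "continuous_on {a..b} \<phi>''"
    and convex: "(\<forall>x\<in>{a..b}. \<mu> \<le> \<phi>'' x) \<or> (\<forall>x\<in>{a..b}. \<phi>'' x \<le> - \<mu>)"
  shows "norm (integral {a..b} (\<lambda>x. cis (\<phi> x))) \<le> 10 / sqrt \<mu>"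
  using convex
proof
  assume "\<forall>x\<in>{a..b}. \<mu> \<le> \<phi>'' x"
  with assms show ?thesis by (intro van_der_corput_second_incr[where \<phi>' = \<phi>' and \<phi>'' = \<phi>'']) auto
next
  assume *: "\<forall>x\<in>{a..b}. \<phi>'' x \<le> - \<mu>"
  have "norm (integral {a..b} (\<lambda>x. cis (- \<phi> x))) \<le> 10 / sqrt \<mu>"
  proof (rule van_der_corput_second_incr[where \<phi>' = "\<lambda>x. - \<phi>' x" and \<phi>'' = "\<lambda>x. - \<phi>'' x"])
    show "\<mu> \<le> - \<phi>'' x" if "x \<in> {a..b}" for x using * that by fastforce
  qed (use assms in \<open>auto intro!: DERIV_minus continuous_intros\<close>)
  then show ?thesis by (simp only: norm_integral_cis_minus)
qed

text \<open>Integration by parts against the primitive \<open>E\<close> of \<open>f\<close> moves the derivative onto the amplitude.\<close>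

lemma integral_amplitude_bound:
  fixes f :: "real \<Rightarrow> complex" and \<psi> \<psi>' :: "real \<Rightarrow> real"
  assumes ab: "a \<le> b" and f: "continuous_on {a..b} f"
    and A: "\<And>x. x \<in> {a..b} \<Longrightarrow> norm (integral {a..x} f) \<le> A"
    and d: "\<And>x. x \<in> {a..b} \<Longrightarrow> (\<psi> has_real_derivative \<psi>' x) (at x within {a..b})"
    and c: "continuous_on {a..b} \<psi>'"
    and M: "\<And>x. x \<in> {a..b} \<Longrightarrow> \<bar>\<psi>' x\<bar> \<le> M"
  shows "norm (integral {a..b} (\<lambda>x. f x * of_real (\<psi> x))) \<le> A * (\<bar>\<psi> b\<bar> + M * (b - a))"
proof -
  define E where "E x = integral {a..x} f" for x
  have dE: "(E has_vector_derivative f x) (at x within {a..b})" if "x \<in> {a..b}" for x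
    unfolding E_def using integral_has_vector_derivative[OF f that] .
  have cE: "continuous_on {a..b} E"
    unfolding continuous_on_eq_continuous_within using dE has_vector_derivative_continuous by blast
  have cpsi: "continuous_on {a..b} \<psi>" using d by (rule DERIV_continuous_on)
  have "((\<lambda>x. f x * of_real (\<psi> x) + E x * of_real (\<psi>' x)) has_integral E b * of_real (\<psi> b) - E a * of_real (\<psi> a)) {a..b}"
  proof (rule fundamental_theorem_of_calculus[OF ab])
    fix x assume x: "x \<in> {a..b}"
    have "((\<lambda>x. complex_of_real (\<psi> x)) has_vector_derivative of_real (\<psi>' x)) (at x within {a..b})"
      by (intro has_vector_derivative_of_real d[OF x])
    from has_vector_derivative_mult[OF dE[OF x] this]
    show "((\<lambda>x. E x * of_real (\<psi> x)) has_vector_derivative f x * of_real (\<psi> x) + E x * of_real (\<psi>' x)) (at x within {a..b})"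
      by (simp add: add.commute)
  qed
  moreover have "E a = 0" by (simp add: E_def)
  ultimately have *: "((\<lambda>x. f x * of_real (\<psi> x) + E x * of_real (\<psi>' x)) has_integral E b * of_real (\<psi> b)) {a..b}"
    by simp
  from integral_unique[OF *]
  have eq: "integral {a..b} (\<lambda>x. f x * of_real (\<psi> x)) = E b * of_real (\<psi> b) - integral {a..b} (\<lambda>x. E x * of_real (\<psi>' x))"
    by (subst (asm) Henstock_Kurzweil_Integration.integral_add)
      (auto intro!: integrable_continuous_interval continuous_intros f cE c cpsi simp: algebra_simps)
  have A0: "A \<ge> 0" using A[of a] ab norm_ge_zero order_trans by fastforce
  have "norm (integral {a..b} (\<lambda>x. E x * of_real (\<psi>' x))) \<le> (A * M) * (b - a)"
  proof (rule integral_bound[OF ab])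
    show "norm (E x * of_real (\<psi>' x)) \<le> A * M" if "x \<in> {a..b}" for x
      using A[OF that] M[OF that] A0 by (simp add: E_def norm_mult mult_mono)
  qed (intro continuous_intros cE c)
  moreover have "norm (E b * of_real (\<psi> b)) \<le> A * \<bar>\<psi> b\<bar>"
    using A[of b] ab by (simp add: E_def norm_mult mult_right_mono)
  moreover have "norm (E b * of_real (\<psi> b) - integral {a..b} (\<lambda>x. E x * of_real (\<psi>' x))) \<le>
      norm (E b * of_real (\<psi> b)) + norm (integral {a..b} (\<lambda>x. E x * of_real (\<psi>' x)))"
    by (rule norm_triangle_ineq4)
  moreover have "A * (\<bar>\<psi> b\<bar> + M * (b - a)) = A * \<bar>\<psi> b\<bar> + (A * M) * (b - a)"
    by (simp add: algebra_simps)
  ultimately show ?thesis unfolding eq by linarith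
qed

section \<open>The dispersion relation\<close>

definition disp :: "real \<Rightarrow> real" where "disp r = sqrt (r * tanh r)"

definition disp' :: "real \<Rightarrow> real" where
  "disp' r = (tanh r + r * (1 - (tanh r)\<^sup>2)) / (2 * disp r)"

text \<open>The numerator of the second derivative of \<open>sqrt q\<close> with \<open>q = r * tanh r\<close> is \<open>2 q q'' - q'\<^sup>2\<close>. It is
written here as minus a sum of nonnegative terms, which shows that \<open>disp\<close> is concave on the positive axis.\<close>

definition disp'' :: "real \<Rightarrow> real" where
  "disp'' r = - ((tanh r - r * (1 - (tanh r)\<^sup>2))\<^sup>2 + 4 * r\<^sup>2 * (tanh r)\<^sup>2 * (1 - (tanh r)\<^sup>2)) / (4 * disp r ^ 3)"

lemma disp_pos: "r > 0 \<Longrightarrow> disp r > 0"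
  by (simp add: disp_def)

lemma disp_sq: "r > 0 \<Longrightarrow> disp r ^ 2 = r * tanh r"
  by (simp add: disp_def)

lemma DERIV_disp:
  assumes "r > 0" shows "(disp has_real_derivative disp' r) (at r)"
proof -
  have p: "r * tanh r > 0" using assms by simp
  have "((\<lambda>r. r * tanh r) has_real_derivative (tanh r + r * (1 - (tanh r)\<^sup>2))) (at r)"
    by (auto intro!: derivative_eq_intros)
  from DERIV_chain2[OF DERIV_real_sqrt[OF p] this] show ?thesis
    unfolding disp_def[abs_def] disp'_def by (simp add: field_simps)
qed

lemma DERIV_disp':
  assumes "r > 0" shows "(disp' has_real_derivative disp'' r) (at r)"
proof -
  have p: "disp r > 0" using disp_pos[OF assms] .
  have sq: "disp r ^ 2 = r * tanh r" using disp_sq[OF assms] .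
  define T where "T = tanh r"
  have N: "((\<lambda>r. tanh r + r * (1 - (tanh r)\<^sup>2)) has_real_derivative
      (2 * (1 - T\<^sup>2) - 2 * r * T * (1 - T\<^sup>2))) (at r)"
    unfolding T_def by (auto intro!: derivative_eq_intros simp: algebra_simps power2_eq_square)
  have D: "((\<lambda>r. 2 * disp r) has_real_derivative 2 * disp' r) (at r)"
    using DERIV_disp[OF assms] by (rule DERIV_cmult)
  have *: "(disp' has_real_derivative
      ((2 * (1 - T\<^sup>2) - 2 * r * T * (1 - T\<^sup>2)) * (2 * disp r) - (T + r * (1 - T\<^sup>2)) * (2 * disp' r)) / (2 * disp r)\<^sup>2) (at r)"
    unfolding disp'_def[abs_def] using DERIV_divide[OF N D] p
    by (simp add: T_def disp'_def power2_eq_square)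
  have quot: "(n * (2 * M) - A * (2 * (A / (2 * M)))) / (2 * M)\<^sup>2 = (2 * n * M\<^sup>2 - A\<^sup>2) / (4 * M ^ 3)"
    if "M > 0" for n A M :: real
    using that by (simp add: divide_simps power2_eq_square power3_eq_cube)
  have num: "2 * (2 * S - 2 * r * T * S) * (r * T) - (T + r * S)\<^sup>2 =
      - ((T - r * S)\<^sup>2 + 4 * r\<^sup>2 * T\<^sup>2 * S)" for S
    by (simp add: algebra_simps power2_eq_square)
  have "((2 * (1 - T\<^sup>2) - 2 * r * T * (1 - T\<^sup>2)) * (2 * disp r) - (T + r * (1 - T\<^sup>2)) * (2 * disp' r)) / (2 * disp r)\<^sup>2
     = disp'' r"
    unfolding disp'_def T_def[symmetric] quot[OF p] disp''_def sq by (simp only: T_def[symmetric] num)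
  with * show ?thesis by simp
qed

lemma tanh_ge_half:
  assumes "r \<ge> 1" shows "tanh r \<ge> (1/2 :: real)"
proof -
  have "exp (2::real) \<ge> 3" using exp_ge_add_one_self[of "2::real"] by simp
  moreover have "exp (2 * r) \<ge> exp 2" using assms by simp
  ultimately have "exp (2 * r) \<ge> 3" by linarith
  then have "exp (- (2 * r)) \<le> 1/3" by (simp add: exp_minus field_simps)
  then show ?thesis by (simp add: tanh_real_altdef le_divide_eq add_pos_pos)
qed

lemma disp_le_sqrt: "r > 0 \<Longrightarrow> disp r \<le> sqrt r"
  unfolding disp_def using tanh_real_lt_1[of r] by (simp add: mult_left_le)

text \<open>The numerator of \<open>disp'\<close> is at least \<open>tanh r \<ge> 1 / 2\<close>, and \<open>disp r \<le> sqrt r\<close>.\<close>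

lemma disp'_ge:
  assumes "r \<ge> 1" shows "disp' r \<ge> 1 / (4 * sqrt r)"
proof -
  define T where "T = tanh r"
  have T: "1/2 \<le> T" "T < 1" using tanh_ge_half[OF assms] tanh_real_lt_1 by (auto simp: T_def)
  have "T\<^sup>2 \<le> 1" using T by (simp add: power_le_one)
  then have n: "T + r * (1 - T\<^sup>2) \<ge> 1/2" using T assms by (smt (verit) mult_nonneg_nonneg)
  have "1 / (4 * sqrt r) = (1/2) / (2 * sqrt r)" by simp
  also have "\<dots> \<le> (1/2) / (2 * disp r)"
    using disp_le_sqrt[of r] disp_pos[of r] assms by (intro divide_left_mono) auto
  also have "\<dots> \<le> disp' r"
    unfolding disp'_def T_def[symmetric] using n disp_pos[of r] assms by (intro divide_right_mono) auto
  finally show ?thesis .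
qed

text \<open>With \<open>T = tanh r\<close> and \<open>S = 1 - T\<^sup>2\<close>, the numerator \<open>(T - r S)\<^sup>2 + 4 r\<^sup>2 T\<^sup>2 S\<close> equals
\<open>T\<^sup>2 + r\<^sup>2 S\<^sup>2 + 2 r T S (2 r T - 1)\<close>. Since \<open>2 r T \<ge> 1\<close> for \<open>r \<ge> 1\<close>, it is at least
\<open>T\<^sup>2 \<ge> 1 / 4\<close>.\<close>

lemma disp''_le:
  assumes "r \<ge> 1" shows "disp'' r \<le> - 1 / (16 * sqrt r ^ 3)"
proof -
  define T where "T = tanh r"
  have T: "1/2 \<le> T" "T < 1" using tanh_ge_half[OF assms] tanh_real_lt_1 by (auto simp: T_def)
  define S where "S = 1 - T\<^sup>2"
  have S: "S \<ge> 0" using T by (simp add: power_le_one S_def)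
  have T2: "T\<^sup>2 \<ge> 1/4" using power_mono[OF T(1), of 2] by (simp add: power2_eq_square)
  have rT: "2 * (r * T) \<ge> 1" using mult_mono[OF assms T(1)] assms by simp
  have "(T - r * S)\<^sup>2 + 4 * r\<^sup>2 * T\<^sup>2 * S = T\<^sup>2 + r\<^sup>2 * S\<^sup>2 + 2 * (r * T) * S * (2 * (r * T) - 1)"
    by (simp add: power2_eq_square algebra_simps)
  moreover have "2 * (r * T) * S * (2 * (r * T) - 1) \<ge> 0" using rT S by simp
  moreover have "r\<^sup>2 * S\<^sup>2 \<ge> 0" by simp
  ultimately have n: "(T - r * S)\<^sup>2 + 4 * r\<^sup>2 * T\<^sup>2 * S \<ge> 1/4" using T2 by linarith
  have "1 / (16 * sqrt r ^ 3) = (1/4) / (4 * sqrt r ^ 3)" by simp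
  also have "\<dots> \<le> (1/4) / (4 * disp r ^ 3)"
    using disp_le_sqrt[of r] disp_pos[of r] assms by (intro divide_left_mono mult_left_mono power_mono) auto
  also have "\<dots> \<le> ((T - r * S)\<^sup>2 + 4 * r\<^sup>2 * T\<^sup>2 * S) / (4 * disp r ^ 3)"
    using n disp_pos[of r] assms by (intro divide_right_mono) auto
  also have "\<dots> = - disp'' r" by (simp only: disp''_def T_def S_def minus_divide_left[symmetric] minus_minus)
  finally show ?thesis by simp
qed

lemma continuous_on_disp:
  "continuous_on UNIV disp" "continuous_on {0<..} disp''"
proof -
  have "continuous_on UNIV (\<lambda>r::real. r * tanh r)" by (intro continuous_intros) simp
  then show 1: "continuous_on UNIV disp" unfolding disp_def[abs_def] by (rule continuous_on_real_sqrt)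
  show "continuous_on {0<..} disp''"
    unfolding disp''_def by (intro continuous_intros continuous_on_subset[OF 1]) (auto simp: disp_pos less_imp_neq[THEN not_sym])
qed

lemma m1_eq_disp: "\<xi> > 0 \<Longrightarrow> m1 \<xi> = disp \<xi>" "m1 (- \<xi>) = - m1 \<xi>"
proof -
  show "m1 \<xi> = disp \<xi>" if "\<xi> > 0"
  proof -
    have "\<xi> * sqrt (tanh \<xi> / \<xi>) = sqrt (\<xi>\<^sup>2) * sqrt (tanh \<xi> / \<xi>)" using that by simp
    also have "\<dots> = sqrt (\<xi>\<^sup>2 * (tanh \<xi> / \<xi>))" by (rule real_sqrt_mult[symmetric])
    also have "\<xi>\<^sup>2 * (tanh \<xi> / \<xi>) = \<xi> * tanh \<xi>" using that by (simp add: power2_eq_square)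
    finally show ?thesis by (simp add: m1_def disp_def)
  qed
qed (simp add: m1_def)

lemma m2_eq_disp: "m2 \<xi> = disp (norm \<xi>)"
proof (cases "\<xi> = 0")
  case False
  then show ?thesis using m1_eq_disp(1)[of "norm \<xi>"] by (simp add: m1_def m2_def)
qed (simp add: m2_def disp_def)

section \<open>The radial oscillatory integral\<close>

lemma phase_derivatives:
  assumes "r > 0"
  shows "((\<lambda>r. y * r - s * disp r) has_real_derivative (y - s * disp' r)) (at r within S)"
    and "((\<lambda>r. y - s * disp' r) has_real_derivative (- s * disp'' r)) (at r within S)"
  using DERIV_subset[OF DERIV_disp[OF assms], of S] DERIV_subset[OF DERIV_disp'[OF assms], of S]
  by (auto intro!: derivative_eq_intros)

text \<open>As \<open>disp\<close> is concave, the second derivative of the phase has the sign of \<open>s\<close>; the lower bound for its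
size is weakest at the largest frequency \<open>2 * L\<close>.\<close>

lemma phase_second_derivative_bound:
  assumes L: "L \<ge> 2" and x: "x \<le> 2 * L"
  shows "(\<forall>r\<in>{L/2..x}. \<bar>s\<bar> / (16 * sqrt (2 * L) ^ 3) \<le> - s * disp'' r) \<or>
         (\<forall>r\<in>{L/2..x}. - s * disp'' r \<le> - (\<bar>s\<bar> / (16 * sqrt (2 * L) ^ 3)))"
proof -
  have *: "\<bar>s\<bar> / (16 * sqrt (2 * L) ^ 3) \<le> \<bar>s\<bar> * (- disp'' r)" if "r \<in> {L/2..x}" for r
  proof -
    have r: "1 \<le> r" "r \<le> 2 * L" using that L x by auto
    have "1 / (16 * sqrt (2 * L) ^ 3) \<le> 1 / (16 * sqrt r ^ 3)"
      using r by (intro divide_left_mono mult_left_mono power_mono) auto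
    also have "\<dots> \<le> - disp'' r" using disp''_le[OF r(1)] by simp
    finally show ?thesis using mult_left_mono[of _ _ "\<bar>s\<bar>"] by fastforce
  qed
  show ?thesis
  proof (cases "s \<ge> 0")
    case True then show ?thesis using * by (intro disjI1 ballI) simp
  next
    case False
    have "- s * disp'' r \<le> - (\<bar>s\<bar> / (16 * sqrt (2 * L) ^ 3))" if "r \<in> {L/2..x}" for r
      using *[OF that] False by simp
    then show ?thesis by blast
  qed
qed

lemma continuous_on_phase:
  assumes "L \<ge> (2::real)"
  shows "continuous_on {L/2..x} (\<lambda>r. - s * disp'' r)" "continuous_on {L/2..x} (\<lambda>r. cis (y * r - s * disp r))"
proof -
  have "{L/2..x} \<subseteq> {0<..}" using assms by auto
  from continuous_on_subset[OF continuous_on_disp(2) this] continuous_on_subset[OF continuous_on_disp(1) subset_UNIV, of "{L/2..x}"]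
  show "continuous_on {L/2..x} (\<lambda>r. - s * disp'' r)" "continuous_on {L/2..x} (\<lambda>r. cis (y * r - s * disp r))"
    by (auto intro!: continuous_intros)
qed

text \<open>The amplitude \<open>\<psi>\<close> is that of a radial integral over \<open>{L/2..2*L}\<close>. Both dimensions use the same
estimates, with \<open>\<psi> r = bump chi (r / L)\<close> and, for the polar volume element,
\<open>\<psi> r = r * bump chi (r / L)\<close>. The number \<open>L * M\<close> measures the size of \<open>\<psi>\<close>.\<close>

locale amplitude =
  fixes L M :: real and \<psi> \<psi>' :: "real \<Rightarrow> real"
  assumes L: "L \<ge> 2"
    and \<psi>: "\<And>r. (\<psi> has_real_derivative \<psi>' r) (at r)"
    and \<psi>': "continuous_on UNIV \<psi>'" "\<And>r. r \<in> {L/2..2*L} \<Longrightarrow> \<bar>\<psi>' r\<bar> \<le> M"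
    and \<psi>0: "\<psi> (2 * L) = 0"
begin

lemma oscillatory_bound:
  assumes A: "\<And>x. x \<in> {L/2..2*L} \<Longrightarrow> norm (integral {L/2..x} (\<lambda>r. cis (y * r - s * disp r))) \<le> A"
  shows "norm (integral {L/2..2*L} (\<lambda>r. cis (y * r - s * disp r) * of_real (\<psi> r))) \<le> (3/2) * A * (L * M)"
proof -
  have "norm (integral {L/2..2*L} (\<lambda>r. cis (y * r - s * disp r) * of_real (\<psi> r))) \<le> A * (\<bar>\<psi> (2 * L)\<bar> + M * (2 * L - L / 2))"
    using L by (intro integral_amplitude_bound[where \<psi>' = \<psi>'] continuous_on_phase A
        has_field_derivative_at_within[OF \<psi>] continuous_on_subset[OF \<psi>'(1)] \<psi>'(2)) auto
  then show ?thesis unfolding \<psi>0 by (simp add: algebra_simps)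
qed

text \<open>The linear term \<open>y * r\<close> of the phase does not affect its second derivative, so the bound is uniform in \<open>y\<close>.\<close>

lemma second_derivative_bound:
  assumes s: "s \<noteq> 0"
  shows "norm (integral {L/2..2*L} (\<lambda>r. cis (y * r - s * disp r) * of_real (\<psi> r)))
     \<le> 60 * sqrt (sqrt (2 * L) ^ 3 / \<bar>s\<bar>) * (L * M)"
proof -
  define \<mu> where "\<mu> = \<bar>s\<bar> / (16 * sqrt (2 * L) ^ 3)"
  have \<mu>: "\<mu> > 0" using s L by (simp add: \<mu>_def)
  have "sqrt \<mu> = sqrt \<bar>s\<bar> / (4 * sqrt (sqrt (2 * L) ^ 3))"
    unfolding \<mu>_def by (simp add: real_sqrt_divide real_sqrt_mult)
  then have *: "10 / sqrt \<mu> = 40 * sqrt (sqrt (2 * L) ^ 3 / \<bar>s\<bar>)"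
    by (simp add: real_sqrt_divide)
  have "norm (integral {L/2..x} (\<lambda>r. cis (y * r - s * disp r))) \<le> 10 / sqrt \<mu>" if "x \<in> {L/2..2*L}" for x
  proof (rule van_der_corput_second[OF _ \<mu>])
    show "((\<lambda>r. y * r - s * disp r) has_real_derivative (y - s * disp' r)) (at r within {L/2..x})"
         "((\<lambda>r. y - s * disp' r) has_real_derivative (- s * disp'' r)) (at r within {L/2..x})" if "r \<in> {L/2..x}" for r
      using that L by (intro phase_derivatives; simp)+
  qed (use that phase_second_derivative_bound[OF L, of x s] continuous_on_phase[OF L] in \<open>auto simp: \<mu>_def\<close>)
  from oscillatory_bound[OF this] show ?thesis unfolding * by simp
qed

text \<open>On the support, \<open>\<bar>s * disp' r\<bar>\<close> is at least \<open>\<bar>s\<bar> / (4 * sqrt (2 * L))\<close>, twice the largest admissible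
\<open>\<bar>y\<bar>\<close>. Hence the phase has no stationary point.\<close>

lemma first_derivative_bound:
  assumes s: "s \<noteq> 0" and y: "\<bar>y\<bar> \<le> \<bar>s\<bar> / (8 * sqrt (2 * L))"
  shows "norm (integral {L/2..2*L} (\<lambda>r. cis (y * r - s * disp r) * of_real (\<psi> r)))
     \<le> 48 * (sqrt (2 * L) / \<bar>s\<bar>) * (L * M)"
proof -
  define \<mu> where "\<mu> = \<bar>s\<bar> / (8 * sqrt (2 * L))"
  have \<mu>: "\<mu> > 0" using s L by (simp add: \<mu>_def)
  have "norm (integral {L/2..x} (\<lambda>r. cis (y * r - s * disp r))) \<le> 4 / \<mu>" if x: "x \<in> {L/2..2*L}" for x
  proof (rule van_der_corput_first[OF _ \<mu>])
    show "((\<lambda>r. y * r - s * disp r) has_real_derivative (y - s * disp' r)) (at r within {L/2..x})"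
         "((\<lambda>r. y - s * disp' r) has_real_derivative (- s * disp'' r)) (at r within {L/2..x})" if "r \<in> {L/2..x}" for r
      using that L by (intro phase_derivatives; simp)+
    have "0 \<le> \<bar>s\<bar> / (16 * sqrt (2 * L) ^ 3)" using L by simp
    then show "(\<forall>r\<in>{L/2..x}. 0 \<le> - s * disp'' r) \<or> (\<forall>r\<in>{L/2..x}. - s * disp'' r \<le> 0)"
      using phase_second_derivative_bound[OF L, of x s] x by (meson atLeastAtMost_iff neg_le_0_iff_le order_trans)
    show "\<mu> \<le> \<bar>y - s * disp' r\<bar>" if "r \<in> {L/2..x}" for r
    proof -
      have r: "1 \<le> r" "r \<le> 2 * L" using that L x by auto
      have "1 / (4 * sqrt (2 * L)) \<le> 1 / (4 * sqrt r)"
        using r by (intro divide_left_mono mult_left_mono) auto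
      also have "\<dots> \<le> disp' r" by (rule disp'_ge[OF r(1)])
      finally have "\<bar>s\<bar> * (1 / (4 * sqrt (2 * L))) \<le> \<bar>s\<bar> * \<bar>disp' r\<bar>" by (intro mult_left_mono) auto
      then have "2 * \<mu> \<le> \<bar>s * disp' r\<bar>" by (simp add: \<mu>_def abs_mult)
      then show ?thesis using y unfolding \<mu>_def[symmetric] by linarith
    qed
  qed (use x continuous_on_phase[OF L] in auto)
  from oscillatory_bound[OF this] show ?thesis by (simp add: \<mu>_def)
qed

end

lemma bump_derivative:
  assumes "cutoff chi"
  obtains b' B where "\<And>r. (bump chi has_real_derivative b' r) (at r)" "continuous_on UNIV b'"
    "B > 0" "\<And>r. \<bar>bump chi r\<bar> \<le> B" "\<And>r. \<bar>b' r\<bar> \<le> B"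
proof -
  have "annular (1/2) 2 (Suc 0) (bump chi)" using annular_bump[OF assms, of 1 "Suc 0"] by simp
  then obtain b' where b': "\<And>r. (bump chi has_real_derivative b' r) (at r)" and ann': "annular (1/2) 2 0 b'"
    unfolding annular.simps(2)[of _ _ 0] by blast
  have "annular (1/2) 2 0 (bump chi)"
    using annular_bump[OF assms, of 1 0] by (simp del: annular.simps)
  note ann = this ann'
  have bd: "\<exists>B>0. \<forall>r. \<bar>u r\<bar> \<le> B" if "annular (1/2) 2 0 u" for u :: "real \<Rightarrow> real"
  proof -
    have "compact (u ` {-2..2})" using that
      by (intro compact_continuous_image) (auto intro: continuous_on_subset)
    then obtain B where B: "B > 0" "\<forall>x\<in>u ` {-2..2}. norm x \<le> B"
      using compact_imp_bounded bounded_pos by blast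
    have "\<bar>u r\<bar> \<le> B" for r
    proof (cases "r \<in> {-2..2}")
      case False
      then have "u r = 0" by (intro annular_support[OF that]) auto
      then show ?thesis using B by simp
    qed (use B in auto)
    then show ?thesis using B(1) by (intro exI[of _ B] conjI allI)
  qed
  from bd[OF ann(1)] obtain B1 where B1: "B1 > 0 \<and> (\<forall>r. \<bar>bump chi r\<bar> \<le> B1)" ..
  from bd[OF ann(2)] obtain B2 where B2: "B2 > 0 \<and> (\<forall>r. \<bar>b' r\<bar> \<le> B2)" ..
  have "continuous_on UNIV b'" using annular_continuous[OF ann(2)] .
  moreover have "B1 + B2 > 0" "\<bar>bump chi r\<bar> \<le> B1 + B2" "\<bar>b' r\<bar> \<le> B1 + B2" for r
    using conjunct1[OF B1] spec[OF conjunct2[OF B1], of r] conjunct1[OF B2] spec[OF conjunct2[OF B2], of r]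
    by linarith+
  ultimately show ?thesis by (rule that[OF b'])
qed

lemma amplitude_bump:
  assumes chi: "cutoff chi"
  shows "\<exists>B>0. \<forall>L\<ge>2. (\<exists>\<psi>'. amplitude L (B / L) (\<lambda>r. bump chi (r / L)) \<psi>') \<and>
    (\<exists>\<psi>'. amplitude L B (\<lambda>r. r * bump chi (r / L)) \<psi>')"
proof -
  obtain b' B where b': "\<And>r. (bump chi has_real_derivative b' r) (at r)" "continuous_on UNIV b'"
    "B > 0" "\<And>r. \<bar>bump chi r\<bar> \<le> B" "\<And>r. \<bar>b' r\<bar> \<le> B" using bump_derivative[OF chi] by metis
  have cb: "continuous_on UNIV (bump chi)" using b'(1) by (rule DERIV_continuous_on[OF has_field_derivative_at_within])
  have D: "((\<lambda>r. bump chi (r / L)) has_real_derivative b' (r / L) / L) (at r)" for r L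
  proof -
    have "((\<lambda>r. r / L) has_real_derivative 1 / L) (at r)" by (rule DERIV_cdivide[OF DERIV_ident])
    from DERIV_chain2[OF b'(1) this] show ?thesis by simp
  qed
  have b2: "bump chi 2 = 0" using cutoff_zero[OF chi, of 2] cutoff_zero[OF chi, of 4] by (simp add: bump_def)
  have cL: "continuous_on UNIV (\<lambda>r. g (r / L))" if "continuous_on UNIV g" "L \<ge> 2" for g :: "real \<Rightarrow> real" and L :: real
    using that by (intro continuous_on_compose2[OF that(1)]) (auto intro!: continuous_intros)
  have 1: "\<exists>\<psi>'. amplitude L ((3 * B) / L) (\<lambda>r. bump chi (r / L)) \<psi>'" if L: "L \<ge> 2" for L
  proof -
    have "amplitude L ((3 * B) / L) (\<lambda>r. bump chi (r / L)) (\<lambda>r. b' (r / L) / L)"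
    proof
      show "continuous_on UNIV (\<lambda>r. b' (r / L) / L)" using L by (intro continuous_intros cL b'(2)) auto
      have "\<bar>b' (r / L)\<bar> \<le> 3 * B" for r using b'(5)[of "r / L"] b'(3) by linarith
      then show "\<bar>b' (r / L) / L\<bar> \<le> 3 * B / L" for r using L by (simp add: divide_right_mono)
    qed (use L D b2 in auto)
    then show ?thesis by blast
  qed
  have 2: "\<exists>\<psi>'. amplitude L (3 * B) (\<lambda>r. r * bump chi (r / L)) \<psi>'" if L: "L \<ge> 2" for L
  proof -
    have "amplitude L (3 * B) (\<lambda>r. r * bump chi (r / L)) (\<lambda>r. bump chi (r / L) + (r / L) * b' (r / L))"
    proof
      show "((\<lambda>r. r * bump chi (r / L)) has_real_derivative bump chi (r / L) + (r / L) * b' (r / L)) (at r)" for r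
        using DERIV_mult[OF DERIV_ident D[of L r]] by (simp add: add.commute mult.commute)
      show "continuous_on UNIV (\<lambda>r. bump chi (r / L) + (r / L) * b' (r / L))"
        using L by (intro continuous_intros cL b'(2) cb) auto
      show "\<bar>bump chi (r / L) + (r / L) * b' (r / L)\<bar> \<le> 3 * B" if r: "r \<in> {L/2..2*L}" for r
      proof -
        have "\<bar>r / L\<bar> \<le> 2" using r L by (simp add: divide_le_eq)
        then have "\<bar>r / L\<bar> * \<bar>b' (r / L)\<bar> \<le> 2 * B" using b'(3) b'(5)[of "r / L"] by (intro mult_mono) auto
        then have "\<bar>(r / L) * b' (r / L)\<bar> \<le> 2 * B" by (simp only: abs_mult)
        with b'(4)[of "r / L"] show ?thesis by (intro order.trans[OF abs_triangle_ineq]) linarith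
      qed
    qed (use L b2 in auto)
    then show ?thesis by blast
  qed
  have "3 * B > 0" using b'(3) by simp
  with 1 2 show ?thesis by blast
qed

lemma integral_even_annulus:
  fixes G :: "real \<Rightarrow> complex"
  assumes ab: "0 < a" "a \<le> b" and supp: "\<And>r. \<bar>r\<bar> \<notin> {a..b} \<Longrightarrow> G r = 0"
    and c: "continuous_on {a..b} G" "continuous_on {a..b} (\<lambda>r. G (- r))"
  shows "(LINT r|lborel. G r) = integral {a..b} G + integral {a..b} (\<lambda>r. G (- r))"
proof -
  have c2: "continuous_on {-b..-a} G"
  proof -
    have "continuous_on {-b..-a} (\<lambda>r::real. - r)" by (intro continuous_intros)
    from continuous_on_compose2[OF c(2) this] show ?thesis by auto
  qed
  have i1: "set_integrable lborel {a..b} G" and i2: "set_integrable lborel {-b..-a} G"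
    using c(1) c2 by (auto intro: borel_integrable_atLeastAtMost')
  have eq: "G r = indicator {a..b} r *\<^sub>R G r + indicator {-b..-a} r *\<^sub>R G r" for r
    using supp[of r] ab by (auto simp: indicator_def abs_if split: if_splits)
  have "(LINT r|lborel. G r) = (LINT r:{a..b}|lborel. G r) + (LINT r:{-b..-a}|lborel. G r)"
    using i1 i2 unfolding set_integrable_def set_lebesgue_integral_def
    by (subst eq) (rule Bochner_Integration.integral_add)
  also have "(LINT r:{a..b}|lborel. G r) = integral {a..b} G" by (rule set_borel_integral_eq_integral(2)[OF i1])
  also have "(LINT r:{-b..-a}|lborel. G r) = integral {-b..-a} G" by (rule set_borel_integral_eq_integral(2)[OF i2])
  also have "\<dots> = integral {a..b} (\<lambda>r. G (- r))"
    using Henstock_Kurzweil_Integration.integral_reflect_real[of b a "\<lambda>r. G (- r)"] by simp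
  finally show ?thesis .
qed

lemma dyadic_ge_2: "dyadic L \<Longrightarrow> L > 1 \<Longrightarrow> L \<ge> 2"
proof -
  assume "dyadic L" and L: "L > 1"
  then obtain k :: int where k: "L = 2 powi k" unfolding dyadic_def by blast
  have "k \<ge> 1"
  proof (rule ccontr)
    assume "\<not> k \<ge> 1"
    then have "(2::real) powi k \<le> 2 powi 0" by (intro power_int_increasing) auto
    then show False using k L by simp
  qed
  then have "(2::real) powi 1 \<le> 2 powi k" by (intro power_int_increasing) auto
  then show ?thesis using k by simp
qed

text \<open>The left-hand side is the gain from the second derivative test in the form in which the test produces it.\<close>

lemma decay_factor_le:
  assumes "L \<ge> 2" "s \<noteq> 0"
  shows "sqrt (sqrt (2 * L) ^ 3 / \<bar>s\<bar>) \<le> 2 * (L powr (3/4) * \<bar>s\<bar> powr (-1/2))"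
proof -
  have "sqrt (sqrt (2 * L) ^ 3) = (2 * L) powr (3/4)"
    using assms by (simp add: powr_half_sqrt[symmetric] powr_powr powr_realpow[symmetric])
  also have "\<dots> = 2 powr (3/4) * L powr (3/4)" using assms by (simp add: powr_mult)
  also have "\<dots> \<le> 2 powr 1 * L powr (3/4)" by (intro mult_right_mono powr_mono) auto
  finally have 1: "sqrt (sqrt (2 * L) ^ 3) \<le> 2 * L powr (3/4)" by simp
  have "1 / sqrt \<bar>s\<bar> = \<bar>s\<bar> powr (-1/2)"
    using assms by (simp add: powr_minus_divide powr_half_sqrt)
  moreover have "sqrt (sqrt (2 * L) ^ 3 / \<bar>s\<bar>) = sqrt (sqrt (2 * L) ^ 3) * (1 / sqrt \<bar>s\<bar>)"
    by (simp add: real_sqrt_divide)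
  ultimately have "sqrt (sqrt (2 * L) ^ 3 / \<bar>s\<bar>) = sqrt (sqrt (2 * L) ^ 3) * \<bar>s\<bar> powr (-1/2)"
    by (simp only:)
  then show ?thesis using mult_right_mono[OF 1, of "\<bar>s\<bar> powr (-1/2)"] by simp
qed

section \<open>The kernel in one dimension\<close>

text \<open>Since \<open>m1\<close> is odd, the negative frequencies give the same radial integral with \<open>x\<close> and \<open>s\<close>
replaced by their negatives.\<close>

lemma dispersive_kernel_1:
  assumes chi: "cutoff chi"
  shows "\<exists>C>0. \<forall>L s x. L \<ge> 2 \<longrightarrow> s \<noteq> 0 \<longrightarrow>
    norm (inv_fourier (\<lambda>\<xi>::real. cis (- (s * m1 \<xi>)) * of_real (bump chi (norm \<xi> / L))) x)
      \<le> C * L powr (3/4) * \<bar>s\<bar> powr (-1/2)"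
proof -
  obtain B where B: "B > 0" "\<forall>L\<ge>2. (\<exists>\<psi>'. amplitude L (B / L) (\<lambda>r. bump chi (r / L)) \<psi>') \<and>
    (\<exists>\<psi>'. amplitude L B (\<lambda>r. r * bump chi (r / L)) \<psi>')"
    using amplitude_bump[OF chi] by (elim exE conjE)
  have "norm (inv_fourier (\<lambda>\<xi>::real. cis (- (s * m1 \<xi>)) * of_real (bump chi (norm \<xi> / L))) x)
      \<le> (240 * B) * L powr (3/4) * \<bar>s\<bar> powr (-1/2)" if L: "L \<ge> 2" and s: "s \<noteq> 0" for L s x
  proof -
    obtain \<psi>' where "amplitude L (B / L) (\<lambda>r. bump chi (r / L)) \<psi>'" using B(2) L by blast
    then interpret amplitude L "B / L" "\<lambda>r. bump chi (r / L)" \<psi>' .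
    define \<Lambda> where "\<Lambda> = sqrt (sqrt (2 * L) ^ 3 / \<bar>s\<bar>)"
    define R where "R y s = integral {L/2..2*L} (\<lambda>r. cis (y * r - s * disp r) * of_real (bump chi (r / L)))" for y s
    have R: "norm (R y s') \<le> 60 * \<Lambda> * B" if "\<bar>s'\<bar> = \<bar>s\<bar>" for y s'
      using second_derivative_bound[of s' y] that s L by (simp add: R_def \<Lambda>_def)
    define G where "G \<xi> = cis (x * \<xi>) * (cis (- (s * m1 \<xi>)) * of_real (bump chi (norm \<xi> / L)))" for \<xi>
    have G1: "G r = cis (x * r - s * disp r) * of_real (bump chi (r / L))"
      and G2: "G (- r) = cis ((- x) * r - (- s) * disp r) * of_real (bump chi (r / L))" if "r \<in> {L/2..2*L}" for r
      using that L m1_eq_disp(1)[of r] m1_eq_disp(2)[of r] by (simp_all add: G_def cis_mult flip: mult.assoc)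
    have c\<psi>: "continuous_on {L/2..2*L} (\<lambda>r. bump chi (r / L))"
      using \<psi> by (intro DERIV_continuous_on[OF has_field_derivative_at_within])
    have "(LINT \<xi>|lborel. G \<xi>) = integral {L/2..2*L} G + integral {L/2..2*L} (\<lambda>r. G (- r))"
    proof (rule integral_even_annulus)
      show "G r = 0" if "\<bar>r\<bar> \<notin> {L/2..2*L}" for r
        using that L bump_support[OF chi, of "\<bar>r\<bar> / L"] by (simp add: G_def field_simps)
      have "continuous_on {L/2..2*L} (\<lambda>r. cis (x * r - s * disp r) * of_real (bump chi (r / L)))"
        by (intro continuous_on_mult continuous_on_of_real c\<psi> continuous_on_phase L)
      then show "continuous_on {L/2..2*L} G" by (rule continuous_on_eq) (rule G1[symmetric])
      have "continuous_on {L/2..2*L} (\<lambda>r. cis ((- x) * r - (- s) * disp r) * of_real (bump chi (r / L)))"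
        by (intro continuous_on_mult continuous_on_of_real c\<psi> continuous_on_phase L)
      then show "continuous_on {L/2..2*L} (\<lambda>r. G (- r))" by (rule continuous_on_eq) (rule G2[symmetric])
    qed (use L in auto)
    also have "integral {L/2..2*L} G = R x s"
      unfolding R_def using G1 by (intro Henstock_Kurzweil_Integration.integral_cong)
    also have "integral {L/2..2*L} (\<lambda>r. G (- r)) = R (- x) (- s)"
      unfolding R_def using G2 by (intro Henstock_Kurzweil_Integration.integral_cong)
    finally have eq: "inv_fourier (\<lambda>\<xi>::real. cis (- (s * m1 \<xi>)) * of_real (bump chi (norm \<xi> / L))) x
        = (1 / (2 * pi)) *\<^sub>R (R x s + R (- x) (- s))"
      by (simp add: inv_fourier_def G_def)
    have "norm (R x s + R (- x) (- s)) \<le> 60 * \<Lambda> * B + 60 * \<Lambda> * B"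
      by (intro norm_triangle_mono R) auto
    moreover have "1 / (2 * pi) \<le> 1" using pi_ge_two by simp
    ultimately have "(1 / (2 * pi)) * norm (R x s + R (- x) (- s)) \<le> 1 * (60 * \<Lambda> * B + 60 * \<Lambda> * B)"
      by (intro mult_mono) auto
    also have "\<dots> = 120 * B * \<Lambda>" by simp
    also have "\<dots> \<le> 120 * B * (2 * (L powr (3/4) * \<bar>s\<bar> powr (-1/2)))"
      unfolding \<Lambda>_def using B(1) by (intro mult_left_mono decay_factor_le L s) auto
    finally show ?thesis unfolding eq by simp
  qed
  then show ?thesis using B(1) by (intro exI[of _ "240 * B"]) simp
qed

text \<open>Every dyadic number greater than 1 is at least 2, so the frequencies in question have norm at least 1.\<close>

lemma Linf_estimate:
  fixes mu :: "'a::euclidean_space \<Rightarrow> real"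
  assumes dim: "DIM('a) \<le> 2" and chi: "cutoff chi" and mu: "mu \<in> borel_measurable borel"
    and kernel: "\<exists>C>0. \<forall>L s x. L \<ge> 2 \<longrightarrow> s \<noteq> 0 \<longrightarrow>
      norm (inv_fourier (\<lambda>\<xi>. cis (- (s * mu \<xi>)) * of_real (bump chi (norm \<xi> / L))) x)
        \<le> C * L powr p * \<bar>s\<bar> powr q"
  shows "\<exists>C>0. \<forall>L t. \<forall>f :: 'a \<Rightarrow> complex. dyadic L \<longrightarrow> L > 1 \<longrightarrow> t \<noteq> 0 \<longrightarrow> integrable lborel f \<longrightarrow>
      (\<forall>s\<in>{t, - t}. Linf_norm (propagator mu s (freq_proj chi L f))
        \<le> ereal (C * L powr p * \<bar>t\<bar> powr q * L1_norm f))"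
proof -
  obtain C where "C > 0" and C: "\<forall>L s x. L \<ge> 2 \<longrightarrow> s \<noteq> 0 \<longrightarrow>
      norm (inv_fourier (\<lambda>\<xi>. cis (- (s * mu \<xi>)) * of_real (bump chi (norm \<xi> / L))) x)
        \<le> C * L powr p * \<bar>s\<bar> powr q"
    using kernel by (elim exE conjE)
  show ?thesis
  proof (intro exI[of _ C] conjI allI impI ballI)
    fix L t s :: real and f :: "'a \<Rightarrow> complex"
    assume L: "dyadic L" "L > 1" and t: "t \<noteq> 0" and f: "integrable lborel f" and s: "s \<in> {t, - t}"
    have "L \<ge> 2" using dyadic_ge_2[OF L] .
    moreover have "s \<noteq> 0" and abs: "\<bar>s\<bar> = \<bar>t\<bar>" using s t by auto
    ultimately have "norm (inv_fourier (\<lambda>\<xi>. cis (- (s * mu \<xi>)) * of_real (bump chi (norm \<xi> / L))) x)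
        \<le> C * L powr p * \<bar>t\<bar> powr q" for x
      using C[rule_format, of L s x] unfolding abs by simp
    then show "Linf_norm (propagator mu s (freq_proj chi L f)) \<le> ereal (C * L powr p * \<bar>t\<bar> powr q * L1_norm f)"
      using L(2) by (intro Linf_norm_propagator_freq_proj_le[OF dim chi _ mu f]) auto
  qed fact
qed

section \<open>Polar integration in the plane\<close>

text \<open>It suffices to compare the measures of boxes, and an orthogonal map preserves Lebesgue measure.\<close>

lemma lborel_distr_orthogonal:
  fixes T :: "real ^ 'n::{finite,wellorder} \<Rightarrow> real ^ 'n::_"
  assumes T: "orthogonal_transformation T"
  shows "distr lborel borel T = lborel"
proof (rule lborel_eqI[symmetric])
  have lin: "linear T" and inj: "inj T" and surj: "surj T"
    using T by (auto simp: orthogonal_transformation_linear orthogonal_transformation_inj orthogonal_transformation_surj)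
  have mT [measurable]: "T \<in> borel_measurable borel"
    using lin by (intro borel_measurable_continuous_onI linear_continuous_on) (simp add: linear_conv_bounded_linear)
  define T' where "T' = inv T"
  have T': "orthogonal_transformation T'" unfolding T'_def using T by (rule orthogonal_transformation_inv)
  fix l u :: "real ^ 'n::_" assume lu: "\<And>b. b \<in> Basis \<Longrightarrow> l \<bullet> b \<le> u \<bullet> b"
  have v: "T -` box l u = T' ` box l u"
    unfolding T'_def using inj surj by (simp add: bij_vimage_eq_inv_image bij_def)
  have o: "open (T -` box l u)"
    using lin by (intro open_vimage linear_continuous_on) (auto simp: linear_conv_bounded_linear)
  have lm: "T' ` box l u \<in> lmeasurable" by (rule measurable_orthogonal_image[OF T']) simp
  have "emeasure (distr lborel borel T) (box l u) = emeasure lborel (T' ` box l u)"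
    by (simp add: emeasure_distr v)
  also have "\<dots> = emeasure lebesgue (T' ` box l u)"
    using o unfolding v[symmetric] by (simp add: emeasure_completion)
  also have "\<dots> = ennreal (measure lebesgue (T' ` box l u))"
    by (rule emeasure_eq_measure2) (use lm in \<open>auto simp: fmeasurable_def\<close>)
  also have "measure lebesgue (T' ` box l u) = measure lebesgue (box l u)"
    by (rule measure_orthogonal_image[OF T']) simp
  also have "\<dots> = (\<Prod>b\<in>Basis. (u - l) \<bullet> b)"
    using lu by (simp add: measure_lborel_box_eq)
  finally show "emeasure (distr lborel borel T) (box l u) = ennreal (\<Prod>b\<in>Basis. (u - l) \<bullet> b)" .
qed simp

lemma measurable_vector_2 [measurable]:
  "(\<lambda>(a::real, b::real). vector [a, b] :: real ^ 2) \<in> borel_measurable borel"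
proof -
  have "continuous_on UNIV (\<lambda>p::real \<times> real. \<chi> i. if i = 1 then fst p else snd p :: real ^ 2)"
  proof (intro continuous_on_vec_lambda)
    fix i :: 2
    show "continuous_on UNIV (\<lambda>p::real \<times> real. if i = 1 then fst p else snd p)"
      by (cases "i = 1") (auto intro!: continuous_intros)
  qed
  moreover have "(\<lambda>p::real \<times> real. \<chi> i. if i = 1 then fst p else snd p :: real ^ 2) = (\<lambda>(a, b). vector [a, b])"
    by (auto simp: fun_eq_iff vec_eq_iff forall_2)
  ultimately have "continuous_on UNIV (\<lambda>(a::real, b::real). vector [a, b] :: real ^ 2)" by (simp only:)
  then show ?thesis by (rule borel_measurable_continuous_onI)
qed

lemma lborel_real2:
  "(lborel :: (real ^ 2) measure) = distr lborel borel (\<lambda>(a::real, b::real). vector [a, b])"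
proof (rule lborel_eqI)
  fix l u :: "real ^ 2" assume lu: "\<And>b. b \<in> Basis \<Longrightarrow> l \<bullet> b \<le> u \<bullet> b"
  have Basis: "(Basis :: (real ^ 2) set) = {axis 1 1, axis 2 1}"
    unfolding Basis_vec_def by (auto simp: UNIV_2)
  have le: "l $ 1 \<le> u $ 1" "l $ 2 \<le> u $ 2" using lu[of "axis 1 1"] lu[of "axis 2 1"]
    by (auto simp: Basis inner_axis)
  have "(\<lambda>(a::real, b::real). vector [a, b] :: real ^ 2) -` box l u = {l $ 1<..<u $ 1} \<times> {l $ 2<..<u $ 2}"
    by (auto simp: mem_box_cart forall_2)
  then have "emeasure (distr lborel borel (\<lambda>(a::real, b::real). vector [a, b])) (box l u)
      = emeasure (lborel \<Otimes>\<^sub>M lborel) ({l $ 1<..<u $ 1} \<times> {l $ 2<..<u $ 2})"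
    by (simp add: emeasure_distr lborel_prod)
  also have "\<dots> = ennreal (u $ 1 - l $ 1) * ennreal (u $ 2 - l $ 2)"
    using le by (simp add: lborel.emeasure_pair_measure_Times)
  also have "\<dots> = ennreal (\<Prod>b\<in>Basis. (u - l) \<bullet> b)"
    using le by (simp add: Basis axis_eq_axis inner_axis ennreal_mult)
  finally show "emeasure (distr lborel borel (\<lambda>(a::real, b::real). vector [a, b])) (box l u)
      = ennreal (\<Prod>b\<in>Basis. (u - l) \<bullet> b)" .
qed simp

lemma lborel_real2_integral:
  fixes F :: "real ^ 2 \<Rightarrow> complex"
  assumes F: "integrable lborel F"
  shows "integrable (lborel \<Otimes>\<^sub>M lborel) (\<lambda>(a, b). F (vector [a, b]))"
    and "(LINT \<xi>|lborel. F \<xi>) = (LINT a|lborel. LINT b|lborel. F (vector [a, b]))"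
proof -
  have [measurable]: "F \<in> borel_measurable borel" using F by auto
  have m: "(\<lambda>(a::real, b::real). vector [a, b] :: real ^ 2) \<in> lborel \<rightarrow>\<^sub>M borel" by simp
  show i: "integrable (lborel \<Otimes>\<^sub>M lborel) (\<lambda>(a, b). F (vector [a, b]))"
    using F unfolding lborel_real2 lborel_prod
    by (subst (asm) integrable_distr_eq[OF m]) (simp_all add: case_prod_unfold)
  have "(LINT \<xi>|lborel. F \<xi>) = (LINT p|lborel. F ((\<lambda>(a, b). vector [a, b]) p))"
    unfolding lborel_real2 by (rule integral_distr[OF m]) simp
  also have "\<dots> = (LINT p|(lborel \<Otimes>\<^sub>M lborel). F (vector [fst p, snd p]))"
    unfolding lborel_prod by (simp add: case_prod_unfold)
  also have "\<dots> = (LINT a|lborel. LINT b|lborel. F (vector [a, b]))"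
    using lborel_pair.integral_fst[of "\<lambda>a b. F (vector [a, b])"] i by (simp add: case_prod_unfold)
  finally show "(LINT \<xi>|lborel. F \<xi>) = (LINT a|lborel. LINT b|lborel. F (vector [a, b]))" .
qed

text \<open>This is integration in polar coordinates with the slope \<open>v = tan \<theta>\<close> in place of the angle; the
radius \<open>r\<close> ranges over the whole line and \<open>1 / (1 + v\<^sup>2)\<close> is the density of \<open>d\<theta>\<close>. In this form it needs only
two affine substitutions, \<open>b = a * v\<close> for fixed \<open>a\<close> and \<open>a = r / sqrt (1 + v\<^sup>2)\<close> for fixed \<open>v\<close>, and
Fubini's theorem between them.\<close>

lemma polar_slope_integral:
  fixes g :: "real \<Rightarrow> real \<Rightarrow> complex"
  assumes g: "integrable (lborel \<Otimes>\<^sub>M lborel) (\<lambda>(a, b). g a b)"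
    and gc: "continuous_on UNIV (\<lambda>(a, b). g a b)"
    and gb: "\<And>a. integrable lborel (g a)"
  shows "(LINT a|lborel. LINT b|lborel. g a b) =
     (LINT v|lborel. (1 / (1 + v\<^sup>2)) *\<^sub>R (LINT r|lborel. \<bar>r\<bar> *\<^sub>R g (r / sqrt (1 + v\<^sup>2)) (r * v / sqrt (1 + v\<^sup>2))))"
proof -
  have slope: "(LINT b|lborel. g a b) = (LINT v|lborel. \<bar>a\<bar> *\<^sub>R g a (a * v))" if "a \<noteq> 0" for a
    using lborel_integral_real_affine[OF that, of "g a" 0] that by simp
  have nslope: "(LINT b|lborel. norm (g a b)) = (LINT v|lborel. norm (\<bar>a\<bar> *\<^sub>R g a (a * v)))" if "a \<noteq> 0" for a
    using lborel_integral_real_affine[OF that, of "\<lambda>b. norm (g a b)" 0] that by simp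
  have ae: "AE a in lborel. a \<noteq> (0::real)" by (rule AE_lborel_singleton)
  \<comment> \<open>The integrand after the substitution \<open>b = a * v\<close>, which is valid except on the null set \<open>a = 0\<close>.\<close>
  define k where "k p = \<bar>fst p\<bar> *\<^sub>R g (fst p) (fst p * snd p)" for p :: "real \<times> real"
  have kc: "continuous_on UNIV k"
  proof -
    have "continuous_on UNIV (\<lambda>p::real \<times> real. (fst p, fst p * snd p))" by (intro continuous_intros)
    from continuous_on_compose2[OF gc this] have "continuous_on UNIV (\<lambda>p::real \<times> real. g (fst p) (fst p * snd p))" by simp
    then show ?thesis unfolding k_def by (intro continuous_on_scaleR continuous_on_rabs continuous_on_fst continuous_on_id)
  qed
  then have [measurable]: "k \<in> borel_measurable (lborel \<Otimes>\<^sub>M lborel)"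
    unfolding lborel_prod using borel_measurable_continuous_onI by simp
  have [measurable]: "(\<lambda>(a, b). g a b) \<in> borel_measurable (lborel \<Otimes>\<^sub>M lborel)" using g by auto
  have int: "integrable (lborel \<Otimes>\<^sub>M lborel) k"
  proof (rule lborel_pair.Fubini_integrable)
    have "integrable lborel (\<lambda>a. LINT b|lborel. norm (g a b))"
      using lborel_pair.integrable_fst[of "\<lambda>a b. norm (g a b)"] integrable_norm[OF g] by (simp add: case_prod_unfold)
    moreover have "AE a in lborel. (LINT b|lborel. norm (g a b)) = (LINT v|lborel. norm (k (a, v)))"
      using ae by eventually_elim (simp add: nslope k_def)
    moreover have "(\<lambda>a. LINT v|lborel. norm (k (a, v))) \<in> borel_measurable lborel" by measurable
    moreover have "(\<lambda>a. LINT b|lborel. norm (g a b)) \<in> borel_measurable lborel" by measurable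
    ultimately show "integrable lborel (\<lambda>a. LINT v|lborel. norm (k (a, v)))"
      using integrable_cong_AE by blast
    show "AE a in lborel. integrable lborel (\<lambda>v. k (a, v))"
      using ae
    proof eventually_elim
      case (elim a)
      then show ?case using lborel_integrable_real_affine[OF gb elim, of a 0] by (simp add: k_def)
    qed
  qed measurable
  have "(LINT a|lborel. LINT b|lborel. g a b) = (LINT a|lborel. LINT v|lborel. k (a, v))"
  proof (rule integral_cong_AE)
    show "AE a in lborel. (LINT b|lborel. g a b) = (LINT v|lborel. k (a, v))"
      using ae by eventually_elim (simp add: slope k_def)
  qed measurable
  also have "\<dots> = (LINT v|lborel. LINT a|lborel. k (a, v))"
    using lborel_pair.Fubini_integral[of "\<lambda>a v. k (a, v)"] int by (simp add: case_prod_unfold)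
  also have "\<dots> = (LINT v|lborel. (1 / (1 + v\<^sup>2)) *\<^sub>R (LINT r|lborel. \<bar>r\<bar> *\<^sub>R g (r / sqrt (1 + v\<^sup>2)) (r * v / sqrt (1 + v\<^sup>2))))"
  proof (rule Bochner_Integration.integral_cong[OF refl])
    fix v :: real
    define q where "q = 1 / sqrt (1 + v\<^sup>2)"
    have q: "q > 0" "q * q = 1 / (1 + v\<^sup>2)" by (auto simp: q_def add_pos_nonneg)
    have "(LINT a|lborel. k (a, v)) = \<bar>q\<bar> *\<^sub>R (LINT r|lborel. k (0 + q * r, v))"
      using q by (intro lborel_integral_real_affine) simp
    also have "(LINT r|lborel. k (0 + q * r, v)) = (LINT r|lborel. q *\<^sub>R (\<bar>r\<bar> *\<^sub>R g (r / sqrt (1 + v\<^sup>2)) (r * v / sqrt (1 + v\<^sup>2))))"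
      using q(1) by (simp add: k_def abs_mult q_def)
    also have "\<dots> = q *\<^sub>R (LINT r|lborel. \<bar>r\<bar> *\<^sub>R g (r / sqrt (1 + v\<^sup>2)) (r * v / sqrt (1 + v\<^sup>2)))"
      by (rule Bochner_Integration.integral_scaleR_right)
    finally show "(LINT a|lborel. k (a, v)) = (1 / (1 + v\<^sup>2)) *\<^sub>R (LINT r|lborel. \<bar>r\<bar> *\<^sub>R g (r / sqrt (1 + v\<^sup>2)) (r * v / sqrt (1 + v\<^sup>2)))"
      using q by simp
  qed
  finally show ?thesis .
qed

lemma arctan_substitution:
  fixes F :: "real \<Rightarrow> complex"
  assumes F: "continuous_on UNIV F"
  shows "(LINT v|lborel. (1 / (1 + v\<^sup>2)) *\<^sub>R F (arctan v)) = integral {-(pi/2)..pi/2} F"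
proof -
  have ei: "einterval (-\<infinity>) \<infinity> = UNIV" by (auto simp: einterval_def)
  have cont: "isCont F x" for x using F by (simp add: continuous_on_eq_continuous_at)
  have iF: "set_integrable lborel {-(pi/2)..pi/2} F"
    using F by (intro borel_integrable_atLeastAtMost') (auto intro: continuous_on_subset)
  have "compact (F ` {-(pi/2)..pi/2})"
    using F by (intro compact_continuous_image) (auto intro: continuous_on_subset)
  then obtain B where B: "B > 0" "\<forall>x\<in>F ` {-(pi/2)..pi/2}. norm x \<le> B"
    using compact_imp_bounded bounded_pos by blast
  have FB: "norm (F (arctan v)) \<le> B" for v using B(2) arctan_bounded[of v] by (simp add: less_imp_le)
  have meas: "(\<lambda>v. inverse (1 + v\<^sup>2) *\<^sub>R F (arctan v)) \<in> borel_measurable lborel"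
  proof -
    have "continuous_on UNIV (\<lambda>v. F (arctan v))"
      by (rule continuous_on_compose2[OF F]) (auto intro: continuous_on_arctan)
    then have "continuous_on UNIV (\<lambda>v. inverse (1 + v\<^sup>2) *\<^sub>R F (arctan v))"
      by (intro continuous_on_scaleR continuous_on_inverse continuous_on_add continuous_on_const continuous_on_power continuous_on_id)
        (auto simp: add_nonneg_eq_0_iff)
    then show ?thesis using borel_measurable_continuous_onI by simp
  qed
  have w: "integrable lborel (\<lambda>v::real. inverse (1 + v\<^sup>2))"
    using integrable_inverse_1_plus_square by (simp add: set_integrable_def ei)
  have i2: "integrable lborel (\<lambda>v. inverse (1 + v\<^sup>2) *\<^sub>R F (arctan v))"
  proof (rule Bochner_Integration.integrable_bound[OF integrable_mult_right[OF w, of B] meas], rule AE_I2)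
    fix v :: real
    have "norm (F (arctan v)) * inverse (1 + v\<^sup>2) \<le> B * inverse (1 + v\<^sup>2)"
      by (intro mult_right_mono FB) (simp add: add_pos_nonneg)
    then show "norm (inverse (1 + v\<^sup>2) *\<^sub>R F (arctan v)) \<le> norm (B * inverse (1 + v\<^sup>2))"
      using B(1) by (simp add: abs_mult mult.commute)
  qed
  have "(LBINT \<theta>=ereal (-(pi/2))..ereal (pi/2). F \<theta>) = (LBINT v=-\<infinity>..\<infinity>. inverse (1 + v\<^sup>2) *\<^sub>R F (arctan v))"
  proof (rule interval_integral_substitution_integrable)
    show "(arctan has_real_derivative inverse (1 + v\<^sup>2)) (at v)" for v by (rule DERIV_arctan)
    show "isCont (\<lambda>v. inverse (1 + v\<^sup>2)) v" for v :: real
      by (intro continuous_intros) (auto simp: add_nonneg_eq_0_iff)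
    show "((ereal \<circ> arctan \<circ> real_of_ereal) \<longlongrightarrow> ereal (-(pi/2))) (at_right (-\<infinity>))"
      unfolding comp_assoc ereal_tendsto_simps using tendsto_arctan_at_bot by (simp add: ereal_tendsto_simps)
    show "((ereal \<circ> arctan \<circ> real_of_ereal) \<longlongrightarrow> ereal (pi/2)) (at_left \<infinity>)"
      unfolding comp_assoc ereal_tendsto_simps using tendsto_arctan_at_top by (simp add: ereal_tendsto_simps)
    show "set_integrable lborel (einterval (-\<infinity>) \<infinity>) (\<lambda>v. inverse (1 + v\<^sup>2) *\<^sub>R F (arctan v))"
      using i2 by (simp add: set_integrable_def ei)
    show "set_integrable lborel (einterval (ereal (-(pi/2))) (ereal (pi/2))) F"
      using iF by (rule set_integrable_subset) auto
  qed (use cont in auto)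
  also have "\<dots> = (LINT v|lborel. (1 / (1 + v\<^sup>2)) *\<^sub>R F (arctan v))"
    by (simp add: interval_lebesgue_integral_def set_lebesgue_integral_def ei inverse_eq_divide)
  also have "(LBINT \<theta>=ereal (-(pi/2))..ereal (pi/2). F \<theta>) = integral {-(pi/2)..pi/2} F"
    using iF by (intro interval_integral_eq_integral) auto
  finally show ?thesis ..
qed

lemma continuous_oscillatory_integral:
  fixes c :: "real \<Rightarrow> complex"
  assumes "continuous_on {\<alpha>..\<beta>} c"
  shows "continuous_on UNIV (\<lambda>y. integral {\<alpha>..\<beta>} (\<lambda>r. cis (y * r) * c r))"
proof -
  have "continuous_on (UNIV \<times> cbox \<alpha> \<beta>) (\<lambda>p::real \<times> real. c (snd p))"
    by (rule continuous_on_compose2[OF assms]) (auto intro: continuous_on_snd continuous_on_id)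
  then have "continuous_on (UNIV \<times> cbox \<alpha> \<beta>) (\<lambda>p::real \<times> real. cis (fst p * snd p) * c (snd p))"
    by (intro continuous_on_mult continuous_on_cis continuous_on_fst continuous_on_snd continuous_on_id)
  then have "continuous_on (UNIV \<times> cbox \<alpha> \<beta>) (\<lambda>(y::real, r). cis (y * r) * c r)"
    by (simp add: case_prod_unfold)
  from integral_continuous_on_param[OF this] show ?thesis by simp
qed

text \<open>Rotating \<open>x\<close> to the first axis leaves \<open>a0 (norm \<xi>)\<close> unchanged and makes the plane wave a function
of the first coordinate \<open>r * cos \<theta>\<close> only. The two terms of \<open>Q\<close> come from the positive and
the negative \<open>r\<close> on each line through the origin.\<close>

lemma radial_plane_wave_integral:
  fixes a0 :: "real \<Rightarrow> complex" and x :: "real ^ 2"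
  assumes \<alpha>: "0 < \<alpha>" "\<alpha> \<le> \<beta>" and a0: "continuous_on UNIV a0" "\<And>r. \<bar>r\<bar> \<notin> {\<alpha>..\<beta>} \<Longrightarrow> a0 r = 0"
  defines "Q \<equiv> \<lambda>y. integral {\<alpha>..\<beta>} (\<lambda>r. cis (y * r) * (of_real r * a0 r)) +
                   integral {\<alpha>..\<beta>} (\<lambda>r. cis ((- y) * r) * (of_real r * a0 r))"
  shows "(LINT \<xi>|lborel. cis (x \<bullet> \<xi>) * a0 (norm \<xi>)) = integral {-(pi/2)..pi/2} (\<lambda>\<theta>. Q (norm x * cos \<theta>))"
proof -
  define X where "X = norm x"
  define F where "F y \<xi> = cis (y \<bullet> \<xi>) * a0 (norm \<xi>)" for y \<xi> :: "real ^ 2"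
  have Fc: "continuous_on UNIV (F y)" for y unfolding F_def
    by (intro continuous_on_mult continuous_on_cis continuous_on_inner continuous_on_const continuous_on_id
        continuous_on_compose2[OF a0(1) continuous_on_norm_id]) auto
  have Fi: "integrable lborel (F y)" for y
    by (rule integrable_continuous_compact_support[OF Fc, of \<beta>]) (use a0(2) in \<open>auto simp: F_def\<close>)
  have "norm (X *\<^sub>R axis 1 1 :: real ^ 2) = norm x" by (simp add: X_def)
  then obtain T :: "real ^ 2 \<Rightarrow> real ^ 2" where T: "orthogonal_transformation T" "T (X *\<^sub>R axis 1 1) = x"
    by (rule orthogonal_transformation_exists)
  have "(LINT \<xi>|lborel. F x \<xi>) = (LINT \<xi>|distr lborel borel T. F x \<xi>)"
    by (simp add: lborel_distr_orthogonal[OF T(1)])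
  also have "\<dots> = (LINT \<xi>|lborel. F x (T \<xi>))"
  proof (rule integral_distr)
    have "linear T" using T(1) by (rule orthogonal_transformation_linear)
    then show "T \<in> lborel \<rightarrow>\<^sub>M borel"
      using borel_measurable_continuous_onI[OF linear_continuous_on, of T] by (simp add: linear_conv_bounded_linear)
    show "F x \<in> borel_measurable borel" using Fc by (rule borel_measurable_continuous_onI)
  qed
  also have "(\<lambda>\<xi>. F x (T \<xi>)) = F (X *\<^sub>R axis 1 1)"
  proof
    fix \<xi>
    have "x \<bullet> T \<xi> = (X *\<^sub>R axis 1 1) \<bullet> \<xi>"
      using T by (metis orthogonal_transformation_def)
    moreover have "norm (T \<xi>) = norm \<xi>" using T(1) by (simp add: orthogonal_transformation)
    ultimately show "F x (T \<xi>) = F (X *\<^sub>R axis 1 1) \<xi>" by (simp add: F_def)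
  qed
  also have "(LINT \<xi>|lborel. F (X *\<^sub>R axis 1 1) \<xi>) = (LINT a|lborel. LINT b|lborel. F (X *\<^sub>R axis 1 1) (vector [a, b]))"
    by (rule lborel_real2_integral(2)[OF Fi])
  also have "\<dots> = (LINT a|lborel. LINT b|lborel. cis (X * a) * a0 (sqrt (a\<^sup>2 + b\<^sup>2)))"
    by (simp add: F_def inner_axis' norm_vec_def L2_set_def sum_2)
  also have "\<dots> = (LINT v|lborel. (1 / (1 + v\<^sup>2)) *\<^sub>R (LINT r|lborel. \<bar>r\<bar> *\<^sub>R
      (cis (X * (r / sqrt (1 + v\<^sup>2))) * a0 (sqrt ((r / sqrt (1 + v\<^sup>2))\<^sup>2 + (r * v / sqrt (1 + v\<^sup>2))\<^sup>2)))))"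
  proof (rule polar_slope_integral[of "\<lambda>a b. cis (X * a) * a0 (sqrt (a\<^sup>2 + b\<^sup>2))"])
    show "integrable (lborel \<Otimes>\<^sub>M lborel) (\<lambda>(a, b). cis (X * a) * a0 (sqrt (a\<^sup>2 + b\<^sup>2)))"
      using lborel_real2_integral(1)[OF Fi[of "X *\<^sub>R axis 1 1"]]
      by (simp add: F_def inner_axis' norm_vec_def L2_set_def sum_2)
    have c: "continuous_on UNIV (\<lambda>p::real \<times> real. sqrt ((fst p)\<^sup>2 + (snd p)\<^sup>2))" by (intro continuous_intros)
    have "continuous_on UNIV (\<lambda>p::real \<times> real. cis (X * fst p) * a0 (sqrt ((fst p)\<^sup>2 + (snd p)\<^sup>2)))"
      by (intro continuous_on_mult continuous_on_cis continuous_on_fst continuous_on_const continuous_on_id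
          continuous_on_compose2[OF a0(1) c]) auto
    then show "continuous_on UNIV (\<lambda>(a, b). cis (X * a) * a0 (sqrt (a\<^sup>2 + b\<^sup>2)))" by (simp add: case_prod_unfold)
    show "integrable lborel (\<lambda>b. cis (X * a) * a0 (sqrt (a\<^sup>2 + b\<^sup>2)))" for a
    proof (rule integrable_continuous_compact_support)
      have c: "continuous_on UNIV (\<lambda>b. sqrt (a\<^sup>2 + b\<^sup>2))" by (intro continuous_intros)
      show "continuous_on UNIV (\<lambda>b. cis (X * a) * a0 (sqrt (a\<^sup>2 + b\<^sup>2)))"
        by (intro continuous_on_mult continuous_on_const continuous_on_compose2[OF a0(1) c]) auto
      fix b :: real assume "b \<notin> cball 0 \<beta>"
      then have "\<bar>b\<bar> > \<beta>" by simp
      moreover have "\<bar>b\<bar> \<le> sqrt (a\<^sup>2 + b\<^sup>2)" by (rule real_le_rsqrt) simp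
      ultimately have "\<beta> < sqrt (a\<^sup>2 + b\<^sup>2)" by linarith
      then have "a0 (sqrt (a\<^sup>2 + b\<^sup>2)) = 0" by (intro a0(2)) auto
      then show "cis (X * a) * a0 (sqrt (a\<^sup>2 + b\<^sup>2)) = 0" by simp
    qed
  qed
  also have "\<dots> = (LINT v|lborel. (1 / (1 + v\<^sup>2)) *\<^sub>R Q (X * cos (arctan v)))"
  proof (rule Bochner_Integration.integral_cong[OF refl])
    fix v :: real
    define k where "k = sqrt (1 + v\<^sup>2)"
    have k: "k > 0" "k\<^sup>2 = 1 + v\<^sup>2" by (auto simp: k_def add_pos_nonneg)
    have n: "sqrt ((r / k)\<^sup>2 + (r * v / k)\<^sup>2) = \<bar>r\<bar>" for r
    proof -
      have "(r / k)\<^sup>2 + (r * v / k)\<^sup>2 = r\<^sup>2 * ((1 + v\<^sup>2) / k\<^sup>2)"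
        by (simp add: power_divide power_mult_distrib add_divide_distrib distrib_left)
      moreover have "1 + v\<^sup>2 \<noteq> 0" using k(1) k(2)[symmetric] by simp
      ultimately show ?thesis using k by simp
    qed
    define G where "G r = \<bar>r\<bar> *\<^sub>R (cis (X / k * r) * a0 \<bar>r\<bar>)" for r
    have Gc: "continuous_on UNIV (\<lambda>r. \<bar>r\<bar> *\<^sub>R (cis (y * r) * a0 \<bar>r\<bar>))" for y
      by (intro continuous_on_scaleR continuous_on_mult continuous_on_cis continuous_on_rabs continuous_on_const continuous_on_id
          continuous_on_compose2[OF a0(1), where f = abs]) auto
    have "(LINT r|lborel. G r) = integral {\<alpha>..\<beta>} G + integral {\<alpha>..\<beta>} (\<lambda>r. G (- r))"
    proof (rule integral_even_annulus[OF \<alpha>])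
      show "G r = 0" if "\<bar>r\<bar> \<notin> {\<alpha>..\<beta>}" for r using that a0(2)[of "\<bar>r\<bar>"] by (simp add: G_def)
      show "continuous_on {\<alpha>..\<beta>} G" unfolding G_def using Gc by (rule continuous_on_subset) simp
      show "continuous_on {\<alpha>..\<beta>} (\<lambda>r. G (- r))" unfolding G_def
        using continuous_on_subset[OF Gc[of "- (X / k)"], of "{\<alpha>..\<beta>}"] by simp
    qed
    also have "integral {\<alpha>..\<beta>} G = integral {\<alpha>..\<beta>} (\<lambda>r. cis (X / k * r) * (of_real r * a0 r))"
      using \<alpha> by (intro Henstock_Kurzweil_Integration.integral_cong) (simp add: G_def scaleR_conv_of_real)
    also have "integral {\<alpha>..\<beta>} (\<lambda>r. G (- r)) = integral {\<alpha>..\<beta>} (\<lambda>r. cis ((- (X / k)) * r) * (of_real r * a0 r))"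
      using \<alpha> by (intro Henstock_Kurzweil_Integration.integral_cong) (simp add: G_def scaleR_conv_of_real)
    finally have "(LINT r|lborel. G r) = Q (X * cos (arctan v))"
      by (simp add: Q_def cos_arctan k_def)
    moreover have "(LINT r|lborel. \<bar>r\<bar> *\<^sub>R (cis (X * (r / sqrt (1 + v\<^sup>2))) *
        a0 (sqrt ((r / sqrt (1 + v\<^sup>2))\<^sup>2 + (r * v / sqrt (1 + v\<^sup>2))\<^sup>2)))) = (LINT r|lborel. G r)"
      unfolding k_def[symmetric] n G_def by simp
    ultimately show "(1 / (1 + v\<^sup>2)) *\<^sub>R (LINT r|lborel. \<bar>r\<bar> *\<^sub>R (cis (X * (r / sqrt (1 + v\<^sup>2))) *
        a0 (sqrt ((r / sqrt (1 + v\<^sup>2))\<^sup>2 + (r * v / sqrt (1 + v\<^sup>2))\<^sup>2)))) = (1 / (1 + v\<^sup>2)) *\<^sub>R Q (X * cos (arctan v))"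
      by simp
  qed
  also have "\<dots> = integral {-(pi/2)..pi/2} (\<lambda>\<theta>. Q (X * cos \<theta>))"
  proof (rule arctan_substitution)
    have "continuous_on {\<alpha>..\<beta>} (\<lambda>r. of_real r * a0 r)"
      by (intro continuous_on_mult continuous_on_of_real continuous_on_id continuous_on_subset[OF a0(1)]) simp
    note c = continuous_oscillatory_integral[OF this]
    have "continuous_on UNIV Q" unfolding Q_def
      by (intro continuous_on_add c continuous_on_compose2[OF c, where f = uminus] continuous_on_minus continuous_on_id) auto
    then show "continuous_on UNIV (\<lambda>\<theta>. Q (X * cos \<theta>))"
      by (rule continuous_on_compose2) (auto intro!: continuous_intros)
  qed
  finally show ?thesis by (simp add: F_def X_def)
qed

section \<open>Integration in the angle\<close>

lemma half_le_sin:
  assumes "0 \<le> x" "x \<le> 1" shows "x / 2 \<le> sin (x::real)"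
proof -
  have "sin 0 - 0 / 2 \<le> sin x - x / 2"
  proof (rule DERIV_nonneg_imp_nondecreasing[OF assms(1)])
    fix y assume y: "0 \<le> y" "y \<le> x"
    have "cos y \<ge> cos (pi / 3)"
      using y assms pi_gt3 by (intro cos_monotone_0_pi_le) auto
    then have "cos y \<ge> 1 / 2" by (simp add: cos_60)
    then show "\<exists>d. ((\<lambda>x. sin x - x / 2) has_real_derivative d) (at y) \<and> 0 \<le> d"
      by (intro exI[of _ "cos y - 1 / 2"]) (auto intro!: derivative_eq_intros)
  qed
  then show ?thesis by simp
qed

lemma sin_pos_on_quarter: "0 < \<delta> \<Longrightarrow> \<theta> \<in> {\<delta>..pi/2} \<Longrightarrow> sin \<theta> > 0"
  by (intro sin_gt_zero) auto

lemma integral_cos_over_sin_squared: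
  assumes "0 < \<delta>" "\<delta> \<le> pi / 2"
  shows "((\<lambda>\<theta>. cos \<theta> / (sin \<theta>)\<^sup>2) has_integral (1 / sin \<delta> - 1)) {\<delta>..pi/2}"
proof -
  have "((\<lambda>\<theta>. cos \<theta> / (sin \<theta>)\<^sup>2) has_integral (- 1 / sin (pi/2) - (- 1 / sin \<delta>))) {\<delta>..pi/2}"
  proof (rule fundamental_theorem_of_calculus[OF assms(2)])
    fix \<theta> assume \<theta>: "\<theta> \<in> {\<delta>..pi/2}"
    have "((\<lambda>\<theta>. - 1 / sin \<theta>) has_real_derivative (0 * sin \<theta> - (- 1) * cos \<theta>) / (sin \<theta> * sin \<theta>)) (at \<theta>)"
      using sin_pos_on_quarter[OF assms(1) \<theta>] by (intro DERIV_divide DERIV_const DERIV_sin) auto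
    then show "((\<lambda>\<theta>. - 1 / sin \<theta>) has_vector_derivative cos \<theta> / (sin \<theta>)\<^sup>2) (at \<theta> within {\<delta>..pi/2})"
      by (simp add: power2_eq_square has_real_derivative_iff_has_vector_derivative[symmetric] has_field_derivative_at_within)
  qed
  then show ?thesis by simp
qed

text \<open>Integration by parts: \<open>cis (\<rho> * cos \<theta>)\<close> is its own derivative divided by \<open>- \<i> * \<rho> * sin \<theta>\<close>. The gain is
the factor \<open>1 / \<rho>\<close>, at the cost of the weight \<open>cos \<theta> / (sin \<theta>)\<^sup>2\<close>.\<close>

lemma angular_phase_integral:
  assumes \<rho>: "\<rho> \<noteq> 0" and \<delta>: "0 < \<delta>" "\<delta> \<le> pi / 2"
  shows "integral {\<delta>..pi/2} (\<lambda>\<theta>. cis (\<rho> * cos \<theta>)) = (\<i> / of_real \<rho>) *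
     (1 - cis (\<rho> * cos \<delta>) / of_real (sin \<delta>) + integral {\<delta>..pi/2} (\<lambda>\<theta>. of_real (cos \<theta> / (sin \<theta>)\<^sup>2) * cis (\<rho> * cos \<theta>)))"
proof -
  define \<Phi> where "\<Phi> \<theta> = cis (\<rho> * cos \<theta>) * of_real (1 / sin \<theta>)" for \<theta>
  have nz: "sin \<theta> \<noteq> 0" if "\<theta> \<in> {\<delta>..pi/2}" for \<theta> using sin_pos_on_quarter[OF \<delta>(1) that] by simp
  have c1: "continuous_on {\<delta>..pi/2} (\<lambda>\<theta>. cis (\<rho> * cos \<theta>))" by (intro continuous_intros)
  have c2: "continuous_on {\<delta>..pi/2} (\<lambda>\<theta>. complex_of_real (cos \<theta> / (sin \<theta>)\<^sup>2) * cis (\<rho> * cos \<theta>))"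
    using nz by (intro continuous_intros) auto
  have "((\<lambda>\<theta>. - (\<i> * of_real \<rho>) * cis (\<rho> * cos \<theta>) - of_real (cos \<theta> / (sin \<theta>)\<^sup>2) * cis (\<rho> * cos \<theta>)) has_integral \<Phi> (pi/2) - \<Phi> \<delta>) {\<delta>..pi/2}"
  proof (rule fundamental_theorem_of_calculus[OF \<delta>(2)])
    fix \<theta> assume \<theta>: "\<theta> \<in> {\<delta>..pi/2}"
    have a: "((\<lambda>\<theta>. \<rho> * cos \<theta>) has_real_derivative \<rho> * (- sin \<theta>)) (at \<theta> within {\<delta>..pi/2})"
      by (intro DERIV_cmult has_field_derivative_at_within[OF DERIV_cos])
    have "((\<lambda>\<theta>. 1 / sin \<theta>) has_real_derivative (0 * sin \<theta> - 1 * cos \<theta>) / (sin \<theta> * sin \<theta>)) (at \<theta> within {\<delta>..pi/2})"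
      using nz[OF \<theta>] by (intro DERIV_divide DERIV_const has_field_derivative_at_within[OF DERIV_sin])
    from has_vector_derivative_of_real[OF this]
    have b: "((\<lambda>\<theta>. complex_of_real (1 / sin \<theta>)) has_vector_derivative of_real ((0 * sin \<theta> - 1 * cos \<theta>) / (sin \<theta> * sin \<theta>))) (at \<theta> within {\<delta>..pi/2})" .
    show "(\<Phi> has_vector_derivative - (\<i> * of_real \<rho>) * cis (\<rho> * cos \<theta>) - of_real (cos \<theta> / (sin \<theta>)\<^sup>2) * cis (\<rho> * cos \<theta>)) (at \<theta> within {\<delta>..pi/2})"
      unfolding \<Phi>_def
      by (rule has_vector_derivative_eq_rhs[OF has_vector_derivative_mult[OF cis_has_vector_derivative[OF a] b]])
        (use nz[OF \<theta>] in \<open>simp add: field_simps power2_eq_square\<close>)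
  qed
  from integral_unique[OF this]
  have "- (\<i> * of_real \<rho>) * integral {\<delta>..pi/2} (\<lambda>\<theta>. cis (\<rho> * cos \<theta>)) - integral {\<delta>..pi/2} (\<lambda>\<theta>. of_real (cos \<theta> / (sin \<theta>)\<^sup>2) * cis (\<rho> * cos \<theta>))
      = \<Phi> (pi/2) - \<Phi> \<delta>"
    by (subst (asm) integral_diff[OF integrable_continuous_interval[OF continuous_on_mult_left[OF c1]]
          integrable_continuous_interval[OF c2]]) (simp only: Henstock_Kurzweil_Integration.integral_mult_right)
  then have "- (\<i> * of_real \<rho>) * integral {\<delta>..pi/2} (\<lambda>\<theta>. cis (\<rho> * cos \<theta>)) =
      \<Phi> (pi/2) - \<Phi> \<delta> + integral {\<delta>..pi/2} (\<lambda>\<theta>. of_real (cos \<theta> / (sin \<theta>)\<^sup>2) * cis (\<rho> * cos \<theta>))"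
    by (simp only: diff_eq_eq)
  then have "(\<i> / of_real \<rho>) * (- (\<i> * of_real \<rho>) * integral {\<delta>..pi/2} (\<lambda>\<theta>. cis (\<rho> * cos \<theta>))) = (\<i> / of_real \<rho>) *
     (\<Phi> (pi/2) - \<Phi> \<delta> + integral {\<delta>..pi/2} (\<lambda>\<theta>. of_real (cos \<theta> / (sin \<theta>)\<^sup>2) * cis (\<rho> * cos \<theta>)))"
    by (simp only:)
  moreover have "(\<i> / of_real \<rho>) * (- (\<i> * of_real \<rho>) * z) = z" for z
    using \<rho> by simp
  ultimately show ?thesis by (simp add: \<Phi>_def)
qed

lemma swap_continuous_intervals:
  fixes f :: "real \<Rightarrow> real \<Rightarrow> complex"
  assumes "continuous_on ({a..b} \<times> {c..d}) (\<lambda>p. f (fst p) (snd p))"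
  shows "integral {a..b} (\<lambda>x. integral {c..d} (f x)) = integral {c..d} (\<lambda>y. integral {a..b} (\<lambda>x. f x y))"
  using integral_swap_continuous[of a c b d f] assms by (simp add: case_prod_unfold cbox_Pair_eq)

text \<open>The integration by parts in the angle is carried out for fixed \<open>r\<close>, with \<open>\<rho> = X * r\<close>. The factor \<open>1 / r\<close>
that it produces cancels the polar volume element \<open>r\<close>. All remaining terms are superpositions
of the same type of radial integral \<open>S\<close>, to which an estimate uniform in \<open>y\<close> can be applied afterwards.\<close>

lemma angular_integration_by_parts:
  fixes w :: "real \<Rightarrow> complex"
  assumes \<alpha>: "0 < \<alpha>" and w: "continuous_on {\<alpha>..\<beta>} w" and X: "X \<noteq> 0" and \<delta>: "0 < \<delta>" "\<delta> \<le> pi / 2"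
  defines "R \<equiv> \<lambda>y. integral {\<alpha>..\<beta>} (\<lambda>r. cis (y * r) * (of_real r * w r))"
  defines "S \<equiv> \<lambda>y. integral {\<alpha>..\<beta>} (\<lambda>r. cis (y * r) * w r)"
  shows "integral {\<delta>..pi/2} (\<lambda>\<theta>. R (X * cos \<theta>)) = (\<i> / of_real X) *
     (S 0 - S (X * cos \<delta>) / of_real (sin \<delta>) + integral {\<delta>..pi/2} (\<lambda>\<theta>. of_real (cos \<theta> / (sin \<theta>)\<^sup>2) * S (X * cos \<theta>)))"
proof -
  let ?I = "{\<delta>..pi/2}" and ?J = "{\<alpha>..\<beta>}"
  have nz: "sin \<theta> \<noteq> 0" if "\<theta> \<in> ?I" for \<theta> using sin_pos_on_quarter[OF \<delta>(1) that] by simp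
  have cw: "continuous_on (?I \<times> ?J) (\<lambda>p. w (snd p))"
    by (rule continuous_on_compose2[OF w continuous_on_snd[OF continuous_on_id]]) auto
  have cc: "continuous_on (?I \<times> ?J) (\<lambda>p. cis (X * cos (fst p) * snd p))"
    by (intro continuous_intros)
  have cs: "continuous_on (?I \<times> ?J) (\<lambda>p. complex_of_real (cos (fst p) / (sin (fst p))\<^sup>2))"
    using nz by (intro continuous_intros) auto
  have cS: "continuous_on ?I (\<lambda>\<theta>. S (X * cos \<theta>))" unfolding S_def
    by (rule continuous_on_compose2[OF continuous_oscillatory_integral[OF w]]) (auto intro!: continuous_intros)
  have iw: "(\<lambda>r. cis (y * r) * w r) integrable_on ?J" for y
    by (intro integrable_continuous_interval continuous_on_mult w continuous_intros)
  define V where "V r = integral ?I (\<lambda>\<theta>. of_real (cos \<theta> / (sin \<theta>)\<^sup>2) * (cis (X * cos \<theta> * r) * w r))" for r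
  have "continuous_on (?I \<times> ?J) (\<lambda>p. complex_of_real (cos (fst p) / (sin (fst p))\<^sup>2) * (cis (X * cos (fst p) * snd p) * w (snd p)))"
    by (intro continuous_on_mult cs cc cw)
  note cV = this
  have V: "integral ?J V = integral ?I (\<lambda>\<theta>. of_real (cos \<theta> / (sin \<theta>)\<^sup>2) * S (X * cos \<theta>))"
    unfolding V_def S_def using swap_continuous_intervals[OF cV] by simp
  have iV: "V integrable_on ?J"
  proof -
    have "continuous_on (?J \<times> ?I) (\<lambda>p. complex_of_real (cos (snd p) / (sin (snd p))\<^sup>2) * (cis (X * cos (snd p) * fst p) * w (fst p)))"
    proof -
      have "continuous_on (?J \<times> ?I) (\<lambda>p. (snd p, fst p))" by (intro continuous_intros)
      from continuous_on_compose2[OF cV this] show ?thesis by (simp add: image_subset_iff)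
    qed
    then have "continuous_on (?J \<times> cbox \<delta> (pi/2)) (\<lambda>(r, \<theta>). complex_of_real (cos \<theta> / (sin \<theta>)\<^sup>2) * (cis (X * cos \<theta> * r) * w r))"
      by (simp add: case_prod_unfold)
    from integral_continuous_on_param[OF this] show ?thesis
      unfolding V_def[abs_def] by (intro integrable_continuous_interval) simp
  qed
  have "integral ?I (\<lambda>\<theta>. R (X * cos \<theta>)) = integral ?J (\<lambda>r. integral ?I (\<lambda>\<theta>. cis (X * cos \<theta> * r) * (of_real r * w r)))"
    unfolding R_def
    by (rule swap_continuous_intervals) (intro continuous_on_mult cc cw continuous_on_of_real continuous_on_snd continuous_on_id)
  also have "\<dots> = integral ?J (\<lambda>r. (\<i> / of_real X) * (cis (0 * r) * w r - (cis (X * cos \<delta> * r) * w r) / of_real (sin \<delta>) + V r))"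
  proof (rule Henstock_Kurzweil_Integration.integral_cong)
    fix r assume "r \<in> ?J"
    then have r: "r \<noteq> 0" using \<alpha> by auto
    have "integral ?I (\<lambda>\<theta>. cis (X * cos \<theta> * r) * (of_real r * w r)) =
        integral ?I (\<lambda>\<theta>. cis ((X * r) * cos \<theta>)) * (of_real r * w r)"
      by (simp add: mult_ac)
    also have "\<dots> = (\<i> / of_real (X * r)) * (1 - cis ((X * r) * cos \<delta>) / of_real (sin \<delta>) +
        integral ?I (\<lambda>\<theta>. of_real (cos \<theta> / (sin \<theta>)\<^sup>2) * cis ((X * r) * cos \<theta>))) * (of_real r * w r)"
      using X r by (subst angular_phase_integral[OF _ \<delta>]) auto
    also have "\<dots> = (\<i> / of_real X) * (w r - (cis (X * cos \<delta> * r) * w r) / of_real (sin \<delta>) +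
        integral ?I (\<lambda>\<theta>. of_real (cos \<theta> / (sin \<theta>)\<^sup>2) * cis ((X * r) * cos \<theta>)) * w r)"
    proof -
      have *: "(\<i> / of_real (X * r)) * A * (of_real r * w r) = (\<i> / of_real X) * (A * w r)" for A
        using r by simp
      show ?thesis unfolding * by (simp add: algebra_simps)
    qed
    also have "integral ?I (\<lambda>\<theta>. of_real (cos \<theta> / (sin \<theta>)\<^sup>2) * cis ((X * r) * cos \<theta>)) * w r = V r"
      unfolding V_def Henstock_Kurzweil_Integration.integral_mult_left[symmetric]
      by (simp add: mult_ac)
    finally show "integral ?I (\<lambda>\<theta>. cis (X * cos \<theta> * r) * (of_real r * w r)) =
       (\<i> / of_real X) * (cis (0 * r) * w r - (cis (X * cos \<delta> * r) * w r) / of_real (sin \<delta>) + V r)" by simp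
  qed
  also have "\<dots> = (\<i> / of_real X) * integral ?J (\<lambda>r. (cis (0 * r) * w r - (cis (X * cos \<delta> * r) * w r) / of_real (sin \<delta>)) + V r)"
    by (rule Henstock_Kurzweil_Integration.integral_mult_right)
  also have "integral ?J (\<lambda>r. (cis (0 * r) * w r - (cis (X * cos \<delta> * r) * w r) / of_real (sin \<delta>)) + V r) =
      (integral ?J (\<lambda>r. cis (0 * r) * w r) - integral ?J (\<lambda>r. (cis (X * cos \<delta> * r) * w r) / of_real (sin \<delta>))) + integral ?J V"
    by (subst Henstock_Kurzweil_Integration.integral_add, intro integrable_diff iw integrable_on_divide iV, rule iV,
        subst Henstock_Kurzweil_Integration.integral_diff, rule iw, intro integrable_on_divide iw, rule refl)
  also have "integral ?J (\<lambda>r. (cis (X * cos \<delta> * r) * w r) / of_real (sin \<delta>)) = S (X * cos \<delta>) / of_real (sin \<delta>)"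
    unfolding S_def by (rule Henstock_Kurzweil_Integration.integral_divide)
  finally show ?thesis unfolding V by (simp add: S_def)
qed

text \<open>The total weight of the radial integrals \<open>S\<close> in the preceding identity is \<open>2 / sin \<delta>\<close>, which is at most \<open>4 / \<delta>\<close>.\<close>

lemma angular_integral_bound:
  fixes w :: "real \<Rightarrow> complex"
  assumes \<alpha>: "0 < \<alpha>" and w: "continuous_on {\<alpha>..\<beta>} w" and X: "X \<noteq> 0" and \<delta>: "0 < \<delta>" "\<delta> \<le> 1"
    and \<sigma>: "\<And>y. norm (integral {\<alpha>..\<beta>} (\<lambda>r. cis (y * r) * w r)) \<le> \<sigma>"
  shows "norm (integral {\<delta>..pi/2} (\<lambda>\<theta>. integral {\<alpha>..\<beta>} (\<lambda>r. cis (X * cos \<theta> * r) * (of_real r * w r)))) \<le> 4 * \<sigma> / (\<bar>X\<bar> * \<delta>)"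
proof -
  define S where "S y = integral {\<alpha>..\<beta>} (\<lambda>r. cis (y * r) * w r)" for y
  have S: "norm (S y) \<le> \<sigma>" for y using \<sigma> by (simp add: S_def)
  have \<sigma>0: "\<sigma> \<ge> 0" using S[of 0] norm_ge_zero order_trans by blast
  have \<delta>2: "\<delta> \<le> pi / 2" using \<delta> pi_ge_two by simp
  have s: "\<delta> / 2 \<le> sin \<delta>" using half_le_sin \<delta> by simp
  then have s0: "sin \<delta> > 0" using \<delta> by simp
  have cS: "continuous_on {\<delta>..pi/2} (\<lambda>\<theta>. S (X * cos \<theta>))" unfolding S_def
    by (rule continuous_on_compose2[OF continuous_oscillatory_integral[OF w]]) (auto intro!: continuous_intros)
  note I = integral_cos_over_sin_squared[OF \<delta>(1) \<delta>2]
  let ?T = "integral {\<delta>..pi/2} (\<lambda>\<theta>. complex_of_real (cos \<theta> / (sin \<theta>)\<^sup>2) * S (X * cos \<theta>))"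
  have I2: "((\<lambda>\<theta>. cos \<theta> / (sin \<theta>)\<^sup>2 * \<sigma>) has_integral ((1 / sin \<delta> - 1) * \<sigma>)) {\<delta>..pi/2}"
    using I by (rule has_integral_mult_left)
  have "norm ?T \<le> integral {\<delta>..pi/2} (\<lambda>\<theta>. cos \<theta> / (sin \<theta>)\<^sup>2 * \<sigma>)"
  proof (rule integral_norm_bound_integral)
    have "continuous_on {\<delta>..pi/2} (\<lambda>\<theta>. complex_of_real (cos \<theta> / (sin \<theta>)\<^sup>2))"
      using sin_pos_on_quarter[OF \<delta>(1)] by (intro continuous_intros) (force dest: less_imp_neq)
    then show "(\<lambda>\<theta>. complex_of_real (cos \<theta> / (sin \<theta>)\<^sup>2) * S (X * cos \<theta>)) integrable_on {\<delta>..pi/2}"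
      by (intro integrable_continuous_interval continuous_on_mult cS)
    show "(\<lambda>\<theta>. cos \<theta> / (sin \<theta>)\<^sup>2 * \<sigma>) integrable_on {\<delta>..pi/2}" using I2 by (rule has_integral_integrable)
    fix \<theta> assume "\<theta> \<in> {\<delta>..pi/2}"
    then have "cos \<theta> / (sin \<theta>)\<^sup>2 \<ge> 0" using \<delta> by (intro divide_nonneg_nonneg cos_ge_zero) auto
    then have "norm (complex_of_real (cos \<theta> / (sin \<theta>)\<^sup>2)) = cos \<theta> / (sin \<theta>)\<^sup>2" by (simp only: norm_of_real abs_of_nonneg)
    then show "norm (complex_of_real (cos \<theta> / (sin \<theta>)\<^sup>2) * S (X * cos \<theta>)) \<le> cos \<theta> / (sin \<theta>)\<^sup>2 * \<sigma>"
      using S[of "X * cos \<theta>"] \<open>cos \<theta> / (sin \<theta>)\<^sup>2 \<ge> 0\<close> by (simp only: norm_mult) (rule mult_left_mono)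
  qed
  also have "\<dots> = (1 / sin \<delta> - 1) * \<sigma>" using I2 by (rule integral_unique)
  finally have T: "norm ?T \<le> \<sigma> / sin \<delta> - \<sigma>" by (simp add: algebra_simps)
  have "norm (S 0 - S (X * cos \<delta>) / of_real (sin \<delta>) + ?T) \<le> norm (S 0) + norm (S (X * cos \<delta>) / of_real (sin \<delta>)) + norm ?T"
    by (meson norm_triangle_ineq norm_triangle_ineq4 add_right_mono order_trans)
  also have "norm (S (X * cos \<delta>) / of_real (sin \<delta>)) \<le> \<sigma> / sin \<delta>"
    using S[of "X * cos \<delta>"] s0 by (simp add: norm_divide divide_right_mono)
  finally have "norm (S 0 - S (X * cos \<delta>) / of_real (sin \<delta>) + ?T) \<le> 2 * \<sigma> / sin \<delta>"
    using S[of 0] T by simp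
  also have "\<dots> \<le> 2 * \<sigma> / (\<delta> / 2)" using s \<delta> \<sigma>0 by (intro divide_left_mono) auto
  finally have "(1 / \<bar>X\<bar>) * norm (S 0 - S (X * cos \<delta>) / of_real (sin \<delta>) + ?T) \<le> (1 / \<bar>X\<bar>) * (2 * \<sigma> / (\<delta> / 2))"
    by (intro mult_left_mono) auto
  moreover have "norm (integral {\<delta>..pi/2} (\<lambda>\<theta>. integral {\<alpha>..\<beta>} (\<lambda>r. cis (X * cos \<theta> * r) * (of_real r * w r)))) =
      (1 / \<bar>X\<bar>) * norm (S 0 - S (X * cos \<delta>) / of_real (sin \<delta>) + ?T)"
    unfolding angular_integration_by_parts[OF \<alpha> w X \<delta>(1) \<delta>2] S_def[symmetric] by (simp add: norm_mult norm_divide)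
  ultimately show ?thesis by simp
qed

section \<open>The kernel in two dimensions\<close>

text \<open>Here \<open>R\<close> is the radial integral with the polar volume element, \<open>S\<close> the one without it, and \<open>Z X\<close>
the integral of \<open>R (X * cos \<theta>)\<close> over a quarter circle; by symmetry the kernel is a multiple of
\<open>Z (norm x) + Z (- norm x)\<close>. The number \<open>E = L powr (3 / 2) / \<bar>s\<bar>\<close> is the size to be reached and \<open>\<Lambda>\<close> the
gain from the second derivative test.\<close>

lemma dispersive_kernel_2:
  assumes chi: "cutoff chi"
  shows "\<exists>C>0. \<forall>L s x. L \<ge> 2 \<longrightarrow> s \<noteq> 0 \<longrightarrow>
    norm (inv_fourier (\<lambda>\<xi>::real^2. cis (- (s * m2 \<xi>)) * of_real (bump chi (norm \<xi> / L))) x)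
      \<le> C * L powr (3/2) * \<bar>s\<bar> powr (-1)"
proof -
  obtain B where B: "B > 0" "\<forall>L\<ge>2. (\<exists>\<psi>'. amplitude L (B / L) (\<lambda>r. bump chi (r / L)) \<psi>') \<and>
    (\<exists>\<psi>'. amplitude L B (\<lambda>r. r * bump chi (r / L)) \<psi>')"
    using amplitude_bump[OF chi] by (elim exE conjE)
  have "norm (inv_fourier (\<lambda>\<xi>::real^2. cis (- (s * m2 \<xi>)) * of_real (bump chi (norm \<xi> / L))) x)
      \<le> (7200 * B) * L powr (3/2) * \<bar>s\<bar> powr (-1)" if L: "L \<ge> 2" and s: "s \<noteq> 0" for L s x
  proof -
    obtain \<psi>1 where A1: "amplitude L (B / L) (\<lambda>r. bump chi (r / L)) \<psi>1" using B(2) L by blast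
    obtain \<psi>2 where A2: "amplitude L B (\<lambda>r. r * bump chi (r / L)) \<psi>2" using B(2) L by blast
    define \<Lambda> where "\<Lambda> = sqrt (sqrt (2 * L) ^ 3 / \<bar>s\<bar>)"
    define E where "E = L * sqrt L / \<bar>s\<bar>"
    have E0: "E \<ge> 0" using L by (simp add: E_def)
    define w where "w r = cis (- (s * disp r)) * complex_of_real (bump chi (r / L))" for r
    define R where "R y = integral {L/2..2*L} (\<lambda>r. cis (y * r) * (of_real r * w r))" for y
    define S where "S y = integral {L/2..2*L} (\<lambda>r. cis (y * r) * w r)" for y
    have Req: "R y = integral {L/2..2*L} (\<lambda>r. cis (y * r - s * disp r) * of_real (r * bump chi (r / L)))" for y
      unfolding R_def w_def
      by (rule Henstock_Kurzweil_Integration.integral_cong) (simp add: diff_conv_add_uminus cis_mult[symmetric] mult_ac del: add_uminus_conv_diff)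
    have Seq: "S y = integral {L/2..2*L} (\<lambda>r. cis (y * r - s * disp r) * of_real (bump chi (r / L)))" for y
      unfolding S_def w_def
      by (rule Henstock_Kurzweil_Integration.integral_cong) (simp add: diff_conv_add_uminus cis_mult[symmetric] mult_ac del: add_uminus_conv_diff)
    have R2: "norm (R y) \<le> 60 * \<Lambda> * (L * B)" for y
      unfolding Req \<Lambda>_def by (rule amplitude.second_derivative_bound[OF A2 s])
    have R1: "norm (R y) \<le> 48 * (sqrt (2 * L) / \<bar>s\<bar>) * (L * B)" if "\<bar>y\<bar> \<le> \<bar>s\<bar> / (8 * sqrt (2 * L))" for y
      unfolding Req by (rule amplitude.first_derivative_bound[OF A2 s that])
    have S2: "norm (S y) \<le> 60 * \<Lambda> * B" for y
      using amplitude.second_derivative_bound[OF A1 s, of y] L unfolding Seq \<Lambda>_def by simp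
    have wc: "continuous_on UNIV w"
    proof -
      have "continuous_on UNIV (\<lambda>r. bump chi (r / L))"
        using amplitude.\<psi>[OF A1] by (rule DERIV_continuous_on[OF has_field_derivative_at_within])
      then show ?thesis unfolding w_def[abs_def]
        by (intro continuous_on_mult continuous_on_cis continuous_on_of_real continuous_on_minus continuous_on_const continuous_on_disp(1))
    qed
    have wc': "continuous_on {L/2..2*L} w" by (rule continuous_on_subset[OF wc]) simp
    have rwc: "continuous_on {L/2..2*L} (\<lambda>r. of_real r * w r)"
      by (intro continuous_on_mult continuous_on_of_real continuous_on_id wc')
    have Rc: "continuous_on UNIV R" unfolding R_def by (rule continuous_oscillatory_integral[OF rwc])
    have Rcc: "continuous_on T (\<lambda>\<theta>. R (X * cos \<theta>))" for X T
      by (rule continuous_on_compose2[OF Rc]) (auto intro!: continuous_intros)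
    define Z where "Z X = integral {0..pi/2} (\<lambda>\<theta>. R (X * cos \<theta>))" for X
    have pi2: "pi / 2 - 0 \<le> 2" "0 \<le> pi / 2" using pi_less_4 by auto
    have Zint: "norm (Z X) \<le> K * 2" if "\<And>\<theta>. norm (R (X * cos \<theta>)) \<le> K" for X K
    proof -
      have "norm (Z X) \<le> K * (pi / 2 - 0)" unfolding Z_def by (rule integral_bound[OF pi2(2) Rcc]) (rule that)
      also have "\<dots> \<le> K * 2" using that[of 0] norm_ge_zero order_trans by (intro mult_left_mono pi2(1)) blast
      finally show ?thesis .
    qed
    \<comment> \<open>The radial bound \<open>\<Lambda> * L\<close> restricted to angles of measure \<open>d\<close> is acceptable as soon as
      \<open>d\<^sup>2\<close> is at most of order \<open>1 / (sqrt L * \<bar>s\<bar>)\<close>.\<close>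
    have size: "\<Lambda> * L * d \<le> 6 * E" if d: "0 \<le> d" "d\<^sup>2 \<le> 8 * sqrt (2 * L) / (L * \<bar>s\<bar>)" for d
    proof (rule power2_le_imp_le)
      have q: "sqrt (2 * L) ^ 3 * sqrt (2 * L) = 4 * L\<^sup>2"
      proof -
        have "sqrt (2 * L) ^ 3 * sqrt (2 * L) = ((sqrt (2 * L))\<^sup>2)\<^sup>2"
          by (simp only: power2_eq_square power3_eq_cube mult.assoc)
        then show ?thesis using L by (simp add: power_mult_distrib)
      qed
      have "(\<Lambda> * L * d)\<^sup>2 = (sqrt (2 * L) ^ 3 / \<bar>s\<bar>) * L\<^sup>2 * d\<^sup>2"
        using L by (simp add: \<Lambda>_def power_mult_distrib)
      also have "\<dots> \<le> (sqrt (2 * L) ^ 3 / \<bar>s\<bar>) * L\<^sup>2 * (8 * sqrt (2 * L) / (L * \<bar>s\<bar>))"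
        using L d by (intro mult_left_mono) auto
      also have "\<dots> = 8 * L * (sqrt (2 * L) ^ 3 * sqrt (2 * L)) / \<bar>s\<bar>\<^sup>2"
        using L by (simp add: field_simps power2_eq_square)
      also have "\<dots> = 32 * (L\<^sup>2 * L) / \<bar>s\<bar>\<^sup>2" unfolding q by simp
      also have "\<dots> \<le> 36 * (L\<^sup>2 * L) / \<bar>s\<bar>\<^sup>2" using L by (intro divide_right_mono mult_right_mono) auto
      also have "\<dots> = (6 * E)\<^sup>2" using L by (simp add: E_def power_mult_distrib power_divide)
      finally show "(\<Lambda> * L * d)\<^sup>2 \<le> (6 * E)\<^sup>2" .
    qed (use E0 in simp)
    have Z: "norm (Z X) \<le> 1800 * B * E" for X
    proof (cases "\<bar>X\<bar> \<le> \<bar>s\<bar> / (8 * sqrt (2 * L))")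
      case True
      have "norm (R (X * cos \<theta>)) \<le> 48 * (sqrt (2 * L) / \<bar>s\<bar>) * (L * B)" for \<theta>
      proof (rule R1)
        have "\<bar>X * cos \<theta>\<bar> \<le> \<bar>X\<bar> * 1" unfolding abs_mult by (intro mult_left_mono) auto
        then show "\<bar>X * cos \<theta>\<bar> \<le> \<bar>s\<bar> / (8 * sqrt (2 * L))" using True by simp
      qed
      from Zint[OF this] have "norm (Z X) \<le> 96 * sqrt 2 * (B * E)"
        by (simp add: E_def real_sqrt_mult mult_ac)
      also have "\<dots> \<le> 96 * 2 * (B * E)"
        using B(1) E0 sqrt2_less_2 by (intro mult_right_mono mult_left_mono) auto
      also have "\<dots> \<le> 1800 * B * E" using B(1) E0 by (simp add: mult_ac)
      finally show ?thesis .
    next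
      case False
      then have X: "\<bar>s\<bar> < 8 * sqrt (2 * L) * \<bar>X\<bar>" using L by (simp add: not_le divide_less_eq mult_ac)
      then have X0: "X \<noteq> 0" by auto
      show ?thesis
      proof (cases "L * \<bar>X\<bar> < 1")
        case True
        \<comment> \<open>Here \<open>s\<close> is so small that the radial bound, applied at every angle, suffices.\<close>
        have "L * \<bar>s\<bar> \<le> L * (8 * sqrt (2 * L) * \<bar>X\<bar>)" using X L by (intro mult_left_mono) auto
        also have "\<dots> = 8 * sqrt (2 * L) * (L * \<bar>X\<bar>)" by simp
        also have "\<dots> \<le> 8 * sqrt (2 * L) * 1" using True L by (intro mult_left_mono) auto
        finally have "1\<^sup>2 \<le> 8 * sqrt (2 * L) / (L * \<bar>s\<bar>)" using L s by (simp add: le_divide_eq)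
        from size[OF _ this] have "\<Lambda> * L \<le> 6 * E" by simp
        then have "120 * B * (\<Lambda> * L) \<le> 120 * B * (6 * E)" using B(1) by (intro mult_left_mono) auto
        moreover have "norm (Z X) \<le> 120 * B * (\<Lambda> * L)" using Zint[OF R2, of X] by (simp add: mult_ac)
        moreover have "120 * B * (6 * E) \<le> 1800 * B * E" using B(1) E0 by (simp add: mult_ac)
        ultimately show ?thesis by linarith
      next
        case False
        \<comment> \<open>The phase \<open>X * r * cos \<theta>\<close> with \<open>r\<close> of order \<open>L\<close> is almost stationary in \<open>\<theta>\<close> for angles
          up to this size.\<close>
        define \<delta> where "\<delta> = sqrt (1 / (L * \<bar>X\<bar>))"
        have LX: "L * \<bar>X\<bar> \<ge> 1" using False by simp
        have \<delta>: "0 < \<delta>" "\<delta> \<le> 1" using LX L X0 by (auto simp: \<delta>_def divide_le_eq)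
        have \<delta>2: "\<delta>\<^sup>2 = 1 / (L * \<bar>X\<bar>)" using LX by (simp add: \<delta>_def)
        have "1 / (L * \<bar>X\<bar>) \<le> 8 * sqrt (2 * L) / (L * \<bar>s\<bar>)"
          using X L s X0 by (simp add: divide_simps mult_ac)
        then have sz: "\<Lambda> * L * \<delta> \<le> 6 * E" using \<delta> \<delta>2 by (intro size) auto
        have \<delta>pi: "\<delta> \<le> pi / 2" using \<delta> pi_ge_two by simp
        have "Z X = integral {0..\<delta>} (\<lambda>\<theta>. R (X * cos \<theta>)) + integral {\<delta>..pi/2} (\<lambda>\<theta>. R (X * cos \<theta>))"
          unfolding Z_def using \<delta> \<delta>pi
          by (intro Henstock_Kurzweil_Integration.integral_combine[symmetric] integrable_continuous_interval Rcc) auto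
        moreover have "norm (integral {0..\<delta>} (\<lambda>\<theta>. R (X * cos \<theta>))) \<le> 60 * \<Lambda> * (L * B) * (\<delta> - 0)"
          using \<delta> by (intro integral_bound Rcc R2) auto
        moreover have "norm (integral {\<delta>..pi/2} (\<lambda>\<theta>. R (X * cos \<theta>))) \<le> 4 * (60 * \<Lambda> * B) / (\<bar>X\<bar> * \<delta>)"
          unfolding R_def using L S2 by (intro angular_integral_bound wc' X0 \<delta>) (auto simp: S_def)
        moreover have "4 * (60 * \<Lambda> * B) / (\<bar>X\<bar> * \<delta>) = 240 * \<Lambda> * (L * B) * \<delta>"
        proof -
          have "1 / (\<bar>X\<bar> * \<delta>) = L * \<delta>"
            using \<delta>(1) \<delta>2 L X0 by (simp add: field_simps power2_eq_square)
          then have "4 * (60 * \<Lambda> * B) * (1 / (\<bar>X\<bar> * \<delta>)) = 4 * (60 * \<Lambda> * B) * (L * \<delta>)" by (simp only:)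
          then show ?thesis by (simp add: mult_ac)
        qed
        ultimately have "norm (Z X) \<le> 60 * \<Lambda> * (L * B) * (\<delta> - 0) + 240 * \<Lambda> * (L * B) * \<delta>"
          by (simp only:) (rule order.trans[OF norm_triangle_ineq add_mono])
        also have "\<dots> = 300 * B * (\<Lambda> * L * \<delta>)" by (simp add: mult_ac)
        also have "\<dots> \<le> 300 * B * (6 * E)" using B(1) by (intro mult_left_mono sz) auto
        finally show ?thesis by (simp add: mult_ac)
      qed
    qed
    have sym: "integral {-(pi/2)..pi/2} (\<lambda>\<theta>. R (X * cos \<theta>)) = 2 * Z X" for X
    proof -
      have "integral {-(pi/2)..pi/2} (\<lambda>\<theta>. R (X * cos \<theta>)) = integral {-(pi/2)..0} (\<lambda>\<theta>. R (X * cos \<theta>)) + Z X"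
        unfolding Z_def by (intro Henstock_Kurzweil_Integration.integral_combine[symmetric] integrable_continuous_interval Rcc) auto
      also have "integral {-(pi/2)..0} (\<lambda>\<theta>. R (X * cos \<theta>)) = Z X"
        unfolding Z_def using Henstock_Kurzweil_Integration.integral_reflect_real[of "pi/2" 0 "\<lambda>\<theta>. R (X * cos \<theta>)"] by simp
      finally show ?thesis by simp
    qed
    have "(LINT \<xi>|lborel. cis (x \<bullet> \<xi>) * w (norm \<xi>)) = integral {-(pi/2)..pi/2} (\<lambda>\<theta>. R (norm x * cos \<theta>) + R (- (norm x * cos \<theta>)))"
      unfolding R_def
    proof (rule radial_plane_wave_integral[OF _ _ wc])
      show "w r = 0" if "\<bar>r\<bar> \<notin> {L/2..2*L}" for r
        using that L bump_support[OF chi, of "r / L"] by (simp add: w_def field_simps)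
    qed (use L in auto)
    also have "\<dots> = integral {-(pi/2)..pi/2} (\<lambda>\<theta>. R (norm x * cos \<theta>)) + integral {-(pi/2)..pi/2} (\<lambda>\<theta>. R (- norm x * cos \<theta>))"
      using Rcc[of _ "- norm x"]
      by (subst Henstock_Kurzweil_Integration.integral_add) (auto intro!: integrable_continuous_interval Rcc)
    also have "\<dots> = 2 * Z (norm x) + 2 * Z (- norm x)" by (simp only: sym)
    finally have I: "(LINT \<xi>|lborel. cis (x \<bullet> \<xi>) * w (norm \<xi>)) = 2 * Z (norm x) + 2 * Z (- norm x)" .
    have "norm (2 * Z (norm x) + 2 * Z (- norm x)) \<le> norm (2 * Z (norm x)) + norm (2 * Z (- norm x))"
      by (rule norm_triangle_ineq)
    also have "\<dots> \<le> 2 * (1800 * B * E) + 2 * (1800 * B * E)"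
      unfolding norm_mult by (intro add_mono mult_mono Z) auto
    finally have n: "norm (2 * Z (norm x) + 2 * Z (- norm x)) \<le> 7200 * B * E" by simp
    have "inv_fourier (\<lambda>\<xi>::real^2. cis (- (s * m2 \<xi>)) * of_real (bump chi (norm \<xi> / L))) x
        = (1 / (2 * pi) ^ 2) *\<^sub>R (2 * Z (norm x) + 2 * Z (- norm x))"
      unfolding inv_fourier_def I[symmetric] by (simp add: m2_eq_disp w_def)
    then have "norm (inv_fourier (\<lambda>\<xi>::real^2. cis (- (s * m2 \<xi>)) * of_real (bump chi (norm \<xi> / L))) x)
        = (1 / (2 * pi) ^ 2) * norm (2 * Z (norm x) + 2 * Z (- norm x))" by simp
    also have "\<dots> \<le> 1 * (7200 * B * E)"
    proof (intro mult_mono n)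
      have "1 \<le> (2 * pi) ^ 2" using pi_ge_two by (intro one_le_power) simp
      then show "1 / (2 * pi) ^ 2 \<le> 1" by simp
    qed auto
    also have "E = L powr (3/2) * \<bar>s\<bar> powr (-1)"
    proof -
      have "L powr (3/2) = L powr (1 + 1/2)" by simp
      also have "\<dots> = L * sqrt L" using L unfolding powr_add by (simp add: powr_half_sqrt)
      finally have "L powr (3/2) = L * sqrt L" .
      moreover have "\<bar>s\<bar> powr (-1) = 1 / \<bar>s\<bar>" by (subst powr_minus_divide) simp
      ultimately show ?thesis by (simp only: E_def times_divide_eq_right mult_1_right)
    qed
    finally show ?thesis by simp
  qed
  then show ?thesis using B(1) by (intro exI[of _ "7200 * B"]) simp
qed

theorem lemma9:
  fixes chi :: "real \<Rightarrow> real"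
  assumes "cutoff chi"
  shows "(\<exists>C>0. \<forall>L t. \<forall>f :: real \<Rightarrow> complex.
            dyadic L \<longrightarrow> L > 1 \<longrightarrow> t \<noteq> 0 \<longrightarrow> integrable lborel f \<longrightarrow>
            (\<forall>s\<in>{t, - t}. Linf_norm (propagator m1 s (freq_proj chi L f))
               \<le> ereal (C * L powr (3 * 1 / 4) * \<bar>t\<bar> powr (- (1 / 2)) * L1_norm f)))
       \<and> (\<exists>C>0. \<forall>L t. \<forall>f :: real ^ 2 \<Rightarrow> complex.
            dyadic L \<longrightarrow> L > 1 \<longrightarrow> t \<noteq> 0 \<longrightarrow> integrable lborel f \<longrightarrow>
            (\<forall>s\<in>{t, - t}. Linf_norm (propagator m2 s (freq_proj chi L f))
               \<le> ereal (C * L powr (3 * 2 / 4) * \<bar>t\<bar> powr (- (2 / 2)) * L1_norm f)))"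
proof
  have [measurable]: "(tanh :: real \<Rightarrow> real) \<in> borel_measurable borel"
    by (intro borel_measurable_continuous_onI continuous_intros) simp
  have "m1 \<in> borel_measurable borel" unfolding m1_def[abs_def] by measurable
  from Linf_estimate[OF _ assms this dispersive_kernel_1[OF assms]] show "\<exists>C>0. \<forall>L t. \<forall>f :: real \<Rightarrow> complex.
            dyadic L \<longrightarrow> L > 1 \<longrightarrow> t \<noteq> 0 \<longrightarrow> integrable lborel f \<longrightarrow>
            (\<forall>s\<in>{t, - t}. Linf_norm (propagator m1 s (freq_proj chi L f))
               \<le> ereal (C * L powr (3 * 1 / 4) * \<bar>t\<bar> powr (- (1 / 2)) * L1_norm f))"
    by simp
next
  have "continuous_on UNIV (\<lambda>\<xi>::real^2. disp (norm \<xi>))"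
    by (rule continuous_on_compose2[OF continuous_on_disp(1) continuous_on_norm_id]) simp
  then have "m2 \<in> borel_measurable borel"
    unfolding m2_eq_disp[symmetric] by (rule borel_measurable_continuous_onI)
  from Linf_estimate[OF _ assms this dispersive_kernel_2[OF assms]] show "\<exists>C>0. \<forall>L t. \<forall>f :: real ^ 2 \<Rightarrow> complex.
            dyadic L \<longrightarrow> L > 1 \<longrightarrow> t \<noteq> 0 \<longrightarrow> integrable lborel f \<longrightarrow>
            (\<forall>s\<in>{t, - t}. Linf_norm (propagator m2 s (freq_proj chi L f))
               \<le> ereal (C * L powr (3 * 2 / 4) * \<bar>t\<bar> powr (- (2 / 2)) * L1_norm f))"
    by simp
qed

end
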